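(* Let $(T(t))_{t\in\Delta}$ be a $C_0$-semigroup on $E$, let $f:[0,\infty)\to[1,\infty)$ be an increasing mapping and $m_k=f(k)$, $k\in\mathbb N_0$. Set $A_{k,n}^f:=[\lfloor m_{k+n}\rfloor-\lfloor m_k\rfloor-1,\ \lfloor m_{k+n}\rfloor-\lfloor m_k\rfloor]$ for $k,n\in\mathbb N$, and $B_{k,n}^f:=[\lfloor m_k\rfloor-\lfloor m_{k-n}\rfloor,\ \lfloor m_k\rfloor-\lfloor m_{k-n}\rfloor+1]$ for $k,n\in\mathbb N$, $k\ge n$. Suppose that there exist a dense subset $E_0$ of $E$ such that $T(t)E_0\subseteq E_0$ for $t\in\Delta$, and mappings $S(t):E_0\to E_0$ ($t\in\Delta$) such that: (i) $T(t)S(t)x=x$ for $x\in E_0$, $t\in\Delta$, and $S(r)T(t)x=T(t)S(r)x=S(r-t)x$ for $x\in E_0$ whenever $r,t\in\Delta\setminus\{0\}$, $\arg(r)=\arg(t)$ and $|r|>|t|$; (ii) for every $t_0\in\Delta\setminus\{0\}$ and $s\ge0$, the series $\sum_{n=1}^{k}\int_{s+B_{k,n}^f}T(t\,|t_0|e^{i\arg(t_0)})x\,dt$, $k\in\mathbb N$, converge unconditionally, uniformly in $k\in\mathbb N$, for every $x\in E_0$; (iii) for every $t_0\in\Delta\setminus\{0\}$, the mapping $t\mapsto S(t\,|t_0|e^{i\arg(t_0)})x$, $t\in A_{k,n}^f$, is Bochner integrable for $k,n\in\mathbb N$, $x\in E_0$, and the series $\sum_{n=1}^{\infty}\int_{A_{k,n}^f}S(t\,|t_0|e^{i\arg(t_0)})x\,dt$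 converges unconditionally for $x\in E_0$, uniformly in $k\in\mathbb N$. Then $(T(t))_{t\in\Delta}$ is $f$-frequently hypercyclic and, for every $t_0\in\Delta\setminus\{0\}$, $(T(te^{i\arg(t_0)}))_{t\ge0}$ is $f$-frequently hypercyclic and the operator $T(t_0)$ is l-$(m_k)$-frequently hypercyclic.
   Context: $E$ is a separable infinite-dimensional Fréchet space over $\mathbb K\in\{\mathbb R,\mathbb C\}$, with translation invariant metric $d$ inducing its topology. The index set $\Delta$ is one of $[0,\infty)$, $\mathbb R$, $\mathbb C$, or $\Delta(\alpha):=\{re^{i\theta}: r\ge 0,\ \theta\in[-\alpha,\alpha]\}$ for some $\alpha\in(0,\pi/2]$. For $s\ge0$, $\Delta_s:=\{t\in\Delta:|t|\le s\}$; $m(\cdot)$ is Lebesgue measure on $\Delta$. A $C_0$-semigroup $(T(t))_{t\in\Delta}$ on $E$ is a family of continuous linear operators on $E$ with $T(0)=I$, $T(t+s)=T(t)T(s)$ for $t,s\in\Delta$, and $t\mapsto T(t)x$ continuous for each $x\in E$; it is locally equicontinuous, i.e. $\{T(t):t\in\Delta_{t_0}\}$ is equicontinuous for every $t_0>0$. A collection of series $\sum_{n=1}^\infty x_{n,k}$, $k\in J$, is unconditionally convergent, uniformly in $k\in J$, iff for any $\epsilon>0$ there is $N\in\mathbb N$ such that for every finite $F\subseteq[N,\infty)\cap\mathbb N$ and every $k\in J$ one has $d(\sum_{n\in F}x_{n,k},0)<\epsilon$; for sums $\sum_{n=1}^k$ one puts $x_{n,k}=0$ for $n>k$. Condition (iii)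 presupposes that the arguments of $S$ occurring there lie in $\Delta$. For $A\subseteq\mathbb N$, $\underline d_{m_k}(A):=\liminf_{n\to\infty}|A\cap[1,m_n]|/n$; for $A\subseteq\Delta$, $\underline d_f(A):=\liminf_{t\to\infty}m(A\cap\Delta_{f(t)})/t$. A continuous linear operator $T$ on $E$ is l-$(m_k)$-frequently hypercyclic (also called l-$(m_k)$-hypercyclic) if there is $x\in E$ with $\underline d_{m_k}(\{n\in\mathbb N:T^nx\in V\})>0$ for every open non-empty $V\subseteq E$. The semigroup $(T(t))_{t\in\Delta}$ is $f$-frequently hypercyclic if there is $x\in E$ with $\underline d_f(\{t\in\Delta:T(t)x\in V\})>0$ for every open non-empty $V\subseteq E$; for $(T(te^{i\arg(t_0)}))_{t\ge0}$ this is used with index set $[0,\infty)$. *)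

theory Defs
  imports "HOL-Analysis.Analysis"
begin

section \<open>Separable infinite-dimensional Frechet spaces over the reals or the complex numbers\<close>

text \<open>
  The scalar field is a type of class \<^class>\<open>real_normed_field\<close>; by the Gelfand--Mazur theorem these
  are, up to isometric isomorphism, exactly the real and the complex numbers. The metric is
  \<^const>\<open>dist\<close>, completeness comes from the class \<^class>\<open>complete_space\<close>. The underlying real vector
  space structure is that of the class \<^class>\<open>real_vector\<close>, with which the scalar multiplication
  has to agree on the reals.
\<close>

definition separable_frechet_space ::
    "('k::real_normed_field \<Rightarrow> 'a::{real_vector, complete_space} \<Rightarrow> 'a) \<Rightarrow> bool"
  where "separable_frechet_space smul \<longleftrightarrow>
    vector_space smul \<and>
    (\<forall>r x. smul (of_real r) x = r *\<^sub>R x) \<and>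
    (\<forall>x y z::'a. dist (x + z) (y + z) = dist x y) \<and>
    continuous_on UNIV (\<lambda>(c, x). smul c x) \<and>
    (\<forall>U::'a set. open U \<and> 0 \<in> U \<longrightarrow> (\<exists>V. open V \<and> convex V \<and> 0 \<in> V \<and> V \<subseteq> U)) \<and>
    separable_space (euclidean :: 'a topology) \<and>
    (\<forall>B. finite B \<longrightarrow> module.span smul B \<noteq> UNIV)"

definition continuous_linear :: "('k::field \<Rightarrow> 'a \<Rightarrow> 'a) \<Rightarrow> ('a::{ab_group_add, topological_space} \<Rightarrow> 'a) \<Rightarrow> bool"
  where "continuous_linear smul T \<longleftrightarrow> Vector_Spaces.linear smul smul T \<and> continuous_on UNIV T"


section \<open>The Bochner integral in a Frechet space\<close>

text \<open>
  \<^const>\<open>has_bochner_integral\<close> needs a norm; here the norm is replaced by all continuous seminorms.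
  Over the complex field, real and complex seminorms give the same notion, since a continuous real
  seminorm on such a space is dominated by a continuous complex one.
\<close>

definition continuous_seminorm :: "('a::{real_vector, topological_space} \<Rightarrow> real) \<Rightarrow> bool"
  where "continuous_seminorm p \<longleftrightarrow> continuous_on UNIV p \<and>
    (\<forall>x y. p (x + y) \<le> p x + p y) \<and> (\<forall>c x. p (c *\<^sub>R x) = \<bar>c\<bar> * p x)"

definition has_frechet_integral ::
    "'b measure \<Rightarrow> ('b \<Rightarrow> 'a::{real_vector, topological_space}) \<Rightarrow> 'a \<Rightarrow> bool"
  where "has_frechet_integral M g y \<longleftrightarrow> g \<in> borel_measurable M \<and>
    (\<exists>u. (\<forall>i. Bochner_Integration.simple_bochner_integrable M (u i)) \<and>
         (\<forall>p. continuous_seminorm p \<longrightarrow>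
            (\<lambda>i. \<integral>\<^sup>+ t. ennreal (p (g t - u i t)) \<partial>M) \<longlonglongrightarrow> 0) \<and>
         (\<lambda>i::nat. Bochner_Integration.simple_bochner_integral M (u i)) \<longlonglongrightarrow> y)"

definition frechet_integrable :: "'b measure \<Rightarrow> ('b \<Rightarrow> 'a::{real_vector, topological_space}) \<Rightarrow> bool"
  where "frechet_integrable M g \<longleftrightarrow> (\<exists>y. has_frechet_integral M g y)"

definition frechet_integral :: "'b measure \<Rightarrow> ('b \<Rightarrow> 'a::{real_vector, topological_space}) \<Rightarrow> 'a"
  where "frechet_integral M g = (THE y. has_frechet_integral M g y)"


section \<open>Index sets and strongly continuous semigroups\<close>

text \<open>All index sets are regarded as subsets of the complex plane.\<close>

definition nonneg_axis :: "complex set"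
  where "nonneg_axis = complex_of_real ` {0..}"

definition sector :: "real \<Rightarrow> complex set"
  where "sector \<alpha> = {rcis r \<theta> | r \<theta>. 0 \<le> r \<and> \<theta> \<in> {-\<alpha>..\<alpha>}}"

definition index_set :: "complex set \<Rightarrow> bool"
  where "index_set \<Delta> \<longleftrightarrow> \<Delta> = nonneg_axis \<or> \<Delta> = \<real> \<or> \<Delta> = UNIV \<or> (\<exists>\<alpha>. 0 < \<alpha> \<and> \<alpha> \<le> pi / 2 \<and> \<Delta> = sector \<alpha>)"

text \<open>Lebesgue measure on \<open>\<Delta>\<close> is one-dimensional on the two real index sets and planar otherwise.\<close>

definition index_measure :: "complex set \<Rightarrow> complex set \<Rightarrow> ennreal"
  where "index_measure \<Delta> A =
    (if \<Delta> \<subseteq> \<real> then emeasure lebesgue {r::real. complex_of_real r \<in> A} else emeasure lebesgue A)"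

text \<open>
  Local equicontinuity is not listed: on a Frechet space it follows from strong continuity by the
  Banach--Steinhaus theorem.
\<close>

definition C0_semigroup ::
    "('k::field \<Rightarrow> 'a \<Rightarrow> 'a) \<Rightarrow> complex set \<Rightarrow> (complex \<Rightarrow> 'a::{ab_group_add, topological_space} \<Rightarrow> 'a) \<Rightarrow> bool"
  where "C0_semigroup smul \<Delta> T \<longleftrightarrow>
    (\<forall>t\<in>\<Delta>. continuous_linear smul (T t)) \<and>
    T 0 = id \<and>
    (\<forall>t\<in>\<Delta>. \<forall>s\<in>\<Delta>. T (t + s) = T t \<circ> T s) \<and>
    (\<forall>x. continuous_on \<Delta> (\<lambda>t. T t x))"


section \<open>Unconditional convergence of series, uniformly in a parameter\<close>

text \<open>
  The series are \<open>\<Sum>n\<ge>1. x n k\<close> for \<open>k \<in> J\<close>; the convergence is expressed by the Cauchy-type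
  condition on finite partial sums over index sets far out.
\<close>

definition uniformly_uncond_convergent ::
    "'j set \<Rightarrow> (nat \<Rightarrow> 'j \<Rightarrow> 'a::{ab_group_add, metric_space}) \<Rightarrow> bool"
  where "uniformly_uncond_convergent J x \<longleftrightarrow>
    (\<forall>\<epsilon>>0. \<exists>N\<ge>1. \<forall>F k. finite F \<and> F \<subseteq> {N..} \<and> k \<in> J \<longrightarrow> dist (\<Sum>n\<in>F. x n k) 0 < \<epsilon>)"


section \<open>Densities and frequent hypercyclicity\<close>

definition lower_m_density :: "(nat \<Rightarrow> real) \<Rightarrow> nat set \<Rightarrow> ereal"
  where "lower_m_density m A =
    liminf (\<lambda>n. ereal (real (card {j \<in> A. 1 \<le> j \<and> real j \<le> m n}) / real n))"

definition lower_f_density :: "(real \<Rightarrow> real) \<Rightarrow> complex set \<Rightarrow> complex set \<Rightarrow> ennreal"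
  where "lower_f_density f \<Delta> A =
    Liminf at_top (\<lambda>t. index_measure \<Delta> (A \<inter> {z \<in> \<Delta>. cmod z \<le> f t}) / ennreal t)"

definition l_frequently_hypercyclic :: "(nat \<Rightarrow> real) \<Rightarrow> ('a::topological_space \<Rightarrow> 'a) \<Rightarrow> bool"
  where "l_frequently_hypercyclic m T \<longleftrightarrow>
    (\<exists>x. \<forall>V. open V \<and> V \<noteq> {} \<longrightarrow> lower_m_density m {n. 1 \<le> n \<and> (T ^^ n) x \<in> V} > 0)"

definition f_frequently_hypercyclic ::
    "(real \<Rightarrow> real) \<Rightarrow> complex set \<Rightarrow> (complex \<Rightarrow> 'a::topological_space \<Rightarrow> 'a) \<Rightarrow> bool"
  where "f_frequently_hypercyclic f \<Delta> T \<longleftrightarrow>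
    (\<exists>x. \<forall>V. open V \<and> V \<noteq> {} \<longrightarrow> lower_f_density f \<Delta> {t \<in> \<Delta>. T t x \<in> V} > 0)"


section \<open>The intervals of integration\<close>

definition A_interval :: "(nat \<Rightarrow> real) \<Rightarrow> nat \<Rightarrow> nat \<Rightarrow> real set"
  where "A_interval m k n =
    {real_of_int (\<lfloor>m (k + n)\<rfloor> - \<lfloor>m k\<rfloor> - 1) .. real_of_int (\<lfloor>m (k + n)\<rfloor> - \<lfloor>m k\<rfloor>)}"

text \<open>Only used for \<open>n \<le> k\<close>, so the subtraction on \<^typ>\<open>nat\<close> is not truncated.\<close>

definition B_interval :: "(nat \<Rightarrow> real) \<Rightarrow> nat \<Rightarrow> nat \<Rightarrow> real set"
  where "B_interval m k n =
    {real_of_int (\<lfloor>m k\<rfloor> - \<lfloor>m (k - n)\<rfloor>) .. real_of_int (\<lfloor>m k\<rfloor> - \<lfloor>m (k - n)\<rfloor> + 1)}"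

end

theory Submission
  imports Defs
begin

text \<open>
  Fix \<open>t\<^sub>0 \<noteq> 0\<close>, write \<open>U s = T (s t\<^sub>0)\<close>, \<open>M k = \<lfloor>m k\<rfloor>\<close> and \<open>\<Phi> x = \<integral>\<^sub>0\<^sup>1 U s x ds\<close>. The integrals in (ii) and (iii)
  are \<open>U (M k - M (k - n)) (\<Phi> x)\<close> and vectors that \<open>U (M (k + n) - M k)\<close> maps to \<open>\<Phi> x\<close>, so the vectors
  \<open>\<Phi> x\<close>, and hence those in the span of \<open>\<Phi> ` E\<^sub>0\<close>, satisfy the frequent universality criterion for the
  operators \<open>U (M k - M 1)\<close>. This span is dense: by (ii) for \<open>t\<^sub>0 / q\<close> its closure contains the averages
  \<open>q \<integral> U s x ds\<close> over \<open>[0, 1/q]\<close>, which tend to \<open>x\<close>. By (ii) again, \<open>M\<close> is only constant on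
  intervals of bounded length, so the universal vector is l-\<open>m\<close>-frequently hypercyclic for \<open>U 1\<close>.
  For the semigroups, apply this with \<open>\<bar>t\<^sub>0\<bar> = 1/2\<close>: around each \<open>j t\<^sub>0\<close> with \<open>U j x\<close> in a suitable
  smaller open set there is a translate of a fixed neighbourhood of \<open>0\<close> in \<open>\<Delta>\<close>, these translates
  being disjoint.
\<close>

section \<open>Frechet spaces\<close>

text \<open>The hypotheses bound only integrals over unit intervals, never single vectors
  \<open>U s x\<close> or \<open>S s x\<close>; hence averages replace the vectors of the dense set,
  and the density of their span needs a proof. Nothing makes \<open>S s\<close> linear or
  continuous, so for a vector of the span one only asks that some sequence of preimages exists, a
  property stable under linear combinations. The operators start from \<open>M 1\<close> because the
  series are controlled for positive \<open>k\<close> only. Rounding down may repeat values, so that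
  distinct indices can give the same power of \<open>U 1\<close>; were this to happen on arbitrarily
  long stretches, a fixed nonzero average would recur as an arbitrarily late term of a series in
  (ii). The modulus 1/2 leaves room: for \<open>j \<ge> 1\<close>, the \<open>j\<close>-fold
  multiple of a number of modulus 1/2, moved by a small amount, still has modulus at most
  \<open>j\<close>, so hitting times up to \<open>f s\<close> yield translates inside the disc of
  radius \<open>f s\<close>.\<close>

locale frechet =
  assumes dist_add_cancel_right: "dist (x + z) (y + z) = dist x (y :: 'a::{real_vector, complete_space})"
    and continuous_scaleR: "continuous_on UNIV (\<lambda>(c::real, x::'a). c *\<^sub>R x)"
    and locally_convex: "open U \<Longrightarrow> (0::'a) \<in> U \<Longrightarrow> \<exists>V. open V \<and> convex V \<and> 0 \<in> V \<and> V \<subseteq> U"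
begin

lemma dist_diff: "dist x y = dist (x - y) (0::'a)"
  using dist_add_cancel_right[of "x - y" y 0] by simp

lemma dist_uminus: "dist (- x) (0::'a) = dist x 0"
  using dist_diff[of 0 x] by (simp add: dist_commute)

lemma dist_add_le: "dist (x + y) (0::'a) \<le> dist x 0 + dist y 0"
  using dist_triangle[of "x + y" 0 y] dist_add_cancel_right[of x y 0] by simp

lemma dist_sum_le: "dist (\<Sum>i\<in>I. g i) (0::'a) \<le> (\<Sum>i\<in>I. dist (g i) 0)"
proof (induction I rule: infinite_finite_induct)
  case (insert i I)
  then show ?case using dist_add_le[of "g i" "sum g I"] by simp
qed auto

lemma dist_add_add_le: "dist (a + b) (c + d) \<le> dist a c + dist b (d::'a)"
  using dist_add_le[of "a - c" "b - d"] by (simp add: dist_diff[of "a + b"] dist_diff[of a c] dist_diff[of b d] algebra_simps)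

lemma tendsto_add_frechet:
  assumes "(g \<longlongrightarrow> a) F" "(h \<longlongrightarrow> (b::'a)) F"
  shows "((\<lambda>i. g i + h i) \<longlongrightarrow> a + b) F"
proof -
  have "((\<lambda>i. dist (g i) a + dist (h i) b) \<longlongrightarrow> 0) F"
    using tendsto_add[OF tendsto_dist_iff[THEN iffD1, OF assms(1)] tendsto_dist_iff[THEN iffD1, OF assms(2)]]
    by simp
  then show ?thesis
    unfolding tendsto_dist_iff[of "\<lambda>i. g i + h i"]
    by (rule tendsto_sandwich[OF _ _ tendsto_const, rotated 2])
       (auto intro: always_eventually dist_add_add_le)
qed

lemma tendsto_scaleR_frechet:
  assumes "(c \<longlongrightarrow> (r::real)) F" "(g \<longlongrightarrow> (a::'a)) F"
  shows "((\<lambda>i. c i *\<^sub>R g i) \<longlongrightarrow> r *\<^sub>R a) F"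
proof -
  have "isCont (\<lambda>(c::real, x::'a). c *\<^sub>R x) (r, a)"
    using continuous_scaleR by (simp add: continuous_on_eq_continuous_at)
  from isCont_tendsto_compose[OF this tendsto_Pair[OF assms]] show ?thesis by simp
qed

lemma tendsto_uminus_frechet: "(g \<longlongrightarrow> (a::'a)) F \<Longrightarrow> ((\<lambda>i. - g i) \<longlongrightarrow> - a) F"
  using tendsto_scaleR_frechet[OF tendsto_const[of "-1"], of g a F] by simp

lemma tendsto_diff_frechet:
  "(g \<longlongrightarrow> a) F \<Longrightarrow> (h \<longlongrightarrow> (b::'a)) F \<Longrightarrow> ((\<lambda>i. g i - h i) \<longlongrightarrow> a - b) F"
  using tendsto_add_frechet[of g a F "\<lambda>i. - h i" "- b"] tendsto_uminus_frechet[of h b F] by simp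

text \<open>A translation invariant metric need not be homogeneous, so the effect of a scalar factor
  on distances to 0 is controlled by continuity alone.\<close>

lemma small_scaleR:
  assumes "0 < \<epsilon>"
  obtains \<delta> where "0 < \<delta>" "\<And>x::'a. dist x 0 < \<delta> \<Longrightarrow> dist (c *\<^sub>R x) 0 < \<epsilon>"
proof -
  have "((\<lambda>x::'a. c *\<^sub>R x) \<longlongrightarrow> c *\<^sub>R 0) (nhds 0)"
    by (intro tendsto_scaleR_frechet tendsto_const filterlim_ident)
  then have "\<forall>\<^sub>F x::'a in nhds 0. dist (c *\<^sub>R x) 0 < \<epsilon>"
    using assms by (simp add: tendsto_iff)
  then show ?thesis
    unfolding eventually_nhds_metric using that by blast
qed

lemma linear_tendsto:
  assumes "continuous_on UNIV (L :: 'a \<Rightarrow> 'a)" "(g \<longlongrightarrow> a) F"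
  shows "((\<lambda>i. L (g i)) \<longlongrightarrow> L a) F"
  using assms(1) by (auto intro: isCont_tendsto_compose[OF _ assms(2)] simp: continuous_on_eq_continuous_at)

lemma small_linear:
  assumes "0 < \<epsilon>" "continuous_on UNIV (L :: 'a \<Rightarrow> 'a)" "L 0 = 0"
  obtains \<delta> where "0 < \<delta>" "\<And>x::'a. dist x 0 < \<delta> \<Longrightarrow> dist (L x) 0 < \<epsilon>"
proof -
  have "(L \<longlongrightarrow> L 0) (nhds 0)"
    by (intro linear_tendsto[OF assms(2)] filterlim_ident)
  then have "\<forall>\<^sub>F x::'a in nhds 0. dist (L x) 0 < \<epsilon>"
    using assms by (simp add: tendsto_iff)
  then show ?thesis
    unfolding eventually_nhds_metric using that by blast
qed

lemma subspace_closure_frechet: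
  assumes "subspace (W::'a set)" shows "subspace (closure W)"
  unfolding subspace_def
proof (intro conjI ballI allI)
  show "0 \<in> closure W" using assms closure_subset subspace_0 by blast
next
  fix x y assume "x \<in> closure W" "y \<in> closure W"
  then obtain g h where "\<And>n. g n \<in> W" "g \<longlonglongrightarrow> x" "\<And>n. h n \<in> W" "h \<longlonglongrightarrow> y"
    unfolding closure_sequential by blast
  then have "\<And>n. g n + h n \<in> W" "(\<lambda>n. g n + h n) \<longlonglongrightarrow> x + y"
    using assms by (auto simp: subspace_add intro: tendsto_add_frechet)
  then show "x + y \<in> closure W"
    unfolding closure_sequential by (intro exI[of _ "\<lambda>n. g n + h n"]) simp
next
  fix c x assume "x \<in> closure W"
  then obtain g where "\<And>n. g n \<in> W" "g \<longlonglongrightarrow> x" unfolding closure_sequential by blast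
  then have "\<And>n. c *\<^sub>R g n \<in> W" "(\<lambda>n. c *\<^sub>R g n) \<longlonglongrightarrow> c *\<^sub>R x"
    using assms by (auto simp: subspace_scale intro: tendsto_scaleR_frechet tendsto_const)
  then show "c *\<^sub>R x \<in> closure W"
    unfolding closure_sequential by (intro exI[of _ "\<lambda>n. c *\<^sub>R g n"]) simp
qed

text \<open>Metric balls need not be convex, yet averages of small vectors have to be small;
  estimates of averages therefore run through such a \<open>V\<close>. Intersecting a convex
  neighbourhood with its reflection gives the symmetry.\<close>

lemma convex_ball_subset:
  assumes "0 < \<epsilon>"
  obtains V where "open V" "convex V" "(0::'a) \<in> V" "\<And>x. x \<in> V \<Longrightarrow> dist x 0 < \<epsilon>" "\<And>x. x \<in> V \<Longrightarrow> - x \<in> V"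
proof -
  obtain V where V: "open V" "convex V" "(0::'a) \<in> V" "V \<subseteq> ball 0 \<epsilon>"
    using locally_convex[of "ball 0 \<epsilon>"] assms by auto
  have "continuous_on UNIV (\<lambda>x::'a. - x)"
    unfolding continuous_on_def by (auto intro: tendsto_uminus_frechet tendsto_ident_at)
  then have "open ((\<lambda>x. - x) -` V)" using V(1) by (rule open_vimage[rotated])
  moreover have "convex ((\<lambda>x. - x) -` V)"
    by (intro convex_linear_vimage[OF _ V(2)] linearI) auto
  ultimately have "open (V \<inter> (\<lambda>x. - x) -` V)" "convex (V \<inter> (\<lambda>x. - x) -` V)"
    using V by (auto intro: convex_Int)
  then show ?thesis
    using that[of "V \<inter> (\<lambda>x. - x) -` V"] V by (auto simp: subset_eq dist_commute)
qed

lemma average_mem_convex: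
  assumes "convex V" "\<And>i. i < n \<Longrightarrow> g i \<in> V" "0 < (n::nat)"
  shows "(1 / real n) *\<^sub>R (\<Sum>i<n. g i :: 'a) \<in> V"
  using convex_sum[of "{..<n}" V "\<lambda>_. 1 / real n" g] assms by (simp add: scaleR_sum_right)

text \<open>The Minkowski functional of a convex symmetric neighbourhood of \<open>0\<close> that misses \<open>y\<close>.\<close>

lemma continuous_seminorm_separates:
  assumes "y \<noteq> (0::'a)"
  obtains p where "continuous_seminorm p" "p y > 0"
proof -
  from assms have "0 < dist y 0" by simp
  then obtain V where V: "open V" "convex V" "(0::'a) \<in> V" "\<And>x. x \<in> V \<Longrightarrow> dist x 0 < dist y 0"
    "\<And>x. x \<in> V \<Longrightarrow> - x \<in> V"
    by (rule convex_ball_subset) blast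
  define P where "P x = {t. 0 < t \<and> (1/t) *\<^sub>R x \<in> V}" for x
  define p where "p x = Inf (P x)" for x
  have bdd: "bdd_below (P x)" for x by (auto simp: P_def intro!: bdd_belowI[of _ 0])
  have ne: "P x \<noteq> {}" for x
  proof -
    have "((\<lambda>n. (1 / real (Suc n)) *\<^sub>R x) \<longlongrightarrow> 0 *\<^sub>R x) sequentially"
      by (intro tendsto_scaleR_frechet tendsto_const LIMSEQ_Suc[OF lim_1_over_n])
    then have "\<forall>\<^sub>F n in sequentially. (1 / real (Suc n)) *\<^sub>R x \<in> V"
      using V(1,3) by (auto dest: topological_tendstoD)
    then obtain n where "(1 / real (Suc n)) *\<^sub>R x \<in> V" by (auto simp: eventually_sequentially)
    then have "real (Suc n) \<in> P x" by (simp add: P_def)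
    then show ?thesis by blast
  qed
  have nonneg: "0 \<le> p x" for x
    unfolding p_def by (rule cInf_greatest[OF ne]) (auto simp: P_def)
  \<comment> \<open>Convexity and \<open>0 \<in> V\<close> make \<open>P x\<close> upward closed:
    \<open>(1/t) *\<^sub>R x\<close> lies on the segment from 0 to
    \<open>(1/s) *\<^sub>R x\<close>.\<close>
  have up: "t \<in> P x" if "p x < t" for x t
  proof -
    from that obtain s where s: "s \<in> P x" "s < t"
      unfolding p_def using cInf_less_iff[OF ne bdd] by blast
    have "(s/t) *\<^sub>R ((1/s) *\<^sub>R x) + (1 - s/t) *\<^sub>R 0 \<in> V"
      using s V(2,3) by (intro convexD) (auto simp: P_def)
    then show ?thesis using s by (auto simp: P_def)
  qed
  have le: "p x \<le> t" if "t \<in> P x" for x t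
    unfolding p_def using that bdd by (rule cInf_lower)
  have add: "p (x + z) \<le> p x + p z" for x z
  proof (rule field_le_epsilon)
    fix e :: real assume "0 < e"
    define s t where "s = p x + e/2" and "t = p z + e/2"
    have st: "s \<in> P x" "t \<in> P z" using \<open>0 < e\<close> by (auto intro!: up simp: s_def t_def)
    then have "0 < s" "0 < t" by (auto simp: P_def)
    have "(s/(s+t)) *\<^sub>R ((1/s) *\<^sub>R x) + (t/(s+t)) *\<^sub>R ((1/t) *\<^sub>R z) \<in> V"
      using st V(2) by (intro convexD) (auto simp: P_def add_divide_distrib[symmetric])
    then have "s + t \<in> P (x + z)"
      using \<open>0 < s\<close> \<open>0 < t\<close> by (simp add: P_def scaleR_add_right)
    from le[OF this] show "p (x + z) \<le> p x + p z + e" by (simp add: s_def t_def)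
  qed
  have pos_scale: "p (c *\<^sub>R x) \<le> c * p x" if "0 < c" for c x
  proof (rule field_le_epsilon)
    fix e :: real assume "0 < e"
    define t where "t = p x + e / c"
    have "t \<in> P x" using \<open>0 < e\<close> that by (auto intro!: up simp: t_def)
    then have "c * t \<in> P (c *\<^sub>R x)" using that by (simp add: P_def)
    from le[OF this] show "p (c *\<^sub>R x) \<le> c * p x + e" using that by (simp add: t_def distrib_left)
  qed
  have pos_eq: "p (c *\<^sub>R x) = c * p x" if "0 < c" for c x
  proof (rule antisym[OF pos_scale[OF that]])
    have "p ((1/c) *\<^sub>R (c *\<^sub>R x)) \<le> (1/c) * p (c *\<^sub>R x)" using that by (intro pos_scale) simp
    then show "c * p x \<le> p (c *\<^sub>R x)" using that by (simp add: field_simps)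
  qed
  have minus: "p (- x) = p x" for x
  proof -
    have "P (- x) = P x" using V(5) by (auto simp: P_def) (metis minus_minus)
    then show ?thesis by (simp add: p_def)
  qed
  have zero: "p 0 = 0" using pos_eq[of 2 0] by simp
  have scale: "p (c *\<^sub>R x) = \<bar>c\<bar> * p x" for c x
    using pos_eq[of c x] pos_eq[of "-c" x] minus[of "c *\<^sub>R x"] zero by (cases c "0::real" rule: linorder_cases) auto
  have cont: "continuous_on UNIV p"
    unfolding continuous_on_def
  proof
    fix a
    have "((\<lambda>x. p (x - a)) \<longlongrightarrow> 0) (at a)"
    proof (rule tendstoI)
      fix e :: real assume "0 < e"
      have "((\<lambda>x. (2/e) *\<^sub>R (x - a)) \<longlongrightarrow> (2/e) *\<^sub>R (a - a)) (at a)"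
        by (intro tendsto_scaleR_frechet tendsto_const tendsto_diff_frechet tendsto_ident_at)
      then have "\<forall>\<^sub>F x in at a. (2/e) *\<^sub>R (x - a) \<in> V"
        using V(1,3) by (auto dest: topological_tendstoD)
      then show "\<forall>\<^sub>F x in at a. dist (p (x - a)) 0 < e"
      proof (rule eventually_mono)
        fix x assume "(2/e) *\<^sub>R (x - a) \<in> V"
        then have "e/2 \<in> P (x - a)" using \<open>0 < e\<close> by (simp add: P_def)
        from le[OF this] show "dist (p (x - a)) 0 < e" using nonneg[of "x - a"] \<open>0 < e\<close> by simp
      qed
    qed
    moreover have "\<bar>p x - p a\<bar> \<le> p (x - a)" for x
      using add[of "x - a" a] add[of "a - x" x] minus[of "x - a"] by (auto simp: abs_le_iff)
    ultimately have "((\<lambda>x. dist (p x) (p a)) \<longlongrightarrow> 0) (at a)"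
      by - (rule tendsto_sandwich[OF _ _ tendsto_const, rotated 2], auto simp: dist_real_def)
    then show "(p \<longlongrightarrow> p a) (at a)" by (rule tendsto_dist_iff[THEN iffD2])
  qed
  \<comment> \<open>An element of \<open>P y\<close> below 1 would put \<open>y\<close> into
    \<open>V\<close>, whose elements are all closer to 0 than \<open>y\<close>.\<close>
  have "p y \<ge> 1"
    unfolding p_def
  proof (rule cInf_greatest[OF ne])
    fix t assume t: "t \<in> P y"
    show "1 \<le> t"
    proof (rule ccontr)
      assume "\<not> 1 \<le> t"
      then have "t *\<^sub>R ((1/t) *\<^sub>R y) + (1 - t) *\<^sub>R 0 \<in> V"
        using t V(2,3) by (intro convexD) (auto simp: P_def)
      then have "y \<in> V" using t by (auto simp: P_def)
      then show False using V(4) by blast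
    qed
  qed
  then show ?thesis
    using that[of p] cont add scale by (auto simp: continuous_seminorm_def)
qed

end

section \<open>Frequent universality\<close>

lemma multiples_card_le: "card {i\<in>{1..k::nat}. d dvd i} \<le> k div d"
proof (cases "d = 0")
  case True
  then show ?thesis by (auto simp: card_eq_0_iff)
next
  case False
  have "{i\<in>{1..k}. d dvd i} \<subseteq> (\<lambda>q. d * q) ` {1..k div d}"
  proof
    fix i assume "i \<in> {i\<in>{1..k}. d dvd i}"
    then obtain q where "i = d * q" "1 \<le> i" "i \<le> k" by auto
    moreover from this have "q \<le> k div d" using False by (simp add: less_eq_div_iff_mult_less_eq mult.commute)
    moreover have "1 \<le> q" using calculation by (cases q) auto
    ultimately show "i \<in> (\<lambda>q. d * q) ` {1..k div d}" by auto
  qed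
  then have "card {i\<in>{1..k}. d dvd i} \<le> card ((\<lambda>q. d * q) ` {1..k div d})"
    by (intro card_mono) auto
  also have "\<dots> \<le> k div d" using card_image_le[of "{1..k div d}" "\<lambda>q. d * q"] by simp
  finally show ?thesis .
qed

text \<open>
  Index \<open>i\<close> is given the label \<open>l\<close> and the weight \<open>N l\<close> if \<open>2 ^ (l + N l)\<close> is the exact power of
  two dividing \<open>i\<close>, and the weight \<open>0\<close> if there is no such \<open>l\<close>. The average weight is then finite,
  so placing the indices at mutual distances given by the weights costs only a constant factor in
  density.
\<close>

lemma separated_sets_of_positive_density:
  fixes N :: "nat \<Rightarrow> nat"
  assumes "mono N" "\<And>l. 1 \<le> N l"
  obtains A :: "nat \<Rightarrow> nat set" where
    "\<And>l n. n \<in> A l \<Longrightarrow> N l \<le> n"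
    "\<And>l j n n'. n \<in> A l \<Longrightarrow> n' \<in> A j \<Longrightarrow> n < n' \<Longrightarrow> n + N l + N j \<le> n'"
    "\<And>l j. l \<noteq> j \<Longrightarrow> A l \<inter> A j = {}"
    "\<And>l. \<exists>c>0. \<forall>\<^sub>F P in sequentially. c * real P \<le> real (card (A l \<inter> {..P}))"
proof -
  \<comment> \<open>The summand \<open>N l\<close> pays for the weight, because
    \<open>N l < 2 ^ N l\<close>; the summand \<open>l\<close> turns the sum over all labels into a
    geometric series.\<close>
  define g where "g l = l + N l" for l
  have g_mono: "strict_mono g"
    using assms(1) by (auto simp: g_def strict_mono_def mono_def intro!: add_less_le_mono)
  define lab where "lab i l \<longleftrightarrow> 0 < i \<and> 2 ^ g l dvd i \<and> \<not> 2 ^ Suc (g l) dvd i" for i l :: nat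
  have lab_unique: "l = j" if "lab i l" "lab i j" for i l j
  proof (rule ccontr)
    assume "l \<noteq> j"
    then consider "g l < g j" | "g j < g l" using g_mono by (metis nat_neq_iff strict_monoD)
    then show False
      using that unfolding lab_def by cases (meson Suc_leI dvd_trans le_imp_power_dvd)+
  qed
  define W where "W i = (if \<exists>l. lab i l then N (THE l. lab i l) else 0)" for i
  have W_eq: "W i = N l" if "lab i l" for i l
  proof -
    have "(THE l. lab i l) = l" using that lab_unique by (intro the_equality) blast+
    then show ?thesis using that by (auto simp: W_def)
  qed
  have lab_le: "l < i" if "lab i l" for i l
  proof -
    have "l < 2 ^ l" by simp
    also have "\<dots> \<le> (2::nat) ^ g l" by (intro power_increasing) (auto simp: g_def)
    also have "\<dots> \<le> i" using that by (auto simp: lab_def dvd_imp_le)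
    finally show ?thesis .
  qed
  have W_sum: "(\<Sum>i\<in>{1..k}. W i) \<le> 2 * k" for k
  proof -
    have "W i \<le> (\<Sum>l<k. if 2 ^ g l dvd i then N l else 0)" if "i \<in> {1..k}" for i
    proof (cases "\<exists>l. lab i l")
      case True
      then obtain l where l: "lab i l" by blast
      have "N l \<le> (\<Sum>l\<in>{l}. if 2 ^ g l dvd i then N l else 0)" using l by (simp add: lab_def)
      also have "\<dots> \<le> (\<Sum>l<k. if 2 ^ g l dvd i then N l else 0)"
        using lab_le[OF l] that by (intro sum_mono2) auto
      finally show ?thesis using W_eq[OF l] by simp
    qed (simp add: W_def)
    then have "(\<Sum>i\<in>{1..k}. W i) \<le> (\<Sum>i\<in>{1..k}. \<Sum>l<k. if 2 ^ g l dvd i then N l else 0)"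
      by (intro sum_mono) blast
    also have "\<dots> = (\<Sum>l<k. \<Sum>i\<in>{1..k}. if 2 ^ g l dvd i then N l else 0)"
      by (rule sum.swap)
    also have "\<dots> = (\<Sum>l<k. N l * card {i\<in>{1..k}. 2 ^ g l dvd i})"
      by (intro sum.cong refl) (simp add: sum.If_cases Int_def mult.commute)
    finally have "real (\<Sum>i\<in>{1..k}. W i) \<le> real (\<Sum>l<k. N l * card {i\<in>{1..k}. 2 ^ g l dvd i})"
      by (simp only: of_nat_le_iff)
    also have "\<dots> \<le> (\<Sum>l<k. real k * (1/2) ^ l)"
      unfolding of_nat_sum
    proof (rule sum_mono)
      fix l
      have "N l * card {i\<in>{1..k}. 2 ^ g l dvd i} \<le> N l * (k div 2 ^ g l)"
        by (intro mult_left_mono multiples_card_le) auto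
      then have "real (N l * card {i\<in>{1..k}. 2 ^ g l dvd i}) \<le> real (N l) * real (k div 2 ^ g l)"
        by (metis of_nat_le_iff of_nat_mult)
      also have "\<dots> \<le> 2 ^ N l * (real k / 2 ^ g l)"
      proof (intro mult_mono)
        show "real (k div 2 ^ g l) \<le> real k / 2 ^ g l"
          using of_nat_div_le_of_nat[of k "2 ^ g l", where ?'a = real] by simp
        have "real (N l) < real (2 ^ N l)" unfolding of_nat_less_iff by simp
        then show "real (N l) \<le> 2 ^ N l" by simp
      qed auto
      also have "\<dots> = real k * (1/2) ^ l" by (simp add: g_def power_add power_one_over divide_simps)
      finally show "real (N l * card {i\<in>{1..k}. 2 ^ g l dvd i}) \<le> real k * (1/2) ^ l" .
    qed
    also have "\<dots> = real k * (\<Sum>l<k. (1/2) ^ l)" by (simp add: sum_distrib_left)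
    also have "\<dots> \<le> real k * 2"
      by (intro mult_left_mono) (auto simp: sum_gp_strict)
    finally show ?thesis by (metis mult.commute of_nat_le_iff of_nat_mult of_nat_numeral)
  qed
  \<comment> \<open>\<open>pos i\<close> is the centre of an interval of radius \<open>W i\<close>,
    these intervals being laid end to end from 0 in the order of the indices. Centres of two
    intervals thus differ by at least the sum of the radii, and \<open>W_sum\<close> bounds the
    growth of the centres.\<close>
  define pos where "pos i = 2 * (\<Sum>i'\<in>{1..<i}. W i') + W i" for i
  have pos_le: "pos i \<le> 4 * i" for i
  proof (cases "i = 0")
    case True
    then show ?thesis by (simp add: pos_def W_def lab_def)
  next
    case False
    then have "{1..i} = insert i {1..<i}" by auto
    then have "pos i \<le> 2 * (\<Sum>i\<in>{1..i}. W i)" by (simp add: pos_def)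
    then show ?thesis using W_sum[of i] by linarith
  qed
  have pos_sep: "pos i + W i + W j \<le> pos j" if "i < j" "0 < i" for i j
  proof -
    have "(\<Sum>i'\<in>insert i {1..<i}. W i') \<le> (\<Sum>i'\<in>{1..<j}. W i')"
      using that by (intro sum_mono2) auto
    then show ?thesis by (simp add: pos_def)
  qed
  define A where "A l = {pos i | i. lab i l}" for l
  have order: "i < i'" if "pos i < pos i'" "lab i l" "lab i' j" for i i' l j
  proof (rule ccontr)
    assume "\<not> i < i'"
    then consider "i = i'" | "i' < i" by linarith
    then show False using that pos_sep[of i' i] by cases (auto simp: lab_def)
  qed
  have inj: "i = i'" if "pos i = pos i'" "lab i l" "lab i' j" for i i' l j
  proof (rule ccontr)
    assume "i \<noteq> i'"
    then consider "i < i'" | "i' < i" by linarith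
    then show False using that pos_sep[of i i'] pos_sep[of i' i] W_eq[of i l] assms(2)[of l]
      by cases (auto simp: lab_def)
  qed
  show ?thesis
  proof (rule that[of A])
    fix l n assume "n \<in> A l"
    then show "N l \<le> n" using W_eq by (auto simp: A_def pos_def)
  next
    fix l j n n' assume "n \<in> A l" "n' \<in> A j" "n < n'"
    then obtain i i' where i: "n = pos i" "lab i l" "n' = pos i'" "lab i' j" by (auto simp: A_def)
    with \<open>n < n'\<close> have "i < i'" using order by blast
    then show "n + N l + N j \<le> n'" using pos_sep[of i i'] i W_eq by (auto simp: lab_def)
  next
    fix l j :: nat assume "l \<noteq> j"
    then show "A l \<inter> A j = {}" using inj lab_unique by (auto simp: A_def) blast
  next
    fix l
    define D :: nat where "D = 2 ^ g l"
    have D: "0 < D" by (simp add: D_def)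
    have card: "P div (8 * D) \<le> card (A l \<inter> {..P})" for P
    proof -
      \<comment> \<open>The odd multiples of \<open>D\<close> are exactly the indices with label
        \<open>l\<close>, and their positions are at most \<open>8 * D * (q + 1)\<close> by
        \<open>pos_le\<close>.\<close>
      define i where "i q = D * (2 * q + 1)" for q
      have labi: "lab (i q) l" for q
      proof -
        have "\<not> 2 ^ Suc (g l) dvd i q"
        proof
          assume "2 ^ Suc (g l) dvd i q"
          then have "D * 2 dvd D * (2 * q + 1)" by (simp add: i_def D_def mult.commute)
          then show False using D by (simp only: nat_mult_dvd_cancel1) presburger
        qed
        then show ?thesis by (simp add: lab_def i_def D_def)
      qed
      have "(\<lambda>q. pos (i q)) ` {..<P div (8 * D)} \<subseteq> A l \<inter> {..P}"
      proof
        fix n assume "n \<in> (\<lambda>q. pos (i q)) ` {..<P div (8 * D)}"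
        then obtain q where q: "q < P div (8 * D)" "n = pos (i q)" by blast
        have "(q + 1) * (8 * D) \<le> P" using q D
          by (metis Suc_eq_plus1 Suc_leI less_eq_div_iff_mult_less_eq mult_pos_pos zero_less_numeral)
        moreover have "4 * i q \<le> (q + 1) * (8 * D)" by (simp add: i_def algebra_simps)
        ultimately have "pos (i q) \<le> P" using pos_le[of "i q"] by linarith
        then show "n \<in> A l \<inter> {..P}" using labi q(2) by (auto simp: A_def)
      qed
      moreover have "inj_on (\<lambda>q. pos (i q)) {..<P div (8 * D)}"
        using inj[OF _ labi labi] D by (auto simp: inj_on_def i_def)
      ultimately show ?thesis
        by (metis card_image card_lessThan card_mono finite_Int finite_atMost)
    qed
    \<comment> \<open>From \<open>16 * D\<close> on, the quotient by \<open>8 * D\<close> is at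
      least 1, so rounding it down costs at most a factor of two.\<close>
    have "\<forall>P\<ge>16 * D. 1 / real (16 * D) * real P \<le> real (card (A l \<inter> {..P}))"
    proof (intro allI impI)
      fix P assume P: "16 * D \<le> P"
      define e where "e = 8 * D"
      have "P < (P div e + 1) * e" using D by (simp add: e_def dividend_less_div_times)
      moreover have "1 \<le> P div e" using P D by (simp add: e_def less_eq_div_iff_mult_less_eq)
      then have "(P div e + 1) * e \<le> (2 * (P div e)) * e" by (intro mult_right_mono) auto
      moreover have "(2 * (P div e)) * e = P div e * (16 * D)" by (simp add: e_def algebra_simps)
      ultimately have "P \<le> P div e * (16 * D)" by linarith
      then have "real P \<le> real (P div e) * real (16 * D)" by (metis of_nat_le_iff of_nat_mult)
      then have "1 / real (16 * D) * real P \<le> real (P div e)" using D by (simp add: field_simps)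
      also have "\<dots> \<le> real (card (A l \<inter> {..P}))" using card[of P] by (simp add: e_def)
      finally show "1 / real (16 * D) * real P \<le> real (card (A l \<inter> {..P}))" .
    qed
    then have "\<forall>\<^sub>F P in sequentially. 1 / real (16 * D) * real P \<le> real (card (A l \<inter> {..P}))"
      unfolding eventually_sequentially by blast
    moreover have "0 < 1 / real (16 * D)" using D by simp
    ultimately show "\<exists>c>0. \<forall>\<^sub>F P in sequentially. c * real P \<le> real (card (A l \<inter> {..P}))" by blast
  qed
qed

text \<open>The error budget of the universal vector. The \<open>l + 1\<close> indices up to
  \<open>l\<close> share one portion \<open>(1/2) ^ l\<close> equally, whence the denominator; the
  indices beyond \<open>l\<close> form a geometric tail that adds at most the same amount.\<close>

lemma sum_max_geometric_le:
  "(\<Sum>j\<le>B. (1/2) ^ max l j / real (max l j + 1)) \<le> 2 * (1/2::real) ^ l"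
proof -
  define F :: "nat \<Rightarrow> real" where "F j = (1/2) ^ max l j / real (max l j + 1)" for j
  have tail: "F j \<le> (1/2) ^ j" if "l \<le> j" for j
    using that by (simp add: F_def divide_le_eq max_def)
  \<comment> \<open>Beyond \<open>l\<close> the bound is sharpened by \<open>(1/2) ^ B\<close>, so
    that adding the next term of the tail reproduces it.\<close>
  have "sum F {..B} \<le> (if B \<le> l then real (B + 1) * F l else 2 * (1/2) ^ l - (1/2) ^ B)"
  proof (induction B)
    case (Suc B)
    consider "Suc B \<le> l" | "B = l" | "l < B" by linarith
    then show ?case
    proof cases
      case 1
      then have "F (Suc B) = F l" by (simp add: F_def max_def)
      then show ?thesis using Suc 1 by (simp add: ring_distribs)
    next
      case 2
      have "real (B + 1) * F l = (1/2) ^ l" using 2 by (simp add: F_def)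
      then show ?thesis using Suc 2 tail[of "Suc l"] by simp
    next
      case 3
      then show ?thesis using Suc tail[of "Suc B"] by simp
    qed
  qed (simp add: F_def)
  also have "\<dots> \<le> 2 * (1/2::real) ^ l"
  proof (cases "B \<le> l")
    case True
    then have "real (B + 1) * F l \<le> real (l + 1) * F l"
      by (intro mult_right_mono) (auto simp: F_def)
    also have "\<dots> = (1/2) ^ l" by (simp add: F_def)
    also have "\<dots> \<le> 2 * (1/2) ^ l" by simp
    finally show ?thesis using True by simp
  qed simp
  finally show ?thesis unfolding F_def .
qed

section \<open>Construction of a frequently universal vector\<close>

context frechet
begin

text \<open>
  The vector is \<open>\<Sum>l. \<Sum>n\<in>A l. w l n\<close> for the separated sets \<open>A l\<close> above: applying \<open>R k\<close> with
  \<open>k \<in> A l\<close> reproduces \<open>y l\<close> from the term \<open>n = k\<close>, and the other terms are small.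
\<close>

lemma frequent_universality:
  fixes R :: "nat \<Rightarrow> 'a \<Rightarrow> 'a" and w :: "nat \<Rightarrow> nat \<Rightarrow> 'a" and y :: "nat \<Rightarrow> 'a"
  assumes lin: "\<And>k. linear (R k)" and cont: "\<And>k. continuous_on UNIV (R k)" and R1: "R 1 = id"
    and dense: "closure (range y) = UNIV"
    and wy: "\<And>l k. K \<le> k \<Longrightarrow> R k (w l k) = y l"
    and small: "\<And>l \<epsilon>. 0 < \<epsilon> \<Longrightarrow> \<exists>N. \<forall>k\<ge>1. \<forall>G. finite G \<and> 0 \<notin> G \<and> (\<forall>j\<in>G. j + N \<le> k \<or> k + N \<le> j)
        \<longrightarrow> dist (\<Sum>j\<in>G. R k (w l j)) 0 < \<epsilon>"
  obtains x where "\<And>V. open V \<Longrightarrow> V \<noteq> {} \<Longrightarrow> \<exists>A c. 0 < c \<and> A \<subseteq> {K..} \<and>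
      (\<forall>a\<in>A. \<forall>b\<in>A. a < b \<longrightarrow> a + K \<le> b) \<and> (\<forall>k\<in>A. R k x \<in> V) \<and>
      (\<forall>\<^sub>F P in sequentially. c * real P \<le> real (card (A \<inter> {..P})))"
proof -
  \<comment> \<open>Through the pairing function every \<open>y i\<close> occurs under infinitely
    many labels. The error attached to label \<open>l\<close> depends on \<open>l\<close> alone, so
    each \<open>y i\<close> is approximated arbitrarily well.\<close>
  define Y where "Y l = y (fst (prod_decode l))" for l
  define W where "W l = w (fst (prod_decode l))" for l
  define eps :: "nat \<Rightarrow> real" where "eps l = (1/2) ^ l / real (l + 1)" for l
  have eps_pos: "0 < eps l" for l by (simp add: eps_def)
  define good where "good N l \<epsilon> \<longleftrightarrow> (\<forall>k\<ge>1. \<forall>G. finite G \<and> 0 \<notin> G \<and> (\<forall>j\<in>G. j + N \<le> k \<or> k + N \<le> j)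
        \<longrightarrow> dist (\<Sum>j\<in>G. R k (W l j)) 0 < \<epsilon>)" for N l \<epsilon>
  have good_mono: "good N' l \<epsilon>" if "good N l \<epsilon>" "N \<le> N'" for N N' l \<epsilon>
    unfolding good_def
  proof (intro allI impI)
    fix k G assume "1 \<le> k" "finite G \<and> 0 \<notin> G \<and> (\<forall>j\<in>G. j + N' \<le> k \<or> k + N' \<le> j)"
    moreover from this have "\<forall>j\<in>G. j + N \<le> k \<or> k + N \<le> j" using that(2) by fastforce
    ultimately show "dist (\<Sum>j\<in>G. R k (W l j)) 0 < \<epsilon>"
      using that(1) by (simp add: good_def)
  qed
  have "\<exists>N. good N j (eps l)" for j l
    using small[OF eps_pos] by (simp add: good_def W_def)
  then obtain N0 where N0: "good (N0 j l) j (eps l)" for j l by metis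
  \<comment> \<open>Summing over all smaller labels makes \<open>N\<close> monotone and valid for
    every earlier \<open>j\<close>. The summand \<open>K\<close> keeps all indices in the range of
    \<open>wy\<close> and \<open>K\<close> apart; the summand \<open>l\<close> forces
    \<open>j \<le> n\<close> for \<open>n \<in> A j\<close>, so a finite set of indices meets only
    finitely many \<open>A j\<close>.\<close>
  define N where "N l = (\<Sum>i\<le>l. \<Sum>j\<le>i. N0 j i) + K + l" for l
  have N_mono: "mono N"
    unfolding mono_def N_def by (intro allI impI add_mono sum_mono2) auto
  have good_N: "good (N l) j (eps l)" if "j \<le> l" for j l
  proof (rule good_mono[OF N0])
    have "N0 j l \<le> (\<Sum>j\<le>l. N0 j l)" using that by (intro member_le_sum) auto
    also have "\<dots> \<le> (\<Sum>i\<le>l. \<Sum>j\<le>i. N0 j i)"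
      by (rule member_le_sum[of l "{..l}" "\<lambda>i. \<Sum>j\<le>i. N0 j i"]) auto
    finally show "N0 j l \<le> N l" by (simp add: N_def)
  qed
  obtain A where A_ge: "\<And>l n. n \<in> A l \<Longrightarrow> Suc (N l) \<le> n"
    and A_sep: "\<And>l j n n'. n \<in> A l \<Longrightarrow> n' \<in> A j \<Longrightarrow> n < n' \<Longrightarrow> n + Suc (N l) + Suc (N j) \<le> n'"
    and A_disj: "\<And>l j. l \<noteq> j \<Longrightarrow> A l \<inter> A j = {}"
    and A_dens: "\<And>l. \<exists>c>0. \<forall>\<^sub>F P in sequentially. c * real P \<le> real (card (A l \<inter> {..P}))"
    \<comment> \<open>The successor gives positive weights and keeps the elements of
      \<open>A l\<close> at distance at least \<open>N l\<close> from the index 1, where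
      \<open>R\<close> is the identity.\<close>
    using separated_sets_of_positive_density[of "\<lambda>l. Suc (N l)"] N_mono by (auto simp: mono_def)
  define u where "u n = (if \<exists>l. n \<in> A l then W (THE l. n \<in> A l) n else 0)" for n
  have u_eq: "u n = W l n" if "n \<in> A l" for n l
  proof -
    have "(THE l. n \<in> A l) = l" using that A_disj by (intro the_equality) blast+
    then show ?thesis using that by (auto simp: u_def)
  qed
  \<comment> \<open>Sort the indices by label: label \<open>j\<close> contributes at most
    \<open>eps (max l j)\<close>. The separation required here holds for \<open>k \<in> A l\<close>
    because the sets are separated by the sum of both weights, and for \<open>k = 1\<close> far
    enough out.\<close>
  have claim: "dist (\<Sum>n\<in>G. R k (u n)) 0 \<le> 2 * (1/2) ^ l"
    if kG: "1 \<le> k" "finite G" "\<And>j n. n \<in> G \<Longrightarrow> n \<in> A j \<Longrightarrow> n + N (max l j) \<le> k \<or> k + N (max l j) \<le> n" for k l G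
  proof -
    obtain B where B: "G \<subseteq> {..B}" using kG(2) finite_nat_iff_bounded_le by blast
    have "(\<Sum>n\<in>G. R k (u n)) = (\<Sum>n\<in>(\<Union>j\<in>{..B}. G \<inter> A j). R k (u n))"
    proof (rule sum.mono_neutral_right[OF kG(2)])
      show "\<forall>n\<in>G - (\<Union>j\<in>{..B}. G \<inter> A j). R k (u n) = 0"
      proof
        fix n assume n: "n \<in> G - (\<Union>j\<in>{..B}. G \<inter> A j)"
        have "n \<notin> A j" for j
        proof
          assume "n \<in> A j"
          moreover from this have "j \<le> n" using A_ge[of n j] by (simp add: N_def)
          ultimately show False using n B by fastforce
        qed
        then show "R k (u n) = 0" by (simp add: u_def linear_0[OF lin])
      qed
    qed auto
    also have "\<dots> = (\<Sum>j\<le>B. \<Sum>n\<in>G \<inter> A j. R k (u n))"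
      using kG(2) A_disj by (intro sum.UNION_disjoint) auto
    also have "\<dots> = (\<Sum>j\<le>B. \<Sum>n\<in>G \<inter> A j. R k (W j n))"
      by (intro sum.cong refl arg_cong[of _ _ "R k"] u_eq) auto
    finally have "dist (\<Sum>n\<in>G. R k (u n)) 0 \<le> (\<Sum>j\<le>B. dist (\<Sum>n\<in>G \<inter> A j. R k (W j n)) 0)"
      by (simp add: dist_sum_le)
    also have "\<dots> \<le> (\<Sum>j\<le>B. eps (max l j))"
    proof (rule sum_mono)
      fix j
      have "0 \<notin> A j" using A_ge[of 0 j] by auto
      then show "dist (\<Sum>n\<in>G \<inter> A j. R k (W j n)) 0 \<le> eps (max l j)"
        using good_N[of j "max l j"] kG unfolding good_def by (intro less_imp_le) auto
    qed
    also have "\<dots> \<le> 2 * (1/2) ^ l"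
      unfolding eps_def by (rule sum_max_geometric_le)
    finally show ?thesis .
  qed
  have small_pow: "\<exists>q. \<forall>l\<ge>q. 2 * (1/2) ^ l < e" if "0 < e" for e :: real
  proof -
    have "(\<lambda>l. 2 * (1/2::real) ^ l) \<longlonglongrightarrow> 2 * 0"
      by (intro tendsto_mult_left LIMSEQ_power_zero) simp
    from order_tendstoD(2)[OF this, of e] show ?thesis
      using that by (simp add: eventually_sequentially)
  qed
  define X where "X P = (\<Sum>n<P. u n)" for P
  \<comment> \<open>Since \<open>R 1 = id\<close>, blocks of the series are instances of
    \<open>claim\<close> with \<open>k = 1\<close>.\<close>
  have "Cauchy X"
  proof (rule CauchyI')
    fix e :: real assume "0 < e"
    from small_pow[OF this] obtain l where l: "2 * (1/2) ^ l < e" by blast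
    have "dist (X P) (X Q) < e" if "1 + N l \<le> P" "P < Q" for P Q
    proof -
      have "X Q - X P = (\<Sum>n\<in>{P..<Q}. u n)"
        unfolding X_def using that(2) sum_diff_nat_ivl[of 0 P Q u] by (simp add: atLeast0LessThan)
      then have "dist (X P) (X Q) = dist (\<Sum>n\<in>{P..<Q}. R 1 (u n)) 0"
        by (simp add: R1[simplified] dist_commute[of "X P"] dist_diff[of "X Q" "X P"])
      also have "\<dots> \<le> 2 * (1/2) ^ l"
      proof (rule claim)
        fix j n assume "n \<in> {P..<Q}" "n \<in> A j"
        then show "n + N (max l j) \<le> 1 \<or> 1 + N (max l j) \<le> n"
          using A_ge[of n j] that(1) by (auto simp: max_def)
      qed auto
      finally show ?thesis using l by simp
    qed
    then show "\<exists>M. \<forall>P\<ge>M. \<forall>Q>P. dist (X P) (X Q) < e" by blast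
  qed
  then obtain x where x: "X \<longlonglongrightarrow> x" using Cauchy_convergent convergent_def by blast
  have near: "dist (R k x) (Y l) \<le> 2 * (1/2) ^ l" if k: "k \<in> A l" for k l
  proof -
    have K: "1 \<le> k" "K \<le> k" using A_ge[OF k] by (auto simp: N_def)
    have "dist (R k (X P)) (Y l) \<le> 2 * (1/2) ^ l" if "k < P" for P
    proof -
      have "R k (X P) = (\<Sum>n<P. R k (u n))" unfolding X_def by (rule linear_sum[OF lin])
      also have "\<dots> = R k (u k) + (\<Sum>n\<in>{..<P} - {k}. R k (u n))"
        using that by (intro sum.remove) auto
      also have "R k (u k) = Y l" using wy[OF K(2)] by (simp add: u_eq[OF k] W_def Y_def)
      finally have "R k (X P) - Y l = (\<Sum>n\<in>{..<P} - {k}. R k (u n))" by simp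
      then have "dist (R k (X P)) (Y l) = dist (\<Sum>n\<in>{..<P} - {k}. R k (u n)) 0"
        by (simp only: dist_diff[of "R k (X P)" "Y l"])
      also have "\<dots> \<le> 2 * (1/2) ^ l"
      proof (rule claim[OF K(1)])
        fix j n assume n: "n \<in> {..<P} - {k}" "n \<in> A j"
        then consider "n < k" | "k < n" by force
        then show "n + N (max l j) \<le> k \<or> k + N (max l j) \<le> n"
          using A_sep[OF n(2) k] A_sep[OF k n(2)] by cases (auto simp: max_def)
      qed auto
      finally show ?thesis .
    qed
    then have "\<forall>\<^sub>F P in sequentially. dist (R k (X P)) (Y l) \<le> 2 * (1/2) ^ l"
      by (intro eventually_sequentiallyI[of "Suc k"]) simp
    then show ?thesis
      by (intro tendsto_upperbound[OF tendsto_dist[OF linear_tendsto[OF cont x] tendsto_const]]) auto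
  qed
  show ?thesis
  proof (rule that[of x])
    fix V :: "'a set" assume "open V" "V \<noteq> {}"
    then obtain i where i: "y i \<in> V"
      using dense open_Int_closure_eq_empty[of V "range y"] by auto
    then obtain r where r: "0 < r" "ball (y i) r \<subseteq> V" using \<open>open V\<close> open_contains_ball by blast
    obtain q where q: "\<And>l. q \<le> l \<Longrightarrow> 2 * (1/2) ^ l < r" using small_pow[OF r(1)] by blast
    define l where "l = prod_encode (i, q)"
    have "2 * (1/2) ^ l < r" unfolding l_def by (intro q le_prod_encode_2)
    moreover have "Y l = y i" by (simp add: Y_def l_def)
    ultimately have "\<forall>k\<in>A l. R k x \<in> V"
      using near[of _ l] r(2) by (fastforce simp: dist_commute)
    moreover have "A l \<subseteq> {K..}" using A_ge[of _ l] by (fastforce simp: N_def)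
    moreover have "\<forall>a\<in>A l. \<forall>b\<in>A l. a < b \<longrightarrow> a + K \<le> b"
      using A_sep[of _ l _ l] by (fastforce simp: N_def)
    ultimately show "\<exists>A c. 0 < c \<and> A \<subseteq> {K..} \<and>
      (\<forall>a\<in>A. \<forall>b\<in>A. a < b \<longrightarrow> a + K \<le> b) \<and> (\<forall>k\<in>A. R k x \<in> V) \<and>
      (\<forall>\<^sub>F P in sequentially. c * real P \<le> real (card (A \<inter> {..P})))"
      using A_dens[of l] by blast
  qed
qed

end

section \<open>Integration\<close>

lemma
  assumes "continuous_seminorm p"
  shows seminorm_continuous: "continuous_on UNIV p"
    and seminorm_add: "p (x + y) \<le> p x + p y"
    and seminorm_scaleR: "p (c *\<^sub>R x) = \<bar>c\<bar> * p x"
    and seminorm_zero: "p 0 = 0"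
    and seminorm_minus: "p (- x) = p x"
    and seminorm_nonneg: "0 \<le> p x"
    and seminorm_sum: "p (\<Sum>i\<in>I. g i) \<le> (\<Sum>i\<in>I. p (g i))"
proof -
  show cont: "continuous_on UNIV p" and add: "p (x + y) \<le> p x + p y"
    and scale: "p (c *\<^sub>R x) = \<bar>c\<bar> * p x" for x y c
    using assms by (auto simp: continuous_seminorm_def)
  show zero: "p 0 = 0" using scale[of 0 0] by simp
  show minus: "p (- x) = p x" for x using scale[of "-1" x] by simp
  show "0 \<le> p x" using add[of x "- x"] zero minus by simp
  show "p (\<Sum>i\<in>I. g i) \<le> (\<Sum>i\<in>I. p (g i))"
    by (induction I rule: infinite_finite_induct) (auto simp: zero intro: order_trans[OF add])
qed

lemma continuous_seminorm_compose_linear: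
  assumes "continuous_seminorm p" "linear L" "continuous_on UNIV L"
  shows "continuous_seminorm (\<lambda>x. p (L x))"
  using assms unfolding continuous_seminorm_def
  by (auto simp: linear_add linear_scale intro: continuous_on_compose2[of UNIV p UNIV L])

lemma seminorm_simple_bochner_integral:
  assumes p: "continuous_seminorm p" and u: "Bochner_Integration.simple_bochner_integrable M u"
  shows "ennreal (p (Bochner_Integration.simple_bochner_integral M u)) \<le> (\<integral>\<^sup>+x. ennreal (p (u x)) \<partial>M)"
proof -
  have "p (Bochner_Integration.simple_bochner_integral M u) \<le> (\<Sum>y\<in>u ` space M. p (measure M {x\<in>space M. u x = y} *\<^sub>R y))"
    unfolding simple_bochner_integral_def by (rule seminorm_sum[OF p])
  also have "\<dots> = (\<Sum>y\<in>u ` space M. measure M {x\<in>space M. u x = y} *\<^sub>R p y)"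
    by (simp add: seminorm_scaleR[OF p])
  also have "\<dots> = Bochner_Integration.simple_bochner_integral M (\<lambda>x. p (u x))"
    using u by (intro simple_bochner_integral_partition[symmetric])
      (auto intro: simple_bochner_integrable_compose2[where p="\<lambda>x y. p x", OF seminorm_zero[OF p]]
        elim: simple_bochner_integrable.cases)
  finally have "ennreal (p (Bochner_Integration.simple_bochner_integral M u)) \<le> ennreal (Bochner_Integration.simple_bochner_integral M (\<lambda>x. p (u x)))"
    by (rule ennreal_leI)
  also have "\<dots> = (\<integral>\<^sup>+x. ennreal (p (u x)) \<partial>M)"
    using u by (intro simple_bochner_integral_eq_nn_integral seminorm_nonneg[OF p]
        simple_bochner_integrable_compose2[where p="\<lambda>x y. p x", OF seminorm_zero[OF p]])
  finally show ?thesis .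
qed

context frechet
begin

text \<open>Without separability the difference of two Borel functions need not be Borel. Here
  \<open>u\<close> has finitely many values, so the function is glued from the finitely many Borel
  functions \<open>p (g x - i)\<close>.\<close>

lemma measurable_seminorm_diff:
  assumes p: "continuous_seminorm p" and g: "g \<in> borel_measurable M" and u: "simple_function M (u :: 'b \<Rightarrow> 'a)"
  shows "(\<lambda>x. p (g x - u x)) \<in> borel_measurable M"
proof (rule measurable_compose_countable'[of "u ` space M" "\<lambda>i x. p (g x - i)"])
  fix i
  have "continuous_on UNIV (\<lambda>z. p (z - i))"
    by (intro continuous_on_compose2[OF seminorm_continuous[OF p]])
      (auto simp: continuous_on_def intro!: tendsto_diff_frechet tendsto_ident_at)
  from measurable_compose[OF g borel_measurable_continuous_onI[OF this]]
  show "(\<lambda>x. p (g x - i)) \<in> borel_measurable M" .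
next
  show "countable (u ` space M)" using u by (simp add: simple_function_def countable_finite)
  then show "u \<in> measurable M (count_space (u ` space M))"
    using u by (simp add: measurable_count_space_eq_countable simple_function_def)
qed

lemma has_frechet_integral_unique_AE:
  assumes "has_frechet_integral M g y" "has_frechet_integral M g' (y' :: 'a)" "AE x in M. g x = g' x"
  shows "y = y'"
proof (rule ccontr)
  assume "y \<noteq> y'"
  then obtain p where p: "continuous_seminorm p" "0 < p (y - y')"
    using continuous_seminorm_separates[of "y - y'"] by auto
  obtain u where g: "g \<in> borel_measurable M" and u: "\<And>i. Bochner_Integration.simple_bochner_integrable M (u i)"
    "(\<lambda>i. \<integral>\<^sup>+ t. ennreal (p (g t - u i t)) \<partial>M) \<longlonglongrightarrow> 0"
    "(\<lambda>i::nat. Bochner_Integration.simple_bochner_integral M (u i)) \<longlonglongrightarrow> y"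
    using assms(1) p(1) unfolding has_frechet_integral_def by blast
  obtain v where g': "g' \<in> borel_measurable M" and v: "\<And>i. Bochner_Integration.simple_bochner_integrable M (v i)"
    "(\<lambda>i. \<integral>\<^sup>+ t. ennreal (p (g' t - v i t)) \<partial>M) \<longlonglongrightarrow> 0"
    "(\<lambda>i::nat. Bochner_Integration.simple_bochner_integral M (v i)) \<longlonglongrightarrow> y'"
    using assms(2) p(1) unfolding has_frechet_integral_def by blast
  have meas: "(\<lambda>t. p (g t - u i t)) \<in> borel_measurable M" "(\<lambda>t. p (g' t - v i t)) \<in> borel_measurable M" for i
    using g g' u(1)[of i] v(1)[of i]
    by (auto intro!: measurable_seminorm_diff[OF p(1)] elim: simple_bochner_integrable.cases)
  have le: "ennreal (p (Bochner_Integration.simple_bochner_integral M (u i) - Bochner_Integration.simple_bochner_integral M (v i)))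
     \<le> (\<integral>\<^sup>+ t. ennreal (p (g t - u i t)) \<partial>M) + (\<integral>\<^sup>+ t. ennreal (p (g' t - v i t)) \<partial>M)" for i
  proof -
    have "ennreal (p (Bochner_Integration.simple_bochner_integral M (u i) - Bochner_Integration.simple_bochner_integral M (v i)))
      = ennreal (p (Bochner_Integration.simple_bochner_integral M (\<lambda>t. u i t - v i t)))"
      by (simp add: simple_bochner_integral_diff u v)
    also have "\<dots> \<le> (\<integral>\<^sup>+ t. ennreal (p (u i t - v i t)) \<partial>M)"
      using simple_bochner_integrable_compose2[where p="(-)", OF _ u(1) v(1)]
      by (intro seminorm_simple_bochner_integral[OF p(1)]) simp
    also have "\<dots> \<le> (\<integral>\<^sup>+ t. ennreal (p (g t - u i t)) + ennreal (p (g' t - v i t)) \<partial>M)"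
    proof (intro nn_integral_mono_AE, use assms(3) in eventually_elim)
      fix t assume "g t = g' t"
      then have "u i t - v i t = - (g t - u i t) + (g' t - v i t)" by simp
      then have "p (u i t - v i t) \<le> p (g t - u i t) + p (g' t - v i t)"
        by (metis seminorm_add[OF p(1)] seminorm_minus[OF p(1)])
      then show "ennreal (p (u i t - v i t)) \<le> ennreal (p (g t - u i t)) + ennreal (p (g' t - v i t))"
        by (simp add: seminorm_nonneg[OF p(1)] flip: ennreal_plus)
    qed
    also have "\<dots> = (\<integral>\<^sup>+ t. ennreal (p (g t - u i t)) \<partial>M) + (\<integral>\<^sup>+ t. ennreal (p (g' t - v i t)) \<partial>M)"
      using meas by (intro nn_integral_add) auto
    finally show ?thesis .
  qed
  have "isCont p (y - y')" using seminorm_continuous[OF p(1)] by (simp add: continuous_on_eq_continuous_at)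
  from isCont_tendsto_compose[OF this tendsto_diff_frechet[OF u(3) v(3)]]
  have "(\<lambda>i. ennreal (p (Bochner_Integration.simple_bochner_integral M (u i) - Bochner_Integration.simple_bochner_integral M (v i)))) \<longlonglongrightarrow> ennreal (p (y - y'))"
    by (rule tendsto_ennrealI)
  moreover have "(\<lambda>i. (\<integral>\<^sup>+ t. ennreal (p (g t - u i t)) \<partial>M) + (\<integral>\<^sup>+ t. ennreal (p (g' t - v i t)) \<partial>M)) \<longlonglongrightarrow> 0 + 0"
    by (intro tendsto_add u v)
  ultimately have "ennreal (p (y - y')) \<le> 0"
    using le by (intro tendsto_le[OF sequentially_bot]) auto
  then show False using p(2) by simp
qed

lemma frechet_integral_eq: "has_frechet_integral M g (y::'a) \<Longrightarrow> frechet_integral M g = y"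
  unfolding frechet_integral_def using has_frechet_integral_unique_AE by blast

lemma has_frechet_integral_frechet_integral:
  "frechet_integrable M (g :: 'b \<Rightarrow> 'a) \<Longrightarrow> has_frechet_integral M g (frechet_integral M g)"
  unfolding frechet_integrable_def using frechet_integral_eq by blast

text \<open>Approximation in all continuous seminorms is inherited by images: if \<open>p\<close> is
  a continuous seminorm, so is its composition with \<open>L\<close>.\<close>

lemma has_frechet_integral_linear:
  assumes "has_frechet_integral M g (y::'a)" "linear (L :: 'a \<Rightarrow> 'a)" "continuous_on UNIV L"
  shows "has_frechet_integral M (\<lambda>t. L (g t)) (L y)"
proof -
  obtain u where g: "g \<in> borel_measurable M" and u: "\<And>i. Bochner_Integration.simple_bochner_integrable M (u i)"
    "\<And>p. continuous_seminorm p \<Longrightarrow> (\<lambda>i. \<integral>\<^sup>+ t. ennreal (p (g t - u i t)) \<partial>M) \<longlonglongrightarrow> 0"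
    "(\<lambda>i::nat. Bochner_Integration.simple_bochner_integral M (u i)) \<longlonglongrightarrow> y"
    using assms(1) unfolding has_frechet_integral_def by blast
  show ?thesis
    unfolding has_frechet_integral_def
  proof (intro conjI exI[of _ "\<lambda>i t. L (u i t)"] allI impI)
    show "(\<lambda>t. L (g t)) \<in> borel_measurable M"
      by (rule measurable_compose[OF g borel_measurable_continuous_onI[OF assms(3)]])
    show "Bochner_Integration.simple_bochner_integrable M (\<lambda>t. L (u i t))" for i
      using simple_bochner_integrable_compose2[where p="\<lambda>x y. L x", OF _ u(1) u(1)] linear_0[OF assms(2)] by simp
    show "(\<lambda>i. \<integral>\<^sup>+ t. ennreal (p (L (g t) - L (u i t))) \<partial>M) \<longlonglongrightarrow> 0" if "continuous_seminorm p" for p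
      using u(2)[OF continuous_seminorm_compose_linear[OF that assms(2,3)]] by (simp add: linear_diff[OF assms(2)])
    show "(\<lambda>i. Bochner_Integration.simple_bochner_integral M (\<lambda>t. L (u i t))) \<longlonglongrightarrow> L y"
      using linear_tendsto[OF assms(3) u(3)] by (simp add: simple_bochner_integral_linear[OF assms(2) u(1)])
  qed
qed

text \<open>The approximating simple functions are pulled back along the measure preserving
  \<open>f\<close>; their level sets keep their measures.\<close>

lemma has_frechet_integral_distr:
  assumes g: "has_frechet_integral M g (y::'a)" and f: "f \<in> measurable M' M" "distr M' M f = M"
  shows "has_frechet_integral M' (\<lambda>t. g (f t)) y"
proof -
  obtain u where g: "g \<in> borel_measurable M" and u: "\<And>i. Bochner_Integration.simple_bochner_integrable M (u i)"
    "\<And>p. continuous_seminorm p \<Longrightarrow> (\<lambda>i. \<integral>\<^sup>+ t. ennreal (p (g t - u i t)) \<partial>M) \<longlonglongrightarrow> 0"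
    "(\<lambda>i::nat. Bochner_Integration.simple_bochner_integral M (u i)) \<longlonglongrightarrow> y"
    using assms(1) unfolding has_frechet_integral_def by blast
  have simple: "simple_function M (u i)" for i using u(1)[of i] by (auto elim: simple_bochner_integrable.cases)
  have pre: "emeasure M' {x\<in>space M'. Q (u i (f x))} = emeasure M {x\<in>space M. Q (u i x)}" for i Q
  proof -
    have "{x\<in>space M. Q (u i x)} \<in> sets M"
      using simple_functionD(2)[OF simple, of i "Collect Q"] by (simp add: vimage_def Int_def conj_commute)
    then have "emeasure (distr M' M f) {x\<in>space M. Q (u i x)} = emeasure M' (f -` {x\<in>space M. Q (u i x)} \<inter> space M')"
      by (rule emeasure_distr[OF f(1)])
    also have "f -` {x\<in>space M. Q (u i x)} \<inter> space M' = {x\<in>space M'. Q (u i (f x))}"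
      using measurable_space[OF f(1)] by auto
    finally show ?thesis by (simp add: f(2))
  qed
  show ?thesis
    unfolding has_frechet_integral_def
  proof (intro conjI exI[of _ "\<lambda>i t. u i (f t)"] allI impI)
    show "(\<lambda>t. g (f t)) \<in> borel_measurable M'" by (rule measurable_compose[OF f(1) g])
    show "Bochner_Integration.simple_bochner_integrable M' (\<lambda>t. u i (f t))" for i
      using u(1)[of i] simple_function_comp[OF f(1) simple, of i] pre[of "\<lambda>y. y \<noteq> 0" i]
      by (auto simp: simple_bochner_integrable.simps)
    show "(\<lambda>i. \<integral>\<^sup>+ t. ennreal (p (g (f t) - u i (f t))) \<partial>M') \<longlonglongrightarrow> 0" if p: "continuous_seminorm p" for p
    proof -
      have "(\<integral>\<^sup>+ t. ennreal (p (g (f t) - u i (f t))) \<partial>M') = (\<integral>\<^sup>+ t. ennreal (p (g t - u i t)) \<partial>M)" for i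
        using nn_integral_distr[OF f(1), of "\<lambda>t. ennreal (p (g t - u i t))"] measurable_seminorm_diff[OF p g simple, of i]
        by (simp add: f(2))
      then show ?thesis using u(2)[OF p] by simp
    qed
    have "Bochner_Integration.simple_bochner_integral M' (\<lambda>t. u i (f t)) = Bochner_Integration.simple_bochner_integral M (u i)" for i
    proof -
      have "Bochner_Integration.simple_bochner_integral M' (\<lambda>t. u i (f t))
        = (\<Sum>y\<in>(\<lambda>t. u i (f t)) ` space M'. measure M {x\<in>space M. u i x = y} *\<^sub>R y)"
        unfolding simple_bochner_integral_def using pre[of "\<lambda>z. z = y" i for y] by (simp add: measure_def)
      also have "\<dots> = Bochner_Integration.simple_bochner_integral M (u i)"
        unfolding simple_bochner_integral_def
      \<comment> \<open>As \<open>f\<close> need not be onto, \<open>u i\<close> may have values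
        that the pullback misses; these are taken on null sets.\<close>
      proof (rule sum.mono_neutral_left)
        show "finite (u i ` space M)" using simple[of i] by (simp add: simple_function_def)
        show "(\<lambda>t. u i (f t)) ` space M' \<subseteq> u i ` space M" using measurable_space[OF f(1)] by auto
        show "\<forall>y\<in>u i ` space M - (\<lambda>t. u i (f t)) ` space M'. measure M {x\<in>space M. u i x = y} *\<^sub>R y = 0"
        proof
          fix y assume "y \<in> u i ` space M - (\<lambda>t. u i (f t)) ` space M'"
          then have empty: "{x\<in>space M'. u i (f x) = y} = {}" by blast
          have "measure M {x\<in>space M. u i x = y} = 0"
            using pre[of "\<lambda>z. z = y" i] unfolding empty by (simp add: measure_def)
          then show "measure M {x\<in>space M. u i x = y} *\<^sub>R y = 0" by simp
        qed
      qed
      finally show ?thesis .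
    qed
    then show "(\<lambda>i. Bochner_Integration.simple_bochner_integral M' (\<lambda>t. u i (f t))) \<longlonglongrightarrow> y" using u(3) by simp
  qed
qed

lemma has_frechet_integral_translation:
  fixes g :: "real \<Rightarrow> 'a"
  assumes "has_frechet_integral (lebesgue_on {a..b}) g y"
  shows "has_frechet_integral (lebesgue_on {a + c..b + c}) (\<lambda>t. g (t - c)) y"
proof (rule has_frechet_integral_distr[OF assms])
  have eq: "lebesgue = distr lebesgue lebesgue (\<lambda>t::real. t - c)"
    using lebesgue_real_affine[of 1 "-c"] by (simp add: density_1)
  have m: "(\<lambda>t::real. t - c) \<in> measurable lebesgue lebesgue"
    using lebesgue_affine_measurable[of "\<lambda>_. 1" "-c"] by simp
  then show meas: "(\<lambda>t. t - c) \<in> measurable (lebesgue_on {a + c..b + c}) (lebesgue_on {a..b})"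
    by (intro measurable_restrict_space3) auto
  show "distr (lebesgue_on {a + c..b + c}) (lebesgue_on {a..b}) (\<lambda>t. t - c) = lebesgue_on {a..b}"
  proof (rule measure_eqI)
    fix X assume "X \<in> sets (distr (lebesgue_on {a + c..b + c}) (lebesgue_on {a..b}) (\<lambda>t. t - c))"
    then have X: "X \<in> sets (lebesgue_on {a..b})" by simp
    then have X': "X \<in> sets lebesgue" "X \<subseteq> {a..b}" by (auto simp: sets_restrict_space)
    have sub: "(\<lambda>t. t - c) -` X \<subseteq> {a + c..b + c}"
    proof
      fix t assume "t \<in> (\<lambda>t. t - c) -` X"
      then have "t - c \<in> {a..b}" using X'(2) by blast
      then show "t \<in> {a + c..b + c}" by simp
    qed
    have "emeasure (distr (lebesgue_on {a + c..b + c}) (lebesgue_on {a..b}) (\<lambda>t. t - c)) X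
      = emeasure (lebesgue_on {a + c..b + c}) ((\<lambda>t. t - c) -` X \<inter> {a + c..b + c})"
      using X meas by (simp add: emeasure_distr)
    also have "(\<lambda>t. t - c) -` X \<inter> {a + c..b + c} = (\<lambda>t. t - c) -` X" using sub by auto
    also have "emeasure (lebesgue_on {a + c..b + c}) ((\<lambda>t. t - c) -` X) = emeasure lebesgue ((\<lambda>t. t - c) -` X)"
      using sub by (intro emeasure_restrict_space) auto
    also have "\<dots> = emeasure (distr lebesgue lebesgue (\<lambda>t. t - c)) X"
      using emeasure_distr[OF m X'(1)] by simp
    also have "\<dots> = emeasure (lebesgue_on {a..b}) X"
      using X' eq by (simp add: emeasure_restrict_space)
    finally show "emeasure (distr (lebesgue_on {a + c..b + c}) (lebesgue_on {a..b}) (\<lambda>t. t - c)) X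
      = emeasure (lebesgue_on {a..b}) X" .
  qed simp
qed

end

section \<open>Riemann sums and integrals of continuous functions over unit intervals\<close>

context frechet
begin

text \<open>Equally weighted left end points: the sums are plain averages, so convex sets control
  them, and linear maps pass through them exactly.\<close>

definition riemann_sum :: "(real \<Rightarrow> 'a) \<Rightarrow> nat \<Rightarrow> 'a"
  where "riemann_sum g n = (1 / real n) *\<^sub>R (\<Sum>i<n. g (real i / real n))"

text \<open>Repeating each node \<open>m\<close> times allows a termwise comparison with the sum
  over the finer grid.\<close>

lemma riemann_sum_refine:
  assumes "0 < m"
  shows "riemann_sum g n = (1 / real (n * m)) *\<^sub>R (\<Sum>j<n * m. g (real (j div m) / real n))"
proof -
  have "(\<Sum>j<n * m. g (real (j div m) / real n)) = (\<Sum>i<n. \<Sum>j=i * m..<i * m + m. g (real (j div m) / real n))"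
    by (rule sum.nat_group[symmetric])
  also have "\<dots> = (\<Sum>i<n. \<Sum>j=i * m..<i * m + m. g (real i / real n))"
  proof (intro sum.cong refl)
    fix i j assume "j \<in> {i * m..<i * m + m}"
    then have "j div m = i" using assms by (intro div_nat_eqI) (auto simp: mult.commute)
    then show "g (real (j div m) / real n) = g (real i / real n)" by simp
  qed
  also have "\<dots> = real m *\<^sub>R (\<Sum>i<n. g (real i / real n))"
    by (simp add: sum_constant_scaleR scaleR_sum_right)
  finally show ?thesis using assms by (simp add: riemann_sum_def)
qed

lemma continuous_oscillation:
  fixes g :: "real \<Rightarrow> 'a"
  assumes "continuous_on {0..1} g" "open V" "0 \<in> V"
  obtains n0 where "0 < n0" "\<And>n s t. n0 \<le> n \<Longrightarrow> s \<in> {0..1} \<Longrightarrow> t \<in> {0..1} \<Longrightarrow> \<bar>s - t\<bar> < 1 / real n \<Longrightarrow> g s - g t \<in> V"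
proof -
  obtain \<epsilon> where \<epsilon>: "0 < \<epsilon>" "ball 0 \<epsilon> \<subseteq> V" using assms open_contains_ball by blast
  have "uniformly_continuous_on {0..1} g" using assms(1) by (rule compact_uniformly_continuous) simp
  then obtain \<delta> where \<delta>: "0 < \<delta>" "\<And>s t. s \<in> {0..1} \<Longrightarrow> t \<in> {0..1} \<Longrightarrow> dist t s < \<delta> \<Longrightarrow> dist (g t) (g s) < \<epsilon>"
    using \<epsilon>(1) unfolding uniformly_continuous_on_def by metis
  obtain n0 where n0: "1 / \<delta> < real n0" using reals_Archimedean2 by blast
  then have n0_pos: "0 < n0" using \<delta>(1) by (cases n0) (auto simp: divide_less_0_iff)
  show ?thesis
  proof (rule that[OF n0_pos])
    fix n s t assume st: "n0 \<le> n" "s \<in> {0..1::real}" "t \<in> {0..1}" "\<bar>s - t\<bar> < 1 / real n"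
    have "1 / real n \<le> 1 / real n0" using st(1) n0_pos by (intro divide_left_mono) auto
    also have "\<dots> < \<delta>" using n0 \<delta>(1) n0_pos by (simp add: field_simps)
    finally have "dist (g s) (g t) < \<epsilon>" using st by (intro \<delta>(2)) (auto simp: dist_real_def)
    then have "dist (g s - g t) 0 < \<epsilon>" by (simp only: dist_diff[of "g s" "g t"])
    then show "g s - g t \<in> V" using \<epsilon>(2) by (auto simp: dist_commute)
  qed
qed

text \<open>Two sums are compared through their common refinement. Each comparison is an average of
  oscillations of \<open>g\<close>, which stays in a convex neighbourhood containing all of these;
  completeness then gives the limit.\<close>

lemma riemann_sum_convergent:
  fixes g :: "real \<Rightarrow> 'a"
  assumes "continuous_on {0..1} g"
  shows "convergent (riemann_sum g)"
proof (rule Cauchy_convergent, rule metric_CauchyI)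
  fix e :: real assume "0 < e"
  then have "0 < e / 2" by simp
  then obtain V where V: "open V" "convex V" "(0::'a) \<in> V" "\<And>x. x \<in> V \<Longrightarrow> dist x 0 < e / 2"
    by (rule convex_ball_subset) blast
  from assms V(1,3) obtain n0 where n0: "0 < n0" "\<And>n s t. n0 \<le> n \<Longrightarrow> s \<in> {0..1} \<Longrightarrow> t \<in> {0..1} \<Longrightarrow>
      \<bar>s - t\<bar> < 1 / real n \<Longrightarrow> g s - g t \<in> V"
    by (rule continuous_oscillation) blast
  have refine: "riemann_sum g n - riemann_sum g (n * m) \<in> V" if "n0 \<le> n" "0 < m" for n m
  proof -
    have n: "0 < n" using that n0 by simp
    have "riemann_sum g n - riemann_sum g (n * m)
      = (1 / real (n * m)) *\<^sub>R (\<Sum>j<n * m. g (real (j div m) / real n) - g (real j / real (n * m)))"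
      unfolding riemann_sum_refine[OF that(2), of g n]
      by (simp add: riemann_sum_def sum_subtractf scaleR_diff_right)
    also have "\<dots> \<in> V"
    proof (rule average_mem_convex[OF V(2)])
      fix j assume j: "j < n * m"
      have dm: "m * (j div m) + j mod m = j" "j mod m < m" using that(2) by auto
      have "real j = real m * real (j div m) + real (j mod m)"
        using dm(1) by (metis of_nat_add of_nat_mult)
      then have eq: "real j / real (n * m) = real (j div m) / real n + real (j mod m) / real (n * m)"
        using that(2) n by (simp add: field_simps)
      have small: "real (j mod m) / real (n * m) < 1 / real n"
        using dm(2) n that(2) by (simp add: field_simps)
      have "real j / real (n * m) \<le> 1" using j by (simp add: divide_le_eq flip: of_nat_mult)
      moreover have "0 \<le> real (j mod m) / real (n * m)" "0 \<le> real (j div m) / real n" by simp_all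
      moreover have "c = a + b \<Longrightarrow> c \<le> 1 \<Longrightarrow> 0 \<le> b \<Longrightarrow> 0 \<le> a \<Longrightarrow> b < d \<Longrightarrow>
          a \<in> {0..1} \<and> c \<in> {0..1} \<and> \<bar>a - c\<bar> < d" for a b c d :: real
        by auto
      ultimately have "real (j div m) / real n \<in> {0..1} \<and> real j / real (n * m) \<in> {0..1} \<and>
        \<bar>real (j div m) / real n - real j / real (n * m)\<bar> < 1 / real n"
        using eq small by blast
      then show "g (real (j div m) / real n) - g (real j / real (n * m)) \<in> V"
        by (intro n0(2)[OF that(1)]) blast+
    qed (use n that(2) in simp)
    finally show ?thesis .
  qed
  have "dist (riemann_sum g m) (riemann_sum g n) < e" if "n0 \<le> m" "n0 \<le> n" for m n
  proof -
    have "dist (riemann_sum g m) (riemann_sum g (m * n)) < e / 2"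
      using V(4)[OF refine[of m n]] that n0(1) by (simp add: dist_diff[of "riemann_sum g m"])
    moreover have "dist (riemann_sum g n) (riemann_sum g (m * n)) < e / 2"
      using V(4)[OF refine[of n m]] that n0(1) by (simp add: dist_diff[of "riemann_sum g n"] mult.commute)
    ultimately show ?thesis by (rule dist_triangle_half_l)
  qed
  then show "\<exists>M. \<forall>m\<ge>M. \<forall>n\<ge>M. dist (riemann_sum g m) (riemann_sum g n) < e" by blast
qed

text \<open>The step functions that freeze \<open>g\<close> at the left grid points have the Riemann
  sums as their integrals and converge to \<open>g\<close> uniformly in every continuous
  seminorm.\<close>

lemma has_frechet_integral_unit_interval:
  fixes g :: "real \<Rightarrow> 'a"
  assumes g: "continuous_on {0..1} g" and y: "riemann_sum g \<longlonglongrightarrow> y"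
  shows "has_frechet_integral (lebesgue_on {0..1}) g y"
proof -
  define k where "k N t = nat \<lfloor>real N * t\<rfloor>" for N t
  define u where "u n t = g (real (k (Suc n) t) / real (Suc n))" for n t
  let ?M = "lebesgue_on {0..1::real}"
  have k_iff: "k N t = i \<longleftrightarrow> real i \<le> real N * t \<and> real N * t < real i + 1" if "0 \<le> t" for N t i
  proof -
    have "0 \<le> \<lfloor>real N * t\<rfloor>" using that by simp
    then have "k N t = i \<longleftrightarrow> \<lfloor>real N * t\<rfloor> = int i" unfolding k_def by linarith
    then show ?thesis by (simp add: floor_eq_iff)
  qed
  have k_le: "k N t \<le> N" if "t \<in> {0..1}" for N t
  proof -
    have "real N * t \<le> real N * 1" using that by (intro mult_left_mono) auto
    then have "real (k N t) \<le> real N" using k_iff[of t N "k N t"] that by auto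
    then show ?thesis by simp
  qed
  have k_simple: "simple_function ?M (k N)" for N
    unfolding simple_function_def
  proof
    show "finite (k N ` space ?M)" by (rule finite_subset[of _ "{..N}"]) (use k_le in auto)
    show "\<forall>x\<in>k N ` space ?M. k N -` {x} \<inter> space ?M \<in> sets ?M"
    proof
      fix x
      have "k N \<in> measurable borel (count_space UNIV)" unfolding k_def by measurable
      from measurable_sets[OF this, of "{x}"] have "k N -` {x} \<in> sets borel" by simp
      then have "k N -` {x} \<in> sets lebesgue" by simp
      then show "k N -` {x} \<inter> space ?M \<in> sets ?M" by (auto simp: sets_restrict_space)
    qed
  qed
  have finite_M: "emeasure ?M A \<noteq> \<infinity>" for A
  proof -
    have "emeasure ?M A \<le> emeasure ?M (space ?M)" by (rule emeasure_space)
    also have "\<dots> = 1" by (simp add: emeasure_restrict_space)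
    finally show ?thesis by (auto simp: top_unique)
  qed
  have u_simple: "Bochner_Integration.simple_bochner_integrable ?M (u n)" for n
  proof (rule simple_bochner_integrable.intros[OF _ finite_M])
    show "simple_function ?M (u n)" unfolding u_def by (rule simple_function_compose1[OF k_simple])
  qed
  have u_integral: "Bochner_Integration.simple_bochner_integral ?M (u n) = riemann_sum g (Suc n)" for n
  proof -
    let ?N = "Suc n"
    have img: "k ?N ` space ?M = {..?N}"
    proof
      show "k ?N ` space ?M \<subseteq> {..?N}" using k_le by auto
      show "{..?N} \<subseteq> k ?N ` space ?M"
      proof
        fix i assume "i \<in> {..?N}"
        then have "real i / real ?N \<in> {0..1}" by (simp add: divide_le_eq)
        moreover from this have "k ?N (real i / real ?N) = i" by (subst k_iff) auto
        ultimately show "i \<in> k ?N ` space ?M" by (intro image_eqI[of _ _ "real i / real ?N"]) auto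
      qed
    qed
    \<comment> \<open>Among the values \<open>0..N\<close> of \<open>k N\<close> the last one occurs
      only at \<open>t = 1\<close>; this null set explains why the sum stops before
      \<open>N\<close>.\<close>
    have meas: "measure ?M {t\<in>space ?M. k ?N t = i} = (if i < ?N then 1 / real ?N else 0)" if "i \<le> ?N" for i
    proof (cases "i < ?N")
      case True
      have eq: "{t\<in>space ?M. k ?N t = i} = {real i / real ?N..<(real i + 1) / real ?N}"
      proof (intro set_eqI iffI)
        fix t assume "t \<in> {t\<in>space ?M. k ?N t = i}"
        then show "t \<in> {real i / real ?N..<(real i + 1) / real ?N}"
          using k_iff[of t ?N i] by (simp add: field_simps)
      next
        fix t assume t: "t \<in> {real i / real ?N..<(real i + 1) / real ?N}"
        have "0 \<le> real i / real ?N" "(real i + 1) / real ?N \<le> 1" using True by (simp_all add: divide_le_eq)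
        then have t01: "0 \<le> t" "t \<le> 1" using t unfolding atLeastLessThan_iff by linarith+
        then show "t \<in> {t\<in>space ?M. k ?N t = i}"
          using t k_iff[of t ?N i] by (simp add: field_simps)
      qed
      have "{real i / real ?N..<(real i + 1) / real ?N} \<subseteq> {0..1}"
        unfolding eq[symmetric] by auto
      then have "measure ?M {t\<in>space ?M. k ?N t = i} = measure lebesgue {real i / real ?N..<(real i + 1) / real ?N}"
        unfolding eq by (intro measure_restrict_space) auto
      also have "\<dots> = (real i + 1) / real ?N - real i / real ?N"
        by (simp add: divide_right_mono)
      finally show ?thesis using True by (simp add: add_divide_distrib)
    next
      case False
      then have i: "i = ?N" using that by simp
      have "{t\<in>space ?M. k ?N t = i} = {1}"
      proof (intro set_eqI iffI)
        fix t assume "t \<in> {t\<in>space ?M. k ?N t = i}"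
        then have "0 \<le> t" "t \<le> 1" "real ?N * 1 \<le> real ?N * t" using k_iff[of t ?N i] i by auto
        moreover from this(3) have "1 \<le> t" by (subst (asm) mult_le_cancel_left_pos) auto
        ultimately show "t \<in> {1}" by simp
      next
        fix t :: real assume "t \<in> {1}"
        then show "t \<in> {t\<in>space ?M. k ?N t = i}" using k_iff[of t ?N i] i by simp
      qed
      then show ?thesis using i by (simp add: measure_restrict_space)
    qed
    have "Bochner_Integration.simple_bochner_integral ?M (u n)
       = (\<Sum>i\<in>k ?N ` space ?M. measure ?M {t\<in>space ?M. k ?N t = i} *\<^sub>R g (real i / real ?N))"
      by (intro simple_bochner_integral_partition u_simple k_simple) (simp_all add: u_def)
    also have "\<dots> = (\<Sum>i\<le>?N. (if i < ?N then 1 / real ?N else 0) *\<^sub>R g (real i / real ?N))"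
      unfolding img by (intro sum.cong refl) (simp only: meas atMost_iff)
    also have "\<dots> = (\<Sum>i<?N. (1 / real ?N) *\<^sub>R g (real i / real ?N))"
      by (rule sum.mono_neutral_cong_right) auto
    also have "\<dots> = riemann_sum g ?N"
      by (simp only: riemann_sum_def scaleR_sum_right)
    finally show ?thesis .
  qed
  show ?thesis
    unfolding has_frechet_integral_def
  proof (intro conjI exI[of _ u] allI impI u_simple)
    show "g \<in> borel_measurable ?M" by (rule continuous_imp_measurable_on_sets_lebesgue[OF g]) simp
    show "(\<lambda>i. Bochner_Integration.simple_bochner_integral ?M (u i)) \<longlonglongrightarrow> y"
      unfolding u_integral using y by (rule LIMSEQ_Suc)
    fix p :: "'a \<Rightarrow> real" assume p: "continuous_seminorm p"
    show "(\<lambda>i. \<integral>\<^sup>+ t. ennreal (p (g t - u i t)) \<partial>?M) \<longlonglongrightarrow> 0"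
    proof (rule order_tendstoI)
      fix a :: ennreal assume "0 < a"
      then obtain b where b: "0 < b" "b < a" using dense by blast
      then obtain e where "0 < e" "b = ennreal e"
        by (cases b) (auto simp: top_unique ennreal_less_zero_iff)
      define V where "V = {z. p z < e}"
      have "open V" unfolding V_def
        by (intro open_Collect_less seminorm_continuous[OF p] continuous_on_const)
      moreover have "0 \<in> V" using \<open>0 < e\<close> seminorm_zero[OF p] by (simp add: V_def)
      ultimately obtain n0 where n0: "0 < n0" "\<And>n s t. n0 \<le> n \<Longrightarrow> s \<in> {0..1} \<Longrightarrow> t \<in> {0..1} \<Longrightarrow>
          \<bar>s - t\<bar> < 1 / real n \<Longrightarrow> g s - g t \<in> V"
        using continuous_oscillation[OF g] by metis
      have "(\<integral>\<^sup>+ t. ennreal (p (g t - u n t)) \<partial>?M) \<le> ennreal e" if "n0 \<le> n" for n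
      proof -
        have "(\<integral>\<^sup>+ t. ennreal (p (g t - u n t)) \<partial>?M) \<le> (\<integral>\<^sup>+ t. ennreal e \<partial>?M)"
        proof (rule nn_integral_mono)
          fix t assume "t \<in> space ?M"
          then have t: "t \<in> {0..1}" by simp
          let ?s = "real (k (Suc n) t) / real (Suc n)"
          have "real (k (Suc n) t) \<le> real (Suc n) * t" "real (Suc n) * t < real (k (Suc n) t) + 1"
            using k_iff[of t "Suc n" "k (Suc n) t"] t by auto
          then have "?s \<le> t" "t < ?s + 1 / real (Suc n)" by (simp_all add: field_simps)
          moreover have "0 \<le> ?s" by simp
          moreover have "s \<le> t \<Longrightarrow> t < s + d \<Longrightarrow> 0 \<le> s \<Longrightarrow> s \<in> {0..1} \<and> \<bar>t - s\<bar> < d" for s d :: real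
            using t by auto
          ultimately have "?s \<in> {0..1} \<and> \<bar>t - ?s\<bar> < 1 / real (Suc n)" by blast
          then have "g t - g ?s \<in> V" using t that by (intro n0(2)[of "Suc n"]) auto
          then show "ennreal (p (g t - u n t)) \<le> ennreal e"
            by (intro ennreal_leI) (simp add: V_def u_def)
        qed
        also have "\<dots> = ennreal e" by (simp add: emeasure_restrict_space)
        finally show ?thesis .
      qed
      then show "\<forall>\<^sub>F n in sequentially. (\<integral>\<^sup>+ t. ennreal (p (g t - u n t)) \<partial>?M) < a"
        using b \<open>b = ennreal e\<close> unfolding eventually_sequentially by (meson le_less_trans)
    qed simp
  qed
qed

lemma has_frechet_integral_continuous:
  fixes g :: "real \<Rightarrow> 'a"
  assumes "continuous_on {a..a+1} g" "riemann_sum (\<lambda>t. g (a + t)) \<longlonglongrightarrow> y"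
  shows "has_frechet_integral (lebesgue_on {a..a+1}) g y"
proof -
  have "continuous_on {0..1} (\<lambda>t. g (a + t))"
    by (intro continuous_on_compose2[OF assms(1)] continuous_intros) auto
  from has_frechet_integral_translation[OF has_frechet_integral_unit_interval[OF this assms(2)], of a]
  show ?thesis by (simp add: add.commute)
qed

end

section \<open>The criterion along a ray\<close>

lemma (in frechet) linear_riemann_sum:
  assumes "linear (L :: 'a \<Rightarrow> 'a)"
  shows "L (riemann_sum g n) = riemann_sum (\<lambda>t. L (g t)) n"
  by (simp add: riemann_sum_def linear_scale[OF assms] linear_sum[OF assms])

lemma sum_lessThan_add: "(\<Sum>i<a + b. h i) = (\<Sum>i<a. h i) + (\<Sum>i<b. h (i + a))"
  for h :: "nat \<Rightarrow> 'b::comm_monoid_add"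
  by (induction b) (simp_all add: ac_simps)

text \<open>\<open>U s\<close> and \<open>S s\<close> stand for \<open>T (s t\<^sub>0)\<close> and \<open>S (s t\<^sub>0)\<close> with \<open>t\<^sub>0\<close> fixed.\<close>

locale ray_criterion = frechet +
  fixes U S :: "real \<Rightarrow> 'a \<Rightarrow> 'a::{real_vector, complete_space}" and E0 :: "'a set" and m :: "nat \<Rightarrow> real"
  assumes linear_U: "0 \<le> s \<Longrightarrow> linear (U s)"
    and continuous_U: "0 \<le> s \<Longrightarrow> continuous_on UNIV (U s)"
    and U_zero: "U 0 = id"
    and U_add: "0 \<le> s \<Longrightarrow> 0 \<le> t \<Longrightarrow> U (s + t) x = U s (U t x)"
    and orbit_continuous: "continuous_on {0..} (\<lambda>s. U s x)"
    and dense_E0: "closure E0 = UNIV"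
    and U_E0: "0 \<le> s \<Longrightarrow> x \<in> E0 \<Longrightarrow> U s x \<in> E0"
    and U_S: "0 \<le> s \<Longrightarrow> x \<in> E0 \<Longrightarrow> U s (S s x) = x"
    and U_S_less: "0 < t \<Longrightarrow> t < r \<Longrightarrow> x \<in> E0 \<Longrightarrow> U t (S r x) = S (r - t) x"
    and m_ge: "1 \<le> m k" and m_mono: "mono m"
    and forward: "1 \<le> q \<Longrightarrow> x \<in> E0 \<Longrightarrow> uniformly_uncond_convergent {1..} (\<lambda>n k. if n \<le> k
          then frechet_integral (lebesgue_on (B_interval m k n)) (\<lambda>t. U (t / real q) x) else 0)"
    and backward_integrable: "1 \<le> k \<Longrightarrow> 1 \<le> n \<Longrightarrow> x \<in> E0 \<Longrightarrow>
          frechet_integrable (lebesgue_on (A_interval m k n)) (\<lambda>t. S t x)"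
    and backward: "x \<in> E0 \<Longrightarrow> uniformly_uncond_convergent {1..}
          (\<lambda>n k. frechet_integral (lebesgue_on (A_interval m k n)) (\<lambda>t. S t x))"
    and separable: "\<exists>C::'a set. countable C \<and> closure C = UNIV"
    and nontrivial: "\<exists>x::'a. x \<noteq> 0"
begin

section \<open>Gaps and averages of orbits\<close>

definition M :: "nat \<Rightarrow> int"
  where "M k = \<lfloor>m k\<rfloor>"

lemma M_mono: "a \<le> b \<Longrightarrow> M a \<le> M b"
  using m_mono by (auto simp: M_def mono_def intro: floor_mono)

definition gap :: "nat \<Rightarrow> nat \<Rightarrow> nat"
  where "gap a b = nat (M b - M a)"

lemma gap_add: "a \<le> b \<Longrightarrow> b \<le> c \<Longrightarrow> gap a c = gap b c + gap a b"
  using M_mono[of a b] M_mono[of b c] by (simp add: gap_def nat_add_distrib[symmetric])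

lemma B_interval_eq: "n \<le> k \<Longrightarrow> B_interval m k n = {real (gap (k - n) k)..real (gap (k - n) k) + 1}"
  using M_mono[of "k - n" k] by (simp add: B_interval_def gap_def M_def)

lemma A_interval_eq: "A_interval m k n = {real (gap k (k + n)) - 1..real (gap k (k + n))}"
  using M_mono[of k "k + n"] by (simp add: A_interval_def gap_def M_def)

text \<open>The integral of \<open>U (c * t) x\<close> over \<open>t\<close> in
  \<open>[0, 1]\<close>, which for \<open>c > 0\<close> is the mean of the orbit over
  \<open>[0, c]\<close>. As a limit of Riemann sums it inherits identities that hold for finite
  sums; \<open>c = 1 / q\<close> belongs to (ii) at the point \<open>t\<^sub>0 / q\<close>.\<close>

definition Phi :: "real \<Rightarrow> 'a \<Rightarrow> 'a"
  where "Phi c x = lim (riemann_sum (\<lambda>t. U (c * t) x))"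

lemma Phi_tendsto:
  assumes "0 \<le> c"
  shows "riemann_sum (\<lambda>t. U (c * t) x) \<longlonglongrightarrow> Phi c x"
proof -
  have "continuous_on {0..1} (\<lambda>t. U (c * t) x)"
    using assms by (intro continuous_on_compose2[OF orbit_continuous] continuous_intros) auto
  then show ?thesis
    using riemann_sum_convergent convergent_LIMSEQ_iff unfolding Phi_def by blast
qed

lemma Phi_commute:
  assumes "0 \<le> c" "0 \<le> s"
  shows "U s (Phi c x) = Phi c (U s x)"
proof (rule LIMSEQ_unique)
  have "U s (riemann_sum (\<lambda>t. U (c * t) x) n) = riemann_sum (\<lambda>t. U (c * t) (U s x)) n" for n
    unfolding linear_riemann_sum[OF linear_U[OF assms(2)]]
    unfolding riemann_sum_def
    using assms by (simp add: U_add[symmetric] add.commute)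
  then show "riemann_sum (\<lambda>t. U (c * t) (U s x)) \<longlonglongrightarrow> U s (Phi c x)"
    using linear_tendsto[OF continuous_U[OF assms(2)] Phi_tendsto[OF assms(1), of x]] by simp
  show "riemann_sum (\<lambda>t. U (c * t) (U s x)) \<longlonglongrightarrow> Phi c (U s x)"
    by (rule Phi_tendsto[OF assms(1)])
qed

lemma has_frechet_integral_orbit:
  assumes "0 \<le> c" "0 \<le> a"
  shows "has_frechet_integral (lebesgue_on {a..a + 1}) (\<lambda>t. U (c * t) x) (U (c * a) (Phi c x))"
proof (rule has_frechet_integral_continuous)
  show "continuous_on {a..a + 1} (\<lambda>t. U (c * t) x)"
    using assms by (intro continuous_on_compose2[OF orbit_continuous] continuous_intros) auto
  have ca: "0 \<le> c * a" using assms by simp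
  have "U (c * a) (riemann_sum (\<lambda>t. U (c * t) x) n) = riemann_sum (\<lambda>t. U (c * (a + t)) x) n" for n
    unfolding linear_riemann_sum[OF linear_U[OF ca]]
    unfolding riemann_sum_def
    using assms by (simp add: U_add[symmetric] ring_distribs)
  then show "riemann_sum (\<lambda>t. U (c * (a + t)) x) \<longlonglongrightarrow> U (c * a) (Phi c x)"
    using linear_tendsto[OF continuous_U[OF ca] Phi_tendsto[OF assms(1), of x]] by simp
qed

lemma forward_integral:
  assumes "1 \<le> q" "n \<le> k"
  shows "frechet_integral (lebesgue_on (B_interval m k n)) (\<lambda>t. U (t / real q) x)
    = U (real (gap (k - n) k) / real q) (Phi (1 / real q) x)"
  using has_frechet_integral_orbit[of "1 / real q" "real (gap (k - n) k)" x] assms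
  by (intro frechet_integral_eq) (simp add: B_interval_eq)

lemma forward_sums:
  assumes "1 \<le> q" "x \<in> E0" "0 < \<epsilon>"
  obtains N where "1 \<le> N" "\<And>F k. finite F \<Longrightarrow> F \<subseteq> {N..k} \<Longrightarrow> 1 \<le> k \<Longrightarrow>
    dist (\<Sum>n\<in>F. U (real (gap (k - n) k) / real q) (Phi (1 / real q) x)) 0 < \<epsilon>"
proof -
  from forward[OF assms(1,2), unfolded uniformly_uncond_convergent_def, rule_format, OF assms(3)]
  obtain N where N: "1 \<le> N" "\<forall>F k. finite F \<and> F \<subseteq> {N..} \<and> k \<in> {1..} \<longrightarrow>
    dist (\<Sum>n\<in>F. if n \<le> k then frechet_integral (lebesgue_on (B_interval m k n)) (\<lambda>t. U (t / real q) x) else 0) 0 < \<epsilon>"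
    by blast
  show ?thesis
  proof (rule that[OF N(1)])
    fix F k assume F: "finite F" "F \<subseteq> {N..k}" "1 \<le> (k::nat)"
    have "(\<Sum>n\<in>F. U (real (gap (k - n) k) / real q) (Phi (1 / real q) x))
      = (\<Sum>n\<in>F. if n \<le> k then frechet_integral (lebesgue_on (B_interval m k n)) (\<lambda>t. U (t / real q) x) else 0)"
      using F by (intro sum.cong) (auto simp: forward_integral[OF assms(1)])
    then show "dist (\<Sum>n\<in>F. U (real (gap (k - n) k) / real q) (Phi (1 / real q) x)) 0 < \<epsilon>"
      using N(2)[rule_format, of F k] F by fastforce
  qed
qed

text \<open>Both sides are \<open>q\<close> times the integral of the orbit over
  \<open>[1, 1 + 1/q]\<close> minus that over \<open>[0, 1/q]\<close>: on the right the common part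
  \<open>[1/q, 1]\<close> cancels.\<close>

lemma Phi_difference:
  assumes "1 \<le> q"
  shows "U 1 (Phi (1 / real q) x) - Phi (1 / real q) x = real q *\<^sub>R (U (1 / real q) (Phi 1 x) - Phi 1 x)"
proof (rule LIMSEQ_unique)
  let ?r = "\<lambda>c n. riemann_sum (\<lambda>t. U (c * t) x) n"
  have q: "0 \<le> 1 / real q" "0 < q" using assms by auto
  show "(\<lambda>n. U 1 (?r (1 / real q) n) - ?r (1 / real q) n) \<longlonglongrightarrow> U 1 (Phi (1 / real q) x) - Phi (1 / real q) x"
    by (intro tendsto_diff_frechet linear_tendsto[OF continuous_U] Phi_tendsto q) simp
  have "(\<lambda>n. ?r 1 (q * n)) \<longlonglongrightarrow> Phi 1 x"
    using Phi_tendsto[of 1 x] q(2) by (intro filterlim_compose[OF Phi_tendsto]) (auto intro: mult_nat_left_at_top)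
  then have lim: "(\<lambda>n. real q *\<^sub>R (U (1 / real q) (?r 1 (q * n)) - ?r 1 (q * n))) \<longlonglongrightarrow> real q *\<^sub>R (U (1 / real q) (Phi 1 x) - Phi 1 x)"
    by (intro tendsto_scaleR_frechet tendsto_const tendsto_diff_frechet linear_tendsto[OF continuous_U] q)
  have "real q *\<^sub>R (U (1 / real q) (?r 1 (q * n)) - ?r 1 (q * n)) = U 1 (?r (1 / real q) n) - ?r (1 / real q) n" if "0 < n" for n
  proof -
    \<comment> \<open>On the grid of mesh \<open>1 / (q * n)\<close> the shifts by
      \<open>1 / q\<close> and by 1 are shifts by \<open>n\<close> and by \<open>q * n\<close>
      nodes, so the cancellation is an identity between finite sums.\<close>
    define h where "h i = U (real i / real (q * n)) x" for i
    have qn: "1 / real q + real i / real (q * n) = real (i + n) / real (q * n)"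
      "1 + real i / real (q * n) = real (i + q * n) / real (q * n)" for i
      using that q by (simp_all add: field_simps)
    have 1: "?r 1 (q * n) = (1 / real (q * n)) *\<^sub>R (\<Sum>i<q * n. h i)"
      by (simp add: riemann_sum_def h_def)
    have 2: "U (1 / real q) (?r 1 (q * n)) = (1 / real (q * n)) *\<^sub>R (\<Sum>i<q * n. h (i + n))"
      unfolding linear_riemann_sum[OF linear_U[OF q(1)]]
      by (simp only: riemann_sum_def h_def mult_1 U_add[OF q(1), symmetric] qn zero_le_divide_iff of_nat_0_le_iff simp_thms)
    have 3: "?r (1 / real q) n = (1 / real n) *\<^sub>R (\<Sum>i<n. h i)"
      by (simp add: riemann_sum_def h_def mult.commute)
    have 4: "U 1 (?r (1 / real q) n) = (1 / real n) *\<^sub>R (\<Sum>i<n. h (i + q * n))"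
    proof -
      have "U 1 (U (1 / real q * (real i / real n)) x) = h (i + q * n)" for i
      proof -
        have "U 1 (U (1 / real q * (real i / real n)) x) = U (1 + real i / real (q * n)) x"
          by (subst U_add) (simp_all add: mult.commute)
        then show ?thesis by (simp only: qn h_def)
      qed
      then show ?thesis unfolding linear_riemann_sum[OF linear_U[of 1, simplified]] unfolding riemann_sum_def by simp
    qed
    have "(\<Sum>i<n. h i) + (\<Sum>i<q * n. h (i + n)) = (\<Sum>i<q * n. h i) + (\<Sum>i<n. h (i + q * n))"
      by (simp flip: sum_lessThan_add add: add.commute)
    then have "(\<Sum>i<q * n. h (i + n)) - (\<Sum>i<q * n. h i) = (\<Sum>i<n. h (i + q * n)) - (\<Sum>i<n. h i)"
      by (simp add: algebra_simps)
    then show ?thesis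
      unfolding 2 4 unfolding 1 3 using q(2) by (simp flip: scaleR_diff_right)
  qed
  then have "\<forall>\<^sub>F n in sequentially. real q *\<^sub>R (U (1 / real q) (?r 1 (q * n)) - ?r 1 (q * n)) = U 1 (?r (1 / real q) n) - ?r (1 / real q) n"
    by (intro eventually_sequentiallyI[of 1]) simp
  from Lim_transform_eventually[OF lim this]
  show "(\<lambda>n. U 1 (?r (1 / real q) n) - ?r (1 / real q) n) \<longlonglongrightarrow> real q *\<^sub>R (U (1 / real q) (Phi 1 x) - Phi 1 x)" .
qed

text \<open>For large \<open>q\<close> the difference is a limit of averages of
  \<open>U s x - x\<close> with small \<open>s\<close>, all of which lie in one convex
  neighbourhood.\<close>

lemma Phi_small_tendsto: "(\<lambda>q. Phi (1 / real (Suc q)) x) \<longlonglongrightarrow> x"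
proof (rule tendstoI)
  fix e :: real assume "0 < e"
  then have "0 < e / 2" by simp
  then obtain V where V: "open V" "convex V" "(0::'a) \<in> V" "\<And>x. x \<in> V \<Longrightarrow> dist x 0 < e / 2"
    by (rule convex_ball_subset) blast
  obtain \<epsilon> where \<epsilon>: "0 < \<epsilon>" "ball 0 \<epsilon> \<subseteq> V" using V open_contains_ball by blast
  have "\<exists>d>0. \<forall>s\<in>{0..}. dist s 0 < d \<longrightarrow> dist (U s x) (U 0 x) < \<epsilon>"
    using orbit_continuous[of x, unfolded continuous_on_iff, rule_format, of 0 \<epsilon>] \<epsilon>(1) by simp
  then obtain d where d: "0 < d" "\<And>s. 0 \<le> s \<Longrightarrow> s < d \<Longrightarrow> dist (U s x) x < \<epsilon>"
    using U_zero by (auto simp: dist_real_def)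
  obtain q0 where q0: "1 / real (Suc q0) < d" using d(1) nat_approx_posE by metis
  have "dist (Phi (1 / real (Suc q)) x) x < e" if "q0 \<le> q" for q
  proof -
    have q: "0 \<le> 1 / real (Suc q)" by simp
    have "1 / real (Suc q) \<le> 1 / real (Suc q0)" using that by (intro divide_left_mono) auto
    then have qd: "1 / real (Suc q) < d" using q0 by linarith
    have "dist (riemann_sum (\<lambda>t. U (1 / real (Suc q) * t) x) n) x \<le> e / 2" if "1 \<le> n" for n
    proof -
      have "riemann_sum (\<lambda>t. U (1 / real (Suc q) * t) x) n - x
        = (1 / real n) *\<^sub>R (\<Sum>i<n. U (1 / real (Suc q) * (real i / real n)) x - x)"
        using that by (simp add: riemann_sum_def sum_subtractf scaleR_diff_right sum_constant_scaleR mult.commute)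
      also have "\<dots> \<in> V"
      proof (rule average_mem_convex[OF V(2)])
        fix i assume "i < n"
        then have "1 / real (Suc q) * (real i / real n) \<le> 1 / real (Suc q) * 1"
          by (intro mult_left_mono) auto
        then have "dist (U (1 / real (Suc q) * (real i / real n)) x) x < \<epsilon>"
          using qd by (intro d(2)) (simp, linarith)
        then have "dist (U (1 / real (Suc q) * (real i / real n)) x - x) 0 < \<epsilon>"
          by (simp only: dist_diff[of _ x])
        then show "U (1 / real (Suc q) * (real i / real n)) x - x \<in> V" using \<epsilon>(2) by (auto simp: dist_commute)
      qed (use that in simp)
      finally have "dist (riemann_sum (\<lambda>t. U (1 / real (Suc q) * t) x) n - x) 0 < e / 2" by (rule V(4))
      then show ?thesis by (simp only: dist_diff[of _ x] less_imp_le)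
    qed
    then have "\<forall>\<^sub>F n in sequentially. dist (riemann_sum (\<lambda>t. U (1 / real (Suc q) * t) x) n) x \<le> e / 2"
      by (intro eventually_sequentiallyI[of 1])
    then have "dist (Phi (1 / real (Suc q)) x) x \<le> e / 2"
      by (intro tendsto_upperbound[OF tendsto_dist[OF Phi_tendsto[OF q] tendsto_const]]) auto
    then show ?thesis using \<open>0 < e\<close> by simp
  qed
  then show "\<forall>\<^sub>F q in sequentially. dist (Phi (1 / real (Suc q)) x) x < e"
    by (auto simp: eventually_sequentially)
qed

section \<open>Density of the span of the averages\<close>

definition W :: "'a set"
  where "W = closure (span (Phi 1 ` E0))"

lemma subspace_W: "subspace W"
  unfolding W_def by (intro subspace_closure_frechet subspace_span)

lemma closed_W: "closed W"
  by (simp add: W_def)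

lemma W_limit: "(\<And>n::nat. g n \<in> W) \<Longrightarrow> g \<longlonglongrightarrow> x \<Longrightarrow> x \<in> W"
  by (rule closed_sequentially[OF closed_W])

lemma Phi_in_W: "x \<in> E0 \<Longrightarrow> Phi 1 x \<in> W"
  unfolding W_def by (intro subsetD[OF closure_subset] span_base imageI)

text \<open>Invariance lets the operators \<open>U s\<close> act on the quotient by
  \<open>W\<close>, where the following steps take place.\<close>

lemma U_W:
  assumes "0 \<le> s" "v \<in> W"
  shows "U s v \<in> W"
proof -
  have "U s ` span (Phi 1 ` E0) \<subseteq> span (Phi 1 ` E0)"
  proof -
    have "U s ` Phi 1 ` E0 \<subseteq> Phi 1 ` E0" using assms(1) U_E0 by (auto simp: Phi_commute)
    then show ?thesis unfolding linear_span_image[OF linear_U[OF assms(1)], symmetric] by (rule span_mono)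
  qed
  then have "U s ` span (Phi 1 ` E0) \<subseteq> W" unfolding W_def by (rule order_trans[OF _ closure_subset])
  then have "U s ` closure (span (Phi 1 ` E0)) \<subseteq> W"
    by - (rule image_closure_subset[OF continuous_on_subset[OF continuous_U[OF assms(1)]] closed_W], simp_all)
  then show ?thesis using assms(2) unfolding W_def by blast
qed

lemma E0_limit:
  obtains g where "\<And>n::nat. g n \<in> E0" "g \<longlonglongrightarrow> v"
proof -
  have "v \<in> closure E0" using dense_E0 by simp
  then show ?thesis using that unfolding closure_sequential by blast
qed

text \<open>By \<open>Phi_difference\<close> the operator \<open>U 1 - I\<close> sends
  \<open>Phi (1/q) x\<close> into \<open>W\<close>; these averages tend to \<open>x\<close>, and
  \<open>W\<close> is closed.\<close>

lemma U_one_diff_in_W: "U 1 v - v \<in> W"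
proof -
  have E0: "U 1 x - x \<in> W" if x: "x \<in> E0" for x
  proof (rule W_limit)
    show "U 1 (Phi (1 / real (Suc q)) x) - Phi (1 / real (Suc q)) x \<in> W" for q
      by (subst Phi_difference)
        (auto intro!: subspace_scale[OF subspace_W] subspace_diff[OF subspace_W] U_W Phi_in_W x)
    show "(\<lambda>q. U 1 (Phi (1 / real (Suc q)) x) - Phi (1 / real (Suc q)) x) \<longlonglongrightarrow> U 1 x - x"
      by (intro tendsto_diff_frechet linear_tendsto[OF continuous_U] Phi_small_tendsto) simp
  qed
  obtain g where g: "\<And>n::nat. g n \<in> E0" "g \<longlonglongrightarrow> v" using E0_limit[of v] by blast
  show ?thesis
  proof (rule W_limit)
    show "U 1 (g n) - g n \<in> W" for n using E0 g by blast
    show "(\<lambda>n. U 1 (g n) - g n) \<longlonglongrightarrow> U 1 v - v"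
      by (intro tendsto_diff_frechet linear_tendsto[OF continuous_U] g) simp
  qed
qed

lemma U_nat_diff_in_W: "U (real j) v - v \<in> W"
proof (induction j)
  case 0
  then show ?case using subspace_0[OF subspace_W] by (simp add: U_zero)
next
  case (Suc j)
  have "U (real (Suc j)) v = U 1 (U (real j) v)" by (simp add: U_add[symmetric])
  then have "U (real (Suc j)) v - v = (U 1 (U (real j) v) - U (real j) v) + (U (real j) v - v)" by simp
  then show ?case using subspace_add[OF subspace_W U_one_diff_in_W Suc.IH] by (simp only:)
qed

text \<open>
  Modulo \<open>W\<close> the operator \<open>U 1\<close> is the identity, so that \<open>U (j / q)\<close> only depends on \<open>j\<close> modulo
  \<open>q\<close>; but the terms of the series in the forward condition, which are of this form, tend to \<open>0\<close>.
\<close>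

lemma Phi_fraction_in_W:
  assumes q: "1 \<le> q" and x: "x \<in> E0"
  shows "Phi (1 / real q) x \<in> W"
proof -
  let ?z = "Phi (1 / real q) x"
  have "\<exists>w\<in>W. dist w ?z < e" if "0 < e" for e
  proof -
    have "\<exists>d>0. \<forall>v. dist v 0 < d \<longrightarrow> dist (U (real (q - r) / real q) v) 0 < e" for r
      using small_linear[OF that continuous_U[of "real (q - r) / real q"]] linear_0[OF linear_U] by (metis divide_nonneg_nonneg of_nat_0_le_iff)
    then obtain d where d: "\<And>r. 0 < d r" "\<And>r v. dist v 0 < d r \<Longrightarrow> dist (U (real (q - r) / real q) v) 0 < e" by metis
    \<comment> \<open>The residue of the gap modulo \<open>q\<close> is known only after
      \<open>N\<close> has been fixed, and \<open>N\<close> depends on the tolerance; hence one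
      tolerance for all \<open>q\<close> residues.\<close>
    define d0 where "d0 = Min (d ` {..<q})"
    have d0: "0 < d0" "\<And>r. r < q \<Longrightarrow> d0 \<le> d r" using q d(1) by (auto simp: d0_def Min_gr_iff lessThan_empty_iff)
    obtain N where N: "1 \<le> N" "\<And>F k. finite F \<Longrightarrow> F \<subseteq> {N..k} \<Longrightarrow> 1 \<le> k \<Longrightarrow>
      dist (\<Sum>n\<in>F. U (real (gap (k - n) k) / real q) ?z) 0 < d0"
      using forward_sums[OF q x d0(1)] by blast
    \<comment> \<open>The single term \<open>n = k = N\<close> of the forward series. Adding
      \<open>(q - r) / q\<close> to its time \<open>D / q\<close> gives an integer, and at integer
      times \<open>U\<close> is the identity modulo \<open>W\<close>; so \<open>?z\<close> itself is
      close to \<open>W\<close>.\<close>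
    define D where "D = gap 0 N"
    have small: "dist (U (real D / real q) ?z) 0 < d0" using N(2)[of "{N}" N] N(1) by (simp add: D_def)
    define j r where "j = D div q" and "r = D mod q"
    have r: "r < q" using q by (simp add: r_def)
    have "D = q * j + r" by (simp add: j_def r_def)
    then have eq: "real (q - r) / real q + real D / real q = real (Suc j)"
      using r q by (simp add: of_nat_diff field_simps)
    have "U (real (q - r) / real q) (U (real D / real q) ?z) = U (real (Suc j)) ?z"
      by (subst U_add[symmetric]) (simp_all only: eq zero_le_divide_iff of_nat_0_le_iff simp_thms)
    moreover have "dist (U (real (q - r) / real q) (U (real D / real q) ?z)) 0 < e"
      using small d0(2)[OF r] by (intro d(2)) simp
    ultimately have "dist (U (real (Suc j)) ?z) 0 < e" by simp
    then have "dist (- (U (real (Suc j)) ?z - ?z)) ?z < e"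
      using dist_diff[of "- (U (real (Suc j)) ?z - ?z)" ?z] dist_uminus[of "U (real (Suc j)) ?z"] by simp
    moreover have "- (U (real (Suc j)) ?z - ?z) \<in> W"
      using U_nat_diff_in_W by (rule subspace_neg[OF subspace_W])
    ultimately show ?thesis by blast
  qed
  then have "?z \<in> closure W" unfolding closure_approachable by blast
  then show ?thesis using closed_W by simp
qed

lemma W_UNIV: "W = UNIV"
proof -
  have "x \<in> W" if "x \<in> E0" for x
    by (rule W_limit[OF Phi_fraction_in_W[OF _ that] Phi_small_tendsto]) simp
  then have "closure E0 \<subseteq> W" using closed_W by (intro closure_minimal) auto
  then show ?thesis using dense_E0 by auto
qed

text \<open>If \<open>gap a b = 0\<close>, the term \<open>n = b - a\<close> of the series for
  \<open>k = b\<close> is \<open>Phi 1 x\<close> itself. For a fixed nonzero average, which exists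
  by density of the span, this is impossible once \<open>b - a\<close> is large.\<close>

lemma gap_positive:
  obtains L where "1 \<le> L" "\<And>a b. a + L \<le> b \<Longrightarrow> 0 < gap a b"
proof -
  have "\<exists>x\<in>E0. Phi 1 x \<noteq> 0"
  proof (rule ccontr)
    assume "\<not> ?thesis"
    then have "span (Phi 1 ` E0) \<subseteq> {0}" by (intro span_minimal) (auto simp: subspace_def)
    then have "W \<subseteq> {0}" unfolding W_def by (intro closure_minimal) auto
    then show False using W_UNIV nontrivial by auto
  qed
  then obtain x where x: "x \<in> E0" "Phi 1 x \<noteq> 0" by blast
  then have "0 < dist (Phi 1 x) 0" by simp
  then obtain N where N: "1 \<le> N" "\<And>F k. finite F \<Longrightarrow> F \<subseteq> {N..k} \<Longrightarrow> 1 \<le> k \<Longrightarrow>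
      dist (\<Sum>n\<in>F. U (real (gap (k - n) k) / real 1) (Phi (1 / real 1) x)) 0 < dist (Phi 1 x) 0"
    by (rule forward_sums[OF order_refl x(1)]) blast
  show ?thesis
  proof (rule that[OF N(1)])
    fix a b assume "a + N \<le> b"
    then have "dist (U (real (gap a b)) (Phi 1 x)) 0 < dist (Phi 1 x) 0"
      using N(2)[of "{b - a}" b] N(1) by simp
    then show "0 < gap a b" by (cases "gap a b = 0") (auto simp: U_zero)
  qed
qed

end

text \<open>Provides the sequence of targets: separability of the space yields a dense sequence
  inside the span, by approximating each point of \<open>C\<close> from \<open>D\<close> at every
  scale.\<close>

lemma countable_dense_subset:
  fixes C D :: "'a::metric_space set"
  assumes C: "countable C" "closure C = UNIV" and D: "closure D = UNIV"
  obtains y :: "nat \<Rightarrow> 'a" where "range y \<subseteq> D" "closure (range y) = UNIV"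
proof -
  have "\<exists>y\<in>D. dist y c < 1 / real (Suc n)" for c n
    using D closure_approachable[of c D] by auto
  then obtain h where h: "\<And>c n. h c n \<in> D" "\<And>c n. dist (h c n) c < 1 / real (Suc n)" by metis
  define B where "B = (\<lambda>(c, n). h c n) ` (C \<times> (UNIV :: nat set))"
  have "C \<noteq> {}" using C(2) by auto
  then have ne: "B \<noteq> {}" by (auto simp: B_def)
  have "countable B" using C(1) by (auto simp: B_def)
  have "x \<in> closure B" for x
    unfolding closure_approachable
  proof (intro allI impI)
    fix e :: real assume "0 < e"
    then obtain n where n: "1 / real (Suc n) < e / 2" using nat_approx_posE[of "e / 2"] by auto
    obtain c where c: "c \<in> C" "dist c x < e / 2"
      using C(2) closure_approachable[of x C] \<open>0 < e\<close> by (metis UNIV_I half_gt_zero)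
    have "dist (h c n) x < e" using dist_triangle[of "h c n" x c] h(2)[of c n] n c(2) by linarith
    then show "\<exists>y\<in>B. dist y x < e" using c(1) by (auto simp: B_def)
  qed
  moreover have "range (from_nat_into B) = B" by (rule range_from_nat_into[OF ne \<open>countable B\<close>])
  moreover have "B \<subseteq> D" using h(1) by (auto simp: B_def)
  ultimately show ?thesis by (intro that[of "from_nat_into B"]) auto
qed

section \<open>The universality criterion for the operators along the ray\<close>

context ray_criterion
begin

text \<open>The base point is 1 because (ii) and (iii) control the indices \<open>k \<ge> 1\<close>.
  Truncation makes \<open>R 0\<close> the identity.\<close>

definition R :: "nat \<Rightarrow> 'a \<Rightarrow> 'a"
  where "R k = U (real (gap 1 k))"

lemma linear_R: "linear (R k)" and continuous_R: "continuous_on UNIV (R k)" and R_one: "R 1 = id"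
  by (auto simp: R_def gap_def U_zero intro: linear_U continuous_U)

text \<open>The requirements of the universality criterion for one target \<open>z\<close>. The
  preimages \<open>w\<close> are arbitrary: linear combinations of targets use the same combinations
  of preimages, while \<open>S\<close> itself need not respect them.\<close>

definition reproduced_from :: "nat \<Rightarrow> 'a \<Rightarrow> (nat \<Rightarrow> 'a) \<Rightarrow> bool"
  where "reproduced_from K z w \<longleftrightarrow> (\<forall>k\<ge>K. R k (w k) = z) \<and>
    (\<forall>\<epsilon>>0. \<exists>N. \<forall>k\<ge>1. \<forall>G. finite G \<and> 0 \<notin> G \<and> (\<forall>j\<in>G. j + N \<le> k \<or> k + N \<le> j)
      \<longrightarrow> dist (\<Sum>j\<in>G. R k (w j)) 0 < \<epsilon>)"

lemma reproduced_from_subspace: "subspace {z. \<exists>w. reproduced_from K z w}"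
  unfolding subspace_def
proof (intro conjI ballI allI, unfold mem_Collect_eq)
  show "\<exists>w. reproduced_from K 0 w"
    by (intro exI[of _ "\<lambda>_. 0"]) (auto simp: reproduced_from_def linear_0[OF linear_R])
next
  fix y z assume "\<exists>w. reproduced_from K y w" "\<exists>w. reproduced_from K z w"
  then obtain v w where vw: "reproduced_from K y v" "reproduced_from K z w" by blast
  have "reproduced_from K (y + z) (\<lambda>j. v j + w j)"
    unfolding reproduced_from_def
  proof (intro conjI allI impI)
    show "R k (v k + w k) = y + z" if "K \<le> k" for k
      using vw that by (simp add: reproduced_from_def linear_add[OF linear_R])
    fix \<epsilon> :: real assume "0 < \<epsilon>"
    then have "0 < \<epsilon> / 2" by simp
    obtain N1 where N1: "\<forall>k\<ge>1. \<forall>G. finite G \<and> 0 \<notin> G \<and> (\<forall>j\<in>G. j + N1 \<le> k \<or> k + N1 \<le> j)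
      \<longrightarrow> dist (\<Sum>j\<in>G. R k (v j)) 0 < \<epsilon> / 2"
      using vw(1) \<open>0 < \<epsilon> / 2\<close> unfolding reproduced_from_def by blast
    obtain N2 where N2: "\<forall>k\<ge>1. \<forall>G. finite G \<and> 0 \<notin> G \<and> (\<forall>j\<in>G. j + N2 \<le> k \<or> k + N2 \<le> j)
      \<longrightarrow> dist (\<Sum>j\<in>G. R k (w j)) 0 < \<epsilon> / 2"
      using vw(2) \<open>0 < \<epsilon> / 2\<close> unfolding reproduced_from_def by blast
    show "\<exists>N. \<forall>k\<ge>1. \<forall>G. finite G \<and> 0 \<notin> G \<and> (\<forall>j\<in>G. j + N \<le> k \<or> k + N \<le> j)
      \<longrightarrow> dist (\<Sum>j\<in>G. R k (v j + w j)) 0 < \<epsilon>"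
    proof (intro exI[of _ "N1 + N2"] allI impI)
      fix k G assume k: "1 \<le> k" and G: "finite G \<and> 0 \<notin> G \<and> (\<forall>j\<in>G. j + (N1 + N2) \<le> k \<or> k + (N1 + N2) \<le> j)"
      have "j + N1 \<le> k \<or> k + N1 \<le> j" "j + N2 \<le> k \<or> k + N2 \<le> j" if "j \<in> G" for j
        using G that by fastforce+
      then have "dist (\<Sum>j\<in>G. R k (v j)) 0 < \<epsilon> / 2" "dist (\<Sum>j\<in>G. R k (w j)) 0 < \<epsilon> / 2"
        using N1[rule_format, OF k, of G] N2[rule_format, OF k, of G] G by simp_all
      then show "dist (\<Sum>j\<in>G. R k (v j + w j)) 0 < \<epsilon>"
        using dist_add_le[of "\<Sum>j\<in>G. R k (v j)" "\<Sum>j\<in>G. R k (w j)"]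
        by (simp add: linear_add[OF linear_R] sum.distrib)
    qed
  qed
  then show "\<exists>w. reproduced_from K (y + z) w" by blast
next
  fix c z assume "\<exists>w. reproduced_from K z w"
  then obtain w where w: "reproduced_from K z w" by blast
  have "reproduced_from K (c *\<^sub>R z) (\<lambda>j. c *\<^sub>R w j)"
    unfolding reproduced_from_def
  proof (intro conjI allI impI)
    show "R k (c *\<^sub>R w k) = c *\<^sub>R z" if "K \<le> k" for k
      using w that by (simp add: reproduced_from_def linear_scale[OF linear_R])
    fix \<epsilon> :: real assume "0 < \<epsilon>"
    then obtain \<delta> where \<delta>: "0 < \<delta>" "\<And>x::'a. dist x 0 < \<delta> \<Longrightarrow> dist (c *\<^sub>R x) 0 < \<epsilon>"
      using small_scaleR by blast
    have "(\<Sum>j\<in>G. R k (c *\<^sub>R w j)) = c *\<^sub>R (\<Sum>j\<in>G. R k (w j))" for k G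
      by (simp add: linear_scale[OF linear_R] scaleR_sum_right)
    then show "\<exists>N. \<forall>k\<ge>1. \<forall>G. finite G \<and> 0 \<notin> G \<and> (\<forall>j\<in>G. j + N \<le> k \<or> k + N \<le> j)
      \<longrightarrow> dist (\<Sum>j\<in>G. R k (c *\<^sub>R w j)) 0 < \<epsilon>"
      using w \<delta> unfolding reproduced_from_def by metis
  qed
  then show "\<exists>w. reproduced_from K (c *\<^sub>R z) w" by blast
qed

text \<open>\<open>backward_term x j\<close> plays the role of \<open>S (M j - M 1) (Phi 1 x)\<close>.\<close>

definition backward_term :: "'a \<Rightarrow> nat \<Rightarrow> 'a"
  where "backward_term x j = frechet_integral (lebesgue_on (A_interval m 1 (j - 1))) (\<lambda>t. S t x)"

lemma has_integral_backward_term: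
  assumes "2 \<le> j" "x \<in> E0"
  shows "has_frechet_integral (lebesgue_on {real (gap 1 j) - 1..real (gap 1 j)}) (\<lambda>t. S t x) (backward_term x j)"
  using has_frechet_integral_frechet_integral[OF backward_integrable[of 1 "j - 1" x]] assms
  by (simp add: backward_term_def A_interval_eq)

text \<open>Inside the integral \<open>U a\<close> turns \<open>S (t + a) x\<close> into
  \<open>S t x\<close>, and the shift by \<open>a\<close> moves the interval onto that of the series
  for \<open>k\<close>. A positive gap keeps this interval in the half line; the relation may fail
  only at \<open>t = 0\<close>, a null set.\<close>

lemma R_backward_term_later:
  assumes k: "1 \<le> k" "1 \<le> n" and x: "x \<in> E0" and pos: "0 < gap k (k + n)"
  shows "R k (backward_term x (k + n)) = frechet_integral (lebesgue_on (A_interval m k n)) (\<lambda>t. S t x)"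
proof -
  define a where "a = real (gap 1 k)"
  have a: "0 \<le> a" by (simp add: a_def)
  have "gap 1 (k + n) = gap k (k + n) + gap 1 k" using k by (intro gap_add) auto
  then have g: "real (gap 1 (k + n)) = real (gap k (k + n)) + a" by (simp add: a_def)
  have "has_frechet_integral (lebesgue_on {real (gap 1 (k + n)) - 1..real (gap 1 (k + n))}) (\<lambda>t. U a (S t x)) (U a (backward_term x (k + n)))"
    using k by (intro has_frechet_integral_linear[OF has_integral_backward_term[OF _ x] linear_U[OF a] continuous_U[OF a]]) simp
  from has_frechet_integral_translation[OF this, of "- a"]
  have 1: "has_frechet_integral (lebesgue_on (A_interval m k n)) (\<lambda>t. U a (S (t + a) x)) (R k (backward_term x (k + n)))"
    unfolding g A_interval_eq R_def a_def[symmetric] by simp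
  have 2: "has_frechet_integral (lebesgue_on (A_interval m k n)) (\<lambda>t. S t x)
    (frechet_integral (lebesgue_on (A_interval m k n)) (\<lambda>t. S t x))"
    by (intro has_frechet_integral_frechet_integral backward_integrable k x)
  have "AE t in lebesgue_on (A_interval m k n). U a (S (t + a) x) = S t x"
  proof -
    have "AE t in lebesgue. t \<in> A_interval m k n \<longrightarrow> U a (S (t + a) x) = S t x"
    proof (rule AE_I'[of "{0}"])
      show "{0::real} \<in> null_sets lebesgue" by (simp add: null_sets_def)
      have "U a (S (t + a) x) = S t x" if "t \<in> A_interval m k n" "t \<noteq> 0" for t
      proof (cases "a = 0")
        case False
        have "0 \<le> t" using that(1) pos by (auto simp: A_interval_eq)
        then show ?thesis using that(2) False a U_S_less[of a "t + a" x] x by simp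
      qed (simp add: U_zero)
      then show "{t \<in> space lebesgue. \<not> (t \<in> A_interval m k n \<longrightarrow> U a (S (t + a) x) = S t x)} \<subseteq> {0}" by auto
    qed
    then show ?thesis by (subst AE_restrict_space_iff) (auto simp: A_interval_eq)
  qed
  from has_frechet_integral_unique_AE[OF 1 2 this] show ?thesis .
qed

text \<open>Left sums of the reversed orbit are right sums of the orbit, and the two differ by
  \<open>(1/n) *\<^sub>R (U 1 x - x)\<close>.\<close>

lemma riemann_sum_reflect_tendsto: "riemann_sum (\<lambda>t. U (1 - t) x) \<longlonglongrightarrow> Phi 1 x"
proof -
  have "riemann_sum (\<lambda>t. U (1 * t) x) n + (1 / real n) *\<^sub>R (U 1 x - x) = riemann_sum (\<lambda>t. U (1 - t) x) n" if "1 \<le> n" for n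
  proof -
    have "(\<Sum>i<n. U (1 - real i / real n) x) = (\<Sum>i<n. U (real (Suc i) / real n) x)"
    proof (rule sum.reindex_bij_witness[where i = "\<lambda>i. n - Suc i" and j = "\<lambda>i. n - Suc i"])
      fix i assume i: "i \<in> {..<n}"
      have "real (Suc (n - Suc i)) / real n = 1 - real i / real n" using i by (simp add: of_nat_diff field_simps)
      then show "U (real (Suc (n - Suc i)) / real n) x = U (1 - real i / real n) x" by simp
    qed auto
    also have "\<dots> = (\<Sum>i<Suc n. U (real i / real n) x) - U 0 x"
      unfolding sum.lessThan_Suc_shift by simp
    also have "\<dots> = (\<Sum>i<n. U (real i / real n) x) + (U 1 x - x)" using that by (simp add: U_zero)
    finally show ?thesis by (simp add: riemann_sum_def scaleR_add_right)
  qed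
  then have ev: "\<forall>\<^sub>F n in sequentially. riemann_sum (\<lambda>t. U (1 * t) x) n + (1 / real n) *\<^sub>R (U 1 x - x) = riemann_sum (\<lambda>t. U (1 - t) x) n"
    by (intro eventually_sequentiallyI[of 1])
  have "(\<lambda>n. riemann_sum (\<lambda>t. U (1 * t) x) n + (1 / real n) *\<^sub>R (U 1 x - x)) \<longlonglongrightarrow> Phi 1 x + 0 *\<^sub>R (U 1 x - x)"
    by (intro tendsto_add_frechet Phi_tendsto tendsto_scaleR_frechet lim_1_over_n tendsto_const) simp
  from Lim_transform_eventually[OF this ev] show ?thesis by simp
qed

text \<open>For \<open>0 \<le> t \<le> a\<close>, writing \<open>U a\<close> as
  \<open>U (a - t)\<close> after \<open>U t\<close> cancels \<open>S t\<close>, which leaves the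
  orbit of \<open>x\<close> run backwards over a unit interval. A positive gap means
  \<open>a \<ge> 1\<close>, so no negative times occur.\<close>

lemma R_backward_term_same:
  assumes k: "2 \<le> k" and x: "x \<in> E0" and pos: "0 < gap 1 k"
  shows "R k (backward_term x k) = Phi 1 x"
proof -
  define a where "a = real (gap 1 k)"
  have a: "1 \<le> a" using pos by (simp add: a_def)
  have 1: "has_frechet_integral (lebesgue_on {a - 1..a}) (\<lambda>t. U a (S t x)) (R k (backward_term x k))"
    unfolding R_def a_def
    by (rule has_frechet_integral_linear[OF has_integral_backward_term[OF k x] linear_U continuous_U]) simp_all
  have "has_frechet_integral (lebesgue_on {a - 1..(a - 1) + 1}) (\<lambda>t. U (a - t) x) (Phi 1 x)"
  proof (rule has_frechet_integral_continuous)
    show "continuous_on {a - 1..(a - 1) + 1} (\<lambda>t. U (a - t) x)"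
      by (intro continuous_on_compose2[OF orbit_continuous] continuous_intros) auto
    show "riemann_sum (\<lambda>t. U (a - (a - 1 + t)) x) \<longlonglongrightarrow> Phi 1 x"
      using riemann_sum_reflect_tendsto by simp
  qed
  then have 2: "has_frechet_integral (lebesgue_on {a - 1..a}) (\<lambda>t. U (a - t) x) (Phi 1 x)" by simp
  have "AE t in lebesgue_on {a - 1..a}. U a (S t x) = U (a - t) x"
  proof (rule AE_I2)
    fix t assume "t \<in> space (lebesgue_on {a - 1..a})"
    then have t: "0 \<le> t" "t \<le> a" using a by auto
    then have "U ((a - t) + t) (S t x) = U (a - t) (U t (S t x))" by (intro U_add) auto
    then show "U a (S t x) = U (a - t) x" using U_S[OF t(1) x] by simp
  qed
  from has_frechet_integral_unique_AE[OF 1 2 this] show ?thesis .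
qed

lemma backward_sums:
  assumes "x \<in> E0" "0 < \<epsilon>"
  obtains N where "1 \<le> N" "\<And>F k. finite F \<Longrightarrow> F \<subseteq> {N..} \<Longrightarrow> 1 \<le> k \<Longrightarrow>
    dist (\<Sum>n\<in>F. frechet_integral (lebesgue_on (A_interval m k n)) (\<lambda>t. S t x)) 0 < \<epsilon>"
  using backward[OF assms(1)] assms(2) unfolding uniformly_uncond_convergent_def by (metis atLeast_iff)

text \<open>Seen from \<open>k\<close>, an earlier index \<open>j\<close> gives the term
  \<open>n = k - j\<close> of the forward series, a later one the term \<open>n = j - k\<close> of
  the backward series. Uniformity in \<open>k\<close> of both conditions is what makes
  \<open>N\<close> independent of \<open>k\<close>.\<close>

lemma Phi_reproduced:
  assumes L: "1 \<le> L" "\<And>a b. a + L \<le> b \<Longrightarrow> 0 < gap a b" and x: "x \<in> E0"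
  shows "\<exists>w. reproduced_from (Suc L) (Phi 1 x) w"
proof
  \<comment> \<open>Below \<open>Suc L\<close> the gap from 1 may vanish and the backward term need
    not be mapped to \<open>Phi 1 x\<close>; the value 0 removes these indices.\<close>
  let ?w = "\<lambda>j. if Suc L \<le> j then backward_term x j else 0"
  show "reproduced_from (Suc L) (Phi 1 x) ?w"
    unfolding reproduced_from_def
  proof (intro conjI allI impI)
    have same: "R k (backward_term x k) = Phi 1 x" if "Suc L \<le> k" for k
      using that L by (intro R_backward_term_same x) auto
    then show "R k (?w k) = Phi 1 x" if "Suc L \<le> k" for k using that by simp
    fix \<epsilon> :: real assume "0 < \<epsilon>"
    then have e2: "0 < \<epsilon> / 2" by simp
    obtain N1 where N1: "1 \<le> N1" "\<And>F k. finite F \<Longrightarrow> F \<subseteq> {N1..k} \<Longrightarrow> 1 \<le> k \<Longrightarrow>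
      dist (\<Sum>n\<in>F. U (real (gap (k - n) k) / real 1) (Phi (1 / real 1) x)) 0 < \<epsilon> / 2"
      using forward_sums[OF order_refl x e2] by blast
    obtain N2 where N2: "1 \<le> N2" "\<And>F k. finite F \<Longrightarrow> F \<subseteq> {N2..} \<Longrightarrow> 1 \<le> k \<Longrightarrow>
      dist (\<Sum>n\<in>F. frechet_integral (lebesgue_on (A_interval m k n)) (\<lambda>t. S t x)) 0 < \<epsilon> / 2"
      using backward_sums[OF x e2] by blast
    \<comment> \<open>The summand \<open>L\<close> guarantees a positive gap between
      \<open>k\<close> and every later index.\<close>
    define N where "N = N1 + N2 + L"
    show "\<exists>N. \<forall>k\<ge>1. \<forall>G. finite G \<and> 0 \<notin> G \<and> (\<forall>j\<in>G. j + N \<le> k \<or> k + N \<le> j)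
      \<longrightarrow> dist (\<Sum>j\<in>G. R k (?w j)) 0 < \<epsilon>"
    proof (intro exI[of _ N] allI impI)
      fix k G assume k: "1 \<le> k" and G: "finite G \<and> 0 \<notin> G \<and> (\<forall>j\<in>G. j + N \<le> k \<or> k + N \<le> j)"
      define G1 where "G1 = {j\<in>G. Suc L \<le> j \<and> j + N \<le> k}"
      define G2 where "G2 = {j\<in>G. k + N \<le> j}"
      have fin: "finite G1" "finite G2" using G by (auto simp: G1_def G2_def)
      have "(\<Sum>j\<in>G. R k (?w j)) = (\<Sum>j\<in>G1 \<union> G2. R k (?w j))"
        using G by (intro sum.mono_neutral_right) (auto simp: G1_def G2_def linear_0[OF linear_R])
      also have "\<dots> = (\<Sum>j\<in>G1. R k (?w j)) + (\<Sum>j\<in>G2. R k (?w j))"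
        using fin L(1) by (intro sum.union_disjoint) (auto simp: G1_def G2_def N_def)
      also have "(\<Sum>j\<in>G1. R k (?w j)) = (\<Sum>j\<in>G1. U (real (gap j k)) (Phi 1 x))"
      proof (rule sum.cong[OF refl])
        fix j assume j: "j \<in> G1"
        have "gap 1 k = gap j k + gap 1 j" using j by (intro gap_add) (auto simp: G1_def)
        then have "R k (backward_term x j) = U (real (gap j k)) (R j (backward_term x j))"
          by (simp add: R_def U_add[symmetric])
        then show "R k (?w j) = U (real (gap j k)) (Phi 1 x)" using j same by (simp add: G1_def)
      qed
      also have "\<dots> = (\<Sum>n\<in>(\<lambda>j. k - j) ` G1. U (real (gap (k - n) k)) (Phi 1 x))"
        by (subst sum.reindex) (auto simp: G1_def inj_on_def intro!: sum.cong)
      also have "(\<Sum>j\<in>G2. R k (?w j)) = (\<Sum>j\<in>G2. frechet_integral (lebesgue_on (A_interval m k (j - k))) (\<lambda>t. S t x))"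
      proof (rule sum.cong[OF refl])
        fix j assume "j \<in> G2"
        then have j: "k + N \<le> j" by (simp add: G2_def)
        then show "R k (?w j) = frechet_integral (lebesgue_on (A_interval m k (j - k))) (\<lambda>t. S t x)"
          using R_backward_term_later[OF k _ x, of "j - k"] L k by (simp add: N_def)
      qed
      also have "\<dots> = (\<Sum>n\<in>(\<lambda>j. j - k) ` G2. frechet_integral (lebesgue_on (A_interval m k n)) (\<lambda>t. S t x))"
        by (subst sum.reindex) (auto simp: G2_def inj_on_def)
      finally have eq: "(\<Sum>j\<in>G. R k (?w j))
        = (\<Sum>n\<in>(\<lambda>j. k - j) ` G1. U (real (gap (k - n) k)) (Phi 1 x))
          + (\<Sum>n\<in>(\<lambda>j. j - k) ` G2. frechet_integral (lebesgue_on (A_interval m k n)) (\<lambda>t. S t x))" .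
      have "dist (\<Sum>j\<in>G. R k (?w j)) 0
        \<le> dist (\<Sum>n\<in>(\<lambda>j. k - j) ` G1. U (real (gap (k - n) k)) (Phi 1 x)) 0
          + dist (\<Sum>n\<in>(\<lambda>j. j - k) ` G2. frechet_integral (lebesgue_on (A_interval m k n)) (\<lambda>t. S t x)) 0"
        unfolding eq by (rule dist_add_le)
      moreover have "dist (\<Sum>n\<in>(\<lambda>j. k - j) ` G1. U (real (gap (k - n) k)) (Phi 1 x)) 0 < \<epsilon> / 2"
      proof -
        have "(\<lambda>j. k - j) ` G1 \<subseteq> {N1..k}" by (auto simp: G1_def N_def)
        then show ?thesis using N1(2)[of "(\<lambda>j. k - j) ` G1" k] fin(1) k by simp
      qed
      moreover have "dist (\<Sum>n\<in>(\<lambda>j. j - k) ` G2. frechet_integral (lebesgue_on (A_interval m k n)) (\<lambda>t. S t x)) 0 < \<epsilon> / 2"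
        using fin(2) k by (intro N2(2)) (auto simp: G2_def N_def)
      ultimately show "dist (\<Sum>j\<in>G. R k (?w j)) 0 < \<epsilon>" by linarith
    qed
  qed
qed

lemma U_power: "(U 1 ^^ n) x = U (real n) x"
  by (induction n) (simp_all add: U_zero U_add[symmetric])

text \<open>The criterion is applied with \<open>K = Suc L\<close>. Good indices are then further
  apart than any stretch on which the gap vanishes, so \<open>gap 1\<close> maps them injectively to
  hitting times of \<open>U 1\<close>; indices up to \<open>P\<close> give times up to
  \<open>m P\<close>.\<close>

theorem l_frequently_hypercyclic_U: "l_frequently_hypercyclic m (U 1)"
proof -
  obtain L where L: "1 \<le> L" "\<And>a b. a + L \<le> b \<Longrightarrow> 0 < gap a b" using gap_positive by blast
  define Z where "Z = span (Phi 1 ` E0)"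
  have "Z \<subseteq> {z. \<exists>w. reproduced_from (Suc L) z w}"
    unfolding Z_def using Phi_reproduced[OF L] by (intro span_minimal reproduced_from_subspace) auto
  then have Z: "\<exists>w. reproduced_from (Suc L) z w" if "z \<in> Z" for z using that by blast
  obtain C :: "'a set" where C: "countable C" "closure C = UNIV" using separable by blast
  have "closure Z = UNIV" using W_UNIV by (simp add: W_def Z_def)
  then obtain y :: "nat \<Rightarrow> 'a" where y: "range y \<subseteq> Z" "closure (range y) = UNIV"
    using countable_dense_subset[OF C] by blast
  have "\<exists>w. reproduced_from (Suc L) (y l) w" for l using Z y(1) by blast
  then obtain w where w: "\<And>l. reproduced_from (Suc L) (y l) (w l)" by metis
  obtain x where x: "\<And>V. open V \<Longrightarrow> V \<noteq> {} \<Longrightarrow> \<exists>A c. 0 < c \<and> A \<subseteq> {Suc L..} \<and>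
      (\<forall>a\<in>A. \<forall>b\<in>A. a < b \<longrightarrow> a + Suc L \<le> b) \<and> (\<forall>k\<in>A. R k x \<in> V) \<and>
      (\<forall>\<^sub>F P in sequentially. c * real P \<le> real (card (A \<inter> {..P})))"
  proof (rule frequent_universality[of R y "Suc L" w, OF linear_R continuous_R R_one y(2)])
    show "R k (w l k) = y l" if "Suc L \<le> k" for k l using w[of l] that by (simp add: reproduced_from_def)
    show "\<exists>N. \<forall>k\<ge>1. \<forall>G. finite G \<and> 0 \<notin> G \<and> (\<forall>j\<in>G. j + N \<le> k \<or> k + N \<le> j)
        \<longrightarrow> dist (\<Sum>j\<in>G. R k (w l j)) 0 < \<epsilon>" if "0 < \<epsilon>" for l \<epsilon>
      using w[of l] that by (simp add: reproduced_from_def)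
  qed blast
  show ?thesis
    unfolding l_frequently_hypercyclic_def
  proof (intro exI[of _ x] allI impI, elim conjE)
    fix V :: "'a set" assume "open V" "V \<noteq> {}"
    from x[OF this] obtain A c where A: "0 < c" "A \<subseteq> {Suc L..}" "\<And>a b. a \<in> A \<Longrightarrow> b \<in> A \<Longrightarrow> a < b \<Longrightarrow> a + Suc L \<le> b"
      "\<And>k. k \<in> A \<Longrightarrow> R k x \<in> V" "\<forall>\<^sub>F P in sequentially. c * real P \<le> real (card (A \<inter> {..P}))"
      by blast
    define H where "H = {n. 1 \<le> n \<and> (U 1 ^^ n) x \<in> V}"
    have card: "card (A \<inter> {..P}) \<le> card {j\<in>H. 1 \<le> j \<and> real j \<le> m P}" for P
    proof (rule card_inj_on_le)
      show "inj_on (gap 1) (A \<inter> {..P})"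
      proof (rule linorder_inj_onI)
        fix a b assume ab: "a < b" "a \<in> A \<inter> {..P}" "b \<in> A \<inter> {..P}"
        then have "a + Suc L \<le> b" using A(3) by blast
        then have "0 < gap a b" by (intro L(2)) simp
        moreover have "gap 1 b = gap a b + gap 1 a" using ab A(2) by (intro gap_add) auto
        ultimately show "gap 1 a \<noteq> gap 1 b" by simp
      qed auto
      show "gap 1 ` (A \<inter> {..P}) \<subseteq> {j\<in>H. 1 \<le> j \<and> real j \<le> m P}"
      proof
        fix j assume "j \<in> gap 1 ` (A \<inter> {..P})"
        then obtain k where k: "k \<in> A" "k \<le> P" "j = gap 1 k" by blast
        have pos: "0 < gap 1 k" using k A(2) by (intro L(2)) auto
        have "(U 1 ^^ j) x \<in> V" using A(4)[OF k(1)] by (simp add: U_power k(3) R_def)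
        moreover have "real j \<le> m P"
        proof -
          have "1 \<le> M 1" using m_ge[of 1] by (simp add: M_def le_floor_iff)
          then have "int j \<le> M P" using M_mono[OF k(2)] pos by (simp add: k(3) gap_def)
          then show ?thesis by (simp add: M_def le_floor_iff)
        qed
        ultimately show "j \<in> {j\<in>H. 1 \<le> j \<and> real j \<le> m P}" using pos k(3) by (simp add: H_def)
      qed
      show "finite {j\<in>H. 1 \<le> j \<and> real j \<le> m P}"
        by (rule finite_subset[of _ "{..nat \<lfloor>m P\<rfloor>}"]) (auto simp: le_nat_floor)
    qed
    have "\<forall>\<^sub>F P in sequentially. ereal c \<le> ereal (real (card {j\<in>H. 1 \<le> j \<and> real j \<le> m P}) / real P)"
      using A(5) eventually_gt_at_top[of 0]
    proof eventually_elim
      case (elim P)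
      have "c * real P \<le> real (card {j\<in>H. 1 \<le> j \<and> real j \<le> m P})"
        using elim(1) card[of P] by linarith
      then show ?case using elim(2) by (simp add: le_divide_eq)
    qed
    then have "ereal c \<le> lower_m_density m H" unfolding lower_m_density_def by (rule Liminf_bounded)
    then have "0 < lower_m_density m H" using A(1) by (metis ereal_less(2) less_le_trans)
    then show "0 < lower_m_density m {n. 1 \<le> n \<and> (U 1 ^^ n) x \<in> V}" by (simp add: H_def)
  qed
qed

end

section \<open>Index sets and the passage to the semigroup\<close>

text \<open>The cosine decreases on \<open>[0, pi]\<close>, so the angle condition becomes an
  inequality. Closedness is then immediate, and stability under addition is the triangle inequality,
  as \<open>cos \<alpha> \<ge> 0\<close> for \<open>\<alpha> \<le> pi / 2\<close>.\<close>

lemma sector_eq: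
  assumes "0 < \<alpha>" "\<alpha> \<le> pi / 2"
  shows "sector \<alpha> = {z. cmod z * cos \<alpha> \<le> Re z}"
proof (intro set_eqI iffI)
  fix z assume "z \<in> sector \<alpha>"
  then obtain r \<theta> where z: "z = rcis r \<theta>" "0 \<le> r" "-\<alpha> \<le> \<theta>" "\<theta> \<le> \<alpha>" by (auto simp: sector_def)
  have "cos \<alpha> \<le> cos \<bar>\<theta>\<bar>" using z assms pi_gt_zero by (intro cos_monotone_0_pi_le) auto
  then show "z \<in> {z. cmod z * cos \<alpha> \<le> Re z}" using z(1,2) by (simp add: mult_left_mono)
next
  fix z assume z: "z \<in> {z. cmod z * cos \<alpha> \<le> Re z}"
  show "z \<in> sector \<alpha>"
  proof (cases "z = 0")
    case True
    then show ?thesis using assms by (auto simp: sector_def intro!: exI[of _ 0])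
  next
    case False
    have bounds: "- pi < Arg z" "Arg z \<le> pi" using Arg_bounded[of z] by auto
    have eq: "z = rcis (cmod z) (Arg z)" by (simp add: rcis_cmod_Arg)
    have "Re z = cmod z * cos (Arg z)" by (subst eq) simp
    then have "cos \<alpha> \<le> cos \<bar>Arg z\<bar>" using z False by simp
    then have "\<bar>Arg z\<bar> \<le> \<alpha>"
      using cos_monotone_0_pi[of \<alpha> "\<bar>Arg z\<bar>"] assms bounds by (force simp: not_le)
    then have "Arg z \<in> {-\<alpha>..\<alpha>}" by auto
    then show ?thesis using eq norm_ge_zero[of z] unfolding sector_def by blast
  qed
qed

lemma nonneg_axis_eq: "nonneg_axis = \<real> \<inter> {z. 0 \<le> Re z}"
  by (auto simp: nonneg_axis_def Reals_def)

lemma index_set_nonneg_axis: "index_set nonneg_axis"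
  by (simp add: index_set_def)

lemma index_set_cases [consumes 1, case_names nonneg real plane sector]:
  assumes "index_set \<Delta>"
  obtains "\<Delta> = nonneg_axis" | "\<Delta> = \<real>" | "\<Delta> = UNIV" |
    \<alpha> where "0 < \<alpha>" "\<alpha> \<le> pi / 2" "\<Delta> = {z. cmod z * cos \<alpha> \<le> Re z}"
  using assms sector_eq unfolding index_set_def by metis

lemma index_set_closed: "index_set \<Delta> \<Longrightarrow> closed \<Delta>"
  by (cases rule: index_set_cases)
    (auto simp: nonneg_axis_eq closed_complex_Reals intro!: closed_Int closed_Collect_le continuous_intros)

lemma index_set_add:
  assumes "index_set \<Delta>" "s \<in> \<Delta>" "t \<in> \<Delta>"
  shows "s + t \<in> \<Delta>"
  using assms(1)
proof (cases rule: index_set_cases)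
  case (sector \<alpha>)
  have "0 \<le> cos \<alpha>" using sector by (intro cos_ge_zero) auto
  then have "cmod (s + t) * cos \<alpha> \<le> (cmod s + cmod t) * cos \<alpha>"
    by (intro mult_right_mono norm_triangle_ineq)
  then show ?thesis using assms sector by (simp add: ring_distribs)
qed (use assms in \<open>auto simp: nonneg_axis_eq\<close>)

lemma index_set_scale:
  assumes "index_set \<Delta>" "t \<in> \<Delta>" "0 \<le> c"
  shows "of_real c * t \<in> \<Delta>"
  using assms(1)
proof (cases rule: index_set_cases)
  case (sector \<alpha>)
  then have "c * (cmod t * cos \<alpha>) \<le> c * Re t" using assms by (intro mult_left_mono) auto
  then show ?thesis using sector assms by (simp add: norm_mult mult.assoc)
qed (use assms in \<open>auto simp: nonneg_axis_eq Reals_mult\<close>)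

lemma index_set_of_real:
  assumes "index_set \<Delta>" "0 \<le> c" shows "of_real c \<in> \<Delta>"
  using assms(1)
proof (cases rule: index_set_cases)
  case (sector \<alpha>)
  then show ?thesis using assms by (simp add: mult_left_le)
qed (use assms in \<open>auto simp: nonneg_axis_eq\<close>)

text \<open>Translation invariance and additivity of Lebesgue measure, on the line or in the plane;
  in the one-dimensional case \<open>t\<close> is real, so the translates stay on the line.\<close>

lemma index_measure_Union_translates:
  fixes J :: "nat set"
  assumes \<Delta>: "index_set \<Delta>" and t: "t \<in> \<Delta>" and Q: "Q \<in> sets borel" "Q \<subseteq> \<Delta>" and J: "finite J"
    and disj: "\<And>i j u v. i \<in> J \<Longrightarrow> j \<in> J \<Longrightarrow> u \<in> Q \<Longrightarrow> v \<in> Q \<Longrightarrow>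
      of_nat i * t + u = of_nat j * t + v \<Longrightarrow> i = j"
    and sub: "\<And>j u. j \<in> J \<Longrightarrow> u \<in> Q \<Longrightarrow> of_nat j * t + u \<in> B" and B: "B \<in> sets borel"
  shows "of_nat (card J) * index_measure \<Delta> Q \<le> index_measure \<Delta> B"
proof (cases "\<Delta> \<subseteq> \<real>")
  case True
  then obtain c where c: "t = of_real c" using t by (auto simp: Reals_def)
  define Q' where "Q' = {r. complex_of_real r \<in> Q}"
  have "complex_of_real -` X \<inter> space borel \<in> sets borel" if "X \<in> sets borel" for X
    by (rule measurable_sets[OF _ that]) (intro borel_measurable_continuous_onI continuous_intros)
  then have borel: "{r. complex_of_real r \<in> X} \<in> sets borel" if "X \<in> sets borel" for X
    using that by (simp add: vimage_def)
  have meas: "(+) a ` Q' \<in> sets lebesgue" for a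
    using borel[OF Q(1)] by (intro lebesgue_sets_translation) (auto simp: Q'_def)
  have val: "emeasure lebesgue ((+) a ` Q') = emeasure lebesgue Q'" for a
    using emeasure_lebesgue_affine[of 1 a Q'] by (simp add: add.commute cong: image_cong_simp)
  have inj: "i = j" if "i \<in> J" "j \<in> J" "u \<in> Q'" "v \<in> Q'" "real i * c + u = real j * c + v" for i j u v
  proof (rule disj[OF that(1,2)])
    show "of_real u \<in> Q" "of_real v \<in> Q" using that(3,4) by (auto simp: Q'_def)
    have "complex_of_real (real i * c + u) = complex_of_real (real j * c + v)" by (simp only: that(5))
    then show "of_nat i * t + of_real u = of_nat j * t + of_real v" by (simp add: c)
  qed
  have "of_nat (card J) * emeasure lebesgue Q' = (\<Sum>j\<in>J. emeasure lebesgue ((+) (real j * c) ` Q'))"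
    by (simp add: val)
  also have "\<dots> = emeasure lebesgue (\<Union>j\<in>J. (+) (real j * c) ` Q')"
  proof (intro sum_emeasure[OF _ _ J])
    show "disjoint_family_on (\<lambda>j. (+) (real j * c) ` Q') J"
      unfolding disjoint_family_on_def
      by (intro ballI impI equals0I, elim IntE imageE) (use inj in metis)
  qed (use meas in blast)
  also have "\<dots> \<le> emeasure lebesgue {r. complex_of_real r \<in> B}"
    using borel[OF B] sub by (intro emeasure_mono) (auto simp: Q'_def c)
  finally show ?thesis using True by (simp add: index_measure_def Q'_def)
next
  case False
  have meas: "(+) a ` Q \<in> sets lebesgue" for a
    using Q(1) by (intro lebesgue_sets_translation) auto
  have val: "emeasure lebesgue ((+) a ` Q) = emeasure lebesgue Q" for a
    using emeasure_lebesgue_affine[of 1 a Q] by (simp add: add.commute cong: image_cong_simp)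
  have "of_nat (card J) * emeasure lebesgue Q = (\<Sum>j\<in>J. emeasure lebesgue ((+) (of_nat j * t) ` Q))"
    by (simp add: val)
  also have "\<dots> = emeasure lebesgue (\<Union>j\<in>J. (+) (of_nat j * t) ` Q)"
  proof (intro sum_emeasure[OF _ _ J])
    show "disjoint_family_on (\<lambda>j. (+) (of_nat j * t) ` Q) J"
      unfolding disjoint_family_on_def
      by (intro ballI impI equals0I, elim IntE imageE) (use disj in metis)
  qed (use meas in blast)
  also have "\<dots> \<le> emeasure lebesgue B"
    using B sub by (intro emeasure_mono) auto
  finally show ?thesis using False by (simp add: index_measure_def)
qed

text \<open>On the line the set contains \<open>[0, \<delta>]\<close>; in the plane it contains an
  open set around \<open>\<delta> / 2\<close>.\<close>

lemma index_measure_pos: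
  assumes \<Delta>: "index_set \<Delta>" and "0 < \<delta>"
  shows "0 < index_measure \<Delta> {u\<in>\<Delta>. cmod u \<le> \<delta>}"
proof (cases "\<Delta> \<subseteq> \<real>")
  case True
  have closed: "closed {r. complex_of_real r \<in> \<Delta> \<and> cmod (complex_of_real r) \<le> \<delta>}"
  proof -
    have "closed (complex_of_real -` (\<Delta> \<inter> cball 0 \<delta>))"
      using index_set_closed[OF \<Delta>] by (intro closed_vimage closed_Int continuous_intros) auto
    moreover have "complex_of_real -` (\<Delta> \<inter> cball 0 \<delta>) = {r. complex_of_real r \<in> \<Delta> \<and> cmod (complex_of_real r) \<le> \<delta>}"
      by auto
    ultimately show ?thesis by simp
  qed
  have "0 < emeasure lebesgue {0..\<delta>}" using assms(2) by simp
  also have "\<dots> \<le> emeasure lebesgue {r. complex_of_real r \<in> \<Delta> \<and> cmod (complex_of_real r) \<le> \<delta>}"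
  proof (rule emeasure_mono)
    show "{0..\<delta>} \<subseteq> {r. complex_of_real r \<in> \<Delta> \<and> cmod (complex_of_real r) \<le> \<delta>}"
      using index_set_of_real[OF \<Delta>] by auto
    show "{r. complex_of_real r \<in> \<Delta> \<and> cmod (complex_of_real r) \<le> \<delta>} \<in> sets lebesgue"
      using borel_closed[OF closed] by (simp del: norm_of_real)
  qed
  finally show ?thesis using True by (simp add: index_measure_def)
next
  case False
  \<comment> \<open>The whole plane is treated through the right half plane, the cone for
    \<open>\<alpha> = pi / 2\<close>.\<close>
  have "\<exists>\<alpha>>0. \<alpha> \<le> pi / 2 \<and> {z. cmod z * cos \<alpha> \<le> Re z} \<subseteq> \<Delta>"
    using \<Delta>
  proof (cases rule: index_set_cases)
    case plane
    then show ?thesis by (intro exI[of _ "pi / 2"]) auto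
  qed (use False in \<open>auto simp: nonneg_axis_eq\<close>)
  then obtain \<alpha> where \<alpha>: "0 < \<alpha>" "\<alpha> \<le> pi / 2" "{z. cmod z * cos \<alpha> \<le> Re z} \<subseteq> \<Delta>" by blast
  define O' where "O' = {z. cmod z * cos \<alpha> < Re z} \<inter> ball 0 \<delta>"
  have "open O'" unfolding O'_def by (intro open_Int open_Collect_less continuous_intros) auto
  moreover have "of_real (\<delta> / 2) \<in> O'"
  proof -
    have "cos \<alpha> < cos 0" using \<alpha> pi_gt_zero by (intro cos_monotone_0_pi) auto
    then show ?thesis using assms(2) by (simp add: O'_def)
  qed
  ultimately have "\<not> negligible O'" using open_not_negligible by blast
  moreover have "O' \<in> sets lebesgue" using \<open>open O'\<close> by (simp add: borel_open)
  ultimately have "0 < emeasure lebesgue O'" by (metis negligible_iff_emeasure0 zero_less_iff_neq_zero)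
  also have "\<dots> \<le> emeasure lebesgue {u\<in>\<Delta>. cmod u \<le> \<delta>}"
  proof (rule emeasure_mono)
    show "O' \<subseteq> {u\<in>\<Delta>. cmod u \<le> \<delta>}" using \<alpha>(3) by (auto simp: O'_def)
    have "closed (\<Delta> \<inter> cball 0 \<delta>)" using index_set_closed[OF \<Delta>] by auto
    moreover have "\<Delta> \<inter> cball 0 \<delta> = {u\<in>\<Delta>. cmod u \<le> \<delta>}" by auto
    ultimately show "{u\<in>\<Delta>. cmod u \<le> \<delta>} \<in> sets lebesgue" using borel_closed by auto
  qed
  finally show ?thesis using False by (simp add: index_measure_def)
qed

text \<open>A Baire argument replaces the equicontinuity of the operators \<open>T t\<close> for small \<open>t\<close>.\<close>

lemma open_subset_mapped_into:
  fixes T :: "complex \<Rightarrow> 'a::{ab_group_add, complete_space} \<Rightarrow> 'a"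
  assumes T: "C0_semigroup smul \<Delta> T" and \<Delta>: "0 \<in> \<Delta>" and V: "open V" "V \<noteq> {}"
  obtains V' \<delta> where "open V'" "V' \<noteq> {}" "0 < \<delta>"
    "\<And>u x. u \<in> \<Delta> \<Longrightarrow> cmod u \<le> \<delta> \<Longrightarrow> x \<in> V' \<Longrightarrow> T u x \<in> V"
proof -
  obtain x0 r where r: "0 < r" "cball x0 r \<subseteq> V"
    using V open_contains_cball by blast
  \<comment> \<open>The closed ball makes each \<open>F n\<close> closed. Strong continuity at 0
    puts every point of the open ball into some \<open>F n\<close>, so by Baire one of them has
    interior.\<close>
  define F where "F n = {x. \<forall>u\<in>\<Delta>. cmod u \<le> 1 / real (Suc n) \<longrightarrow> T u x \<in> cball x0 r}" for n
  have "closed (F n)" for n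
  proof -
    have "F n = (\<Inter>u\<in>{u\<in>\<Delta>. cmod u \<le> 1 / real (Suc n)}. T u -` cball x0 r)" by (auto simp: F_def)
    moreover have "closed (T u -` cball x0 r)" if "u \<in> \<Delta>" for u
      using T that by (intro closed_vimage) (auto simp: C0_semigroup_def continuous_linear_def)
    ultimately show ?thesis by auto
  qed
  have cover: "ball x0 r \<subseteq> (\<Union>n. F n)"
  proof
    fix x assume x: "x \<in> ball x0 r"
    have "continuous_on \<Delta> (\<lambda>t. T t x)" "T 0 x = x" using T by (auto simp: C0_semigroup_def)
    then obtain d where d: "0 < d" "\<And>u. u \<in> \<Delta> \<Longrightarrow> dist u 0 < d \<Longrightarrow> dist (T u x) x < r - dist x0 x"
      unfolding continuous_on_iff using \<Delta> x by (metis diff_gt_0_iff_gt mem_ball)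
    obtain n where n: "1 / real (Suc n) < d" using d(1) nat_approx_posE by metis
    have "T u x \<in> cball x0 r" if "u \<in> \<Delta>" "cmod u \<le> 1 / real (Suc n)" for u
    proof -
      have "dist (T u x) x < r - dist x0 x" using d(2)[of u] that n by simp
      then show ?thesis using dist_triangle[of x0 "T u x" x] by (simp add: dist_commute)
    qed
    then show "x \<in> (\<Union>n. F n)" by (auto simp: F_def)
  qed
  have "\<exists>n. interior (F n) \<noteq> {}"
  proof (rule ccontr)
    assume "\<not> ?thesis"
    then have "euclidean interior_of \<Union>(range F) = {}"
      using \<open>\<And>n. closed (F n)\<close> completely_metrizable_space_euclidean
      by (intro Baire_category_alt) (auto simp: interior_of_def interior_def)
    then have "interior (\<Union>n. F n) = {}" by (auto simp: interior_of_def interior_def)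
    moreover have "ball x0 r \<subseteq> interior (\<Union>n. F n)" using cover by (simp add: interior_maximal)
    ultimately show False using r(1) by auto
  qed
  then obtain n where n: "interior (F n) \<noteq> {}" by blast
  show ?thesis
  proof (rule that[OF open_interior n])
    show "0 < 1 / real (Suc n)" by simp
    show "T u x \<in> V" if "u \<in> \<Delta>" "cmod u \<le> 1 / real (Suc n)" "x \<in> interior (F n)" for u x
      using that r(2) interior_subset[of "F n"] by (auto simp: F_def subset_eq)
  qed
qed

section \<open>From one operator to the whole semigroup\<close>

lemma C0_semigroup_power:
  assumes T: "C0_semigroup smul \<Delta> T" and \<Delta>: "index_set \<Delta>" and t: "t \<in> \<Delta>"
  shows "(T t ^^ n) x = T (of_nat n * t) x"
proof (induction n)
  case 0
  then show ?case using T by (simp add: C0_semigroup_def)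
next
  case (Suc n)
  have "of_nat n * t \<in> \<Delta>" using index_set_scale[OF \<Delta> t, of "real n"] by simp
  then have "T (t + of_nat n * t) = T t \<circ> T (of_nat n * t)" using T t by (simp add: C0_semigroup_def)
  then show ?case using Suc by (simp add: ring_distribs)
qed

text \<open>Points \<open>j * t\<close> with distinct \<open>j\<close> are at least 1/2 apart, so
  translates of a set of radius at most 1/8 are disjoint. For \<open>j \<ge> 1\<close> the bound
  \<open>j / 2 + 1/8 \<le> j\<close> keeps a translate inside the disc whose radius bounds
  \<open>j\<close>.\<close>

lemma f_frequently_hypercyclic_if_operator:
  fixes T :: "complex \<Rightarrow> 'a::{ab_group_add, complete_space} \<Rightarrow> 'a"
  assumes T: "C0_semigroup smul \<Delta> T" and \<Delta>: "index_set \<Delta>"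
    and f_mono: "mono_on {0..} f" and m: "\<And>k. m k = f (real k)"
    and t: "t \<in> \<Delta>" "cmod t = 1 / 2" and hc: "l_frequently_hypercyclic m (T t)"
  shows "f_frequently_hypercyclic f \<Delta> T"
proof -
  obtain x where x: "\<And>V. open V \<Longrightarrow> V \<noteq> {} \<Longrightarrow> lower_m_density m {n. 1 \<le> n \<and> (T t ^^ n) x \<in> V} > 0"
    using hc unfolding l_frequently_hypercyclic_def by blast
  have zero: "0 \<in> \<Delta>" using index_set_of_real[OF \<Delta>, of 0] by simp
  show ?thesis
    unfolding f_frequently_hypercyclic_def
  proof (intro exI[of _ x] allI impI, elim conjE)
    fix V :: "'a set" assume V: "open V" "V \<noteq> {}"
    obtain V' \<delta>0 where V': "open V'" "V' \<noteq> {}" "0 < \<delta>0"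
      "\<And>u x. u \<in> \<Delta> \<Longrightarrow> cmod u \<le> \<delta>0 \<Longrightarrow> x \<in> V' \<Longrightarrow> T u x \<in> V"
      using open_subset_mapped_into[OF T zero V] by blast
    define \<delta> where "\<delta> = min \<delta>0 (1/8)"
    have \<delta>: "0 < \<delta>" "\<delta> \<le> \<delta>0" "\<delta> \<le> 1/8" using V'(3) by (auto simp: \<delta>_def)
    define Q where "Q = {u\<in>\<Delta>. cmod u \<le> \<delta>}"
    have "closed (\<Delta> \<inter> cball 0 \<delta>)" using index_set_closed[OF \<Delta>] by auto
    moreover have "\<Delta> \<inter> cball 0 \<delta> = Q" by (auto simp: Q_def)
    ultimately have Q: "Q \<in> sets borel" using borel_closed by auto
    define H where "H = {n. 1 \<le> n \<and> (T t ^^ n) x \<in> V'}"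
    define J where "J n = {j \<in> H. 1 \<le> j \<and> real j \<le> m n}" for n
    have J_fin: "finite (J n)" for n
    proof (rule finite_subset)
      show "J n \<subseteq> {..nat \<lfloor>m n\<rfloor>}" by (auto simp: J_def le_nat_floor)
    qed simp
    obtain c where c: "0 < ereal c" "ereal c < lower_m_density m H"
      using x[OF V'(1,2)] ereal_dense2 unfolding H_def by blast
    have "\<forall>\<^sub>F n in sequentially. ereal c < ereal (real (card (J n)) / real n)"
      using less_LiminfD[OF c(2)[unfolded lower_m_density_def]] by (simp add: J_def)
    then obtain n0 where n0: "\<And>n. n0 \<le> n \<Longrightarrow> c < real (card (J n)) / real n"
      by (auto simp: eventually_sequentially)
    define B where "B s = {z\<in>\<Delta>. T z x \<in> V} \<inter> {z\<in>\<Delta>. cmod z \<le> f s}" for s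
    have B: "B s \<in> sets borel" for s
    proof -
      have "continuous_on \<Delta> (\<lambda>z. T z x)" using T by (simp add: C0_semigroup_def)
      from this[unfolded continuous_on_open_invariant, rule_format, OF V(1)]
      obtain O' where "open O'" "O' \<inter> \<Delta> = (\<lambda>z. T z x) -` V \<inter> \<Delta>" by blast
      then have "B s = O' \<inter> \<Delta> \<inter> cball 0 (f s)" by (auto simp: B_def)
      then show ?thesis using \<open>open O'\<close> index_set_closed[OF \<Delta>] by (auto intro: borel_open borel_closed)
    qed
    have step: "of_nat (card (J n)) * index_measure \<Delta> Q \<le> index_measure \<Delta> (B s)" if "real n \<le> s" for n s
    proof (rule index_measure_Union_translates[OF \<Delta> t(1) Q _ J_fin _ _ B])
      show "Q \<subseteq> \<Delta>" by (auto simp: Q_def)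
      show "i = j" if "u \<in> Q" "v \<in> Q" "of_nat i * t + u = of_nat j * t + v" for i j u v
      proof -
        have "(of_nat i - of_nat j) * t = v - u" using that(3) by (simp add: algebra_simps)
        then have "cmod ((of_nat i - of_nat j) * t) \<le> 1 / 4"
          using that(1,2) \<delta>(3) norm_triangle_ineq4[of v u] by (auto simp: Q_def)
        moreover have "cmod (of_nat i - of_nat j) = \<bar>real i - real j\<bar>"
          by (metis norm_of_real of_real_diff of_real_of_nat_eq)
        ultimately have "\<bar>real i - real j\<bar> \<le> 1 / 2" by (simp add: norm_mult t(2))
        then show "i = j" by linarith
      qed
      show "of_nat j * t + u \<in> B s" if "j \<in> J n" "u \<in> Q" for j u
      proof -
        have j: "1 \<le> j" "real j \<le> m n" "T (of_nat j * t) x \<in> V'"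
          using that(1) by (auto simp: J_def H_def C0_semigroup_power[OF T \<Delta> t(1)])
        have u: "u \<in> \<Delta>" "cmod u \<le> \<delta>" using that(2) by (auto simp: Q_def)
        have jt: "of_nat j * t \<in> \<Delta>" using index_set_scale[OF \<Delta> t(1), of "real j"] by simp
        have "T (u + of_nat j * t) = T u \<circ> T (of_nat j * t)" using T u(1) jt by (simp add: C0_semigroup_def)
        then have "T (of_nat j * t + u) x \<in> V" using V'(4)[OF u(1) _ j(3)] u(2) \<delta>(2) by (simp add: add.commute)
        moreover have "cmod (of_nat j * t + u) \<le> f s"
        proof -
          have "cmod (of_nat j * t + u) \<le> real j / 2 + 1/8"
            using norm_triangle_ineq[of "of_nat j * t" u] u(2) \<delta>(3) by (simp add: norm_mult t(2))
          also have "\<dots> \<le> m n" using j by simp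
          also have "\<dots> \<le> f s" using \<open>real n \<le> s\<close> by (simp add: m mono_onD[OF f_mono])
          finally show ?thesis .
        qed
        moreover have "of_nat j * t + u \<in> \<Delta>" by (rule index_set_add[OF \<Delta> jt u(1)])
        ultimately show ?thesis by (simp add: B_def)
      qed
    qed
    have "0 < index_measure \<Delta> Q" unfolding Q_def by (rule index_measure_pos[OF \<Delta> \<delta>(1)])
    then obtain b where b: "0 < b" "b < index_measure \<Delta> Q" using dense by blast
    then obtain \<mu> where \<mu>: "0 < \<mu>" "ennreal \<mu> < index_measure \<Delta> Q"
      by (cases b) (auto simp: ennreal_less_zero_iff)
    have bound: "ennreal (c / 2 * \<mu>) \<le> index_measure \<Delta> (B s) / ennreal s" if s: "real (Suc n0) \<le> s" for s
    proof -
      \<comment> \<open>Rounding \<open>s\<close> down keeps \<open>f (real n) \<le> f s\<close>;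
        since \<open>s < n + 1 \<le> 2 * n\<close>, it costs the factor 1/2 in the density.\<close>
      define n where "n = nat \<lfloor>s\<rfloor>"
      have n: "real n \<le> s" "s < real n + 1" "1 \<le> n" "n0 \<le> n" using s by (auto simp: n_def) linarith+
      have "c * real n < real (card (J n))" using n0[OF n(4)] n(3) by (simp add: field_simps)
      moreover have "c / 2 * s \<le> c * real n" using n c(1) by simp
      ultimately have "c / 2 * s \<le> real (card (J n))" by linarith
      then have "ennreal (c / 2 * \<mu> * s) \<le> ennreal (real (card (J n)) * \<mu>)"
        using \<mu>(1) by (intro ennreal_leI) (metis less_imp_le mult.assoc mult.commute mult_left_mono)
      also have "\<dots> = of_nat (card (J n)) * ennreal \<mu>"
        using \<mu>(1) by (simp add: ennreal_mult ennreal_of_nat_eq_real_of_nat)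
      also have "\<dots> \<le> of_nat (card (J n)) * index_measure \<Delta> Q"
        using \<mu>(2) by (intro mult_left_mono) auto
      also have "\<dots> \<le> index_measure \<Delta> (B s)" by (rule step[OF n(1)])
      finally have "ennreal (c / 2 * \<mu> * s) / ennreal s \<le> index_measure \<Delta> (B s) / ennreal s"
        by (rule divide_right_mono_ennreal)
      then show ?thesis using s c(1) \<mu>(1) by (simp add: divide_ennreal)
    qed
    have "ennreal (c / 2 * \<mu>) \<le> lower_f_density f \<Delta> {t\<in>\<Delta>. T t x \<in> V}"
      unfolding lower_f_density_def B_def[symmetric]
      by (rule Liminf_bounded) (use bound in \<open>auto simp: eventually_at_top_linorder\<close>)
    moreover have "0 < ennreal (c / 2 * \<mu>)" using c(1) \<mu>(1) by simp
    ultimately show "0 < lower_f_density f \<Delta> {t\<in>\<Delta>. T t x \<in> V}" by (rule less_le_trans[rotated])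
  qed
qed

text \<open>The argument runs over the reals; real scalar multiplication is the restriction of
  \<open>smul\<close>.\<close>

lemma separable_frechet_space_frechet:
  fixes smul :: "'k::real_normed_field \<Rightarrow> 'a::{real_vector, complete_space} \<Rightarrow> 'a"
  assumes "separable_frechet_space smul"
  shows "frechet TYPE('a)"
proof
  from assms have of_real: "\<And>r x. smul (of_real r) x = r *\<^sub>R x"
    and cont: "continuous_on UNIV (\<lambda>(c, x). smul c x)"
    and other: "\<And>x y z::'a. dist (x + z) (y + z) = dist x y"
      "\<And>U::'a set. open U \<Longrightarrow> 0 \<in> U \<Longrightarrow> \<exists>V. open V \<and> convex V \<and> 0 \<in> V \<and> V \<subseteq> U"
    unfolding separable_frechet_space_def by auto
  have "continuous_on UNIV (\<lambda>z::real \<times> 'a. case (of_real (fst z), snd z) of (c, x) \<Rightarrow> smul c x)"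
    by (intro continuous_on_compose2[OF cont] continuous_intros) auto
  then show "continuous_on UNIV (\<lambda>(c::real, x::'a). c *\<^sub>R x)"
    by (simp add: of_real case_prod_beta)
  show "dist (x + z) (y + z) = dist x y" for x y z :: 'a by (rule other(1))
  show "open U \<Longrightarrow> 0 \<in> U \<Longrightarrow> \<exists>V. open V \<and> convex V \<and> 0 \<in> V \<and> V \<subseteq> U" for U :: "'a set"
    by (rule other(2))
qed

lemma continuous_linear_linear:
  fixes smul :: "'k::real_normed_field \<Rightarrow> 'a::{real_vector, complete_space} \<Rightarrow> 'a"
  assumes "separable_frechet_space smul" "continuous_linear smul T"
  shows "linear T"
proof (rule linearI)
  interpret Vector_Spaces.linear smul smul T using assms(2) by (simp add: continuous_linear_def)
  have of_real: "smul (of_real r) x = r *\<^sub>R x" for r x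
    using assms(1) by (simp add: separable_frechet_space_def)
  show "T (x + y) = T x + T y" for x y by (rule add)
  show "T (r *\<^sub>R x) = r *\<^sub>R T x" for r x using scale[of "of_real r" x] by (simp add: of_real)
qed

theorem theorem2p9:
  fixes scale :: "'k::real_normed_field \<Rightarrow> 'a::{real_vector, complete_space} \<Rightarrow> 'a"
    and \<Delta> :: "complex set"
    and T S :: "complex \<Rightarrow> 'a \<Rightarrow> 'a"
    and f :: "real \<Rightarrow> real"
    and m :: "nat \<Rightarrow> real"
    and E\<^sub>0 :: "'a set"
  assumes E: "separable_frechet_space scale"
    and \<Delta>: "index_set \<Delta>"
    and T: "C0_semigroup scale \<Delta> T"
    and f_ge: "\<And>t. 0 \<le> t \<Longrightarrow> 1 \<le> f t"
    and f_mono: "mono_on {0..} f"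
    and m: "\<And>k. m k = f (real k)"
    and dense: "closure E\<^sub>0 = UNIV"
    and T_inv: "\<And>t. t \<in> \<Delta> \<Longrightarrow> T t ` E\<^sub>0 \<subseteq> E\<^sub>0"
    and S_maps: "\<And>t. t \<in> \<Delta> \<Longrightarrow> S t ` E\<^sub>0 \<subseteq> E\<^sub>0"
    and i_inverse: "\<And>t x. t \<in> \<Delta> \<Longrightarrow> x \<in> E\<^sub>0 \<Longrightarrow> T t (S t x) = x"
    and i_ray: "\<And>r t x. r \<in> \<Delta> - {0} \<Longrightarrow> t \<in> \<Delta> - {0} \<Longrightarrow> Arg r = Arg t \<Longrightarrow> cmod r > cmod t \<Longrightarrow> x \<in> E\<^sub>0 \<Longrightarrow>
          S r (T t x) = S (r - t) x \<and> T t (S r x) = S (r - t) x"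
    and ii: "\<And>t\<^sub>0 s x. t\<^sub>0 \<in> \<Delta> - {0} \<Longrightarrow> 0 \<le> s \<Longrightarrow> x \<in> E\<^sub>0 \<Longrightarrow>
          uniformly_uncond_convergent {1..}
            (\<lambda>n k. if n \<le> k
                   then frechet_integral (lebesgue_on ((\<lambda>b. s + b) ` B_interval m k n))
                          (\<lambda>t. T (of_real t * rcis (cmod t\<^sub>0) (Arg t\<^sub>0)) x)
                   else 0)"
    and iii_args: "\<And>t\<^sub>0 k n t. t\<^sub>0 \<in> \<Delta> - {0} \<Longrightarrow> 1 \<le> k \<Longrightarrow> 1 \<le> n \<Longrightarrow> t \<in> A_interval m k n \<Longrightarrow>
          of_real t * rcis (cmod t\<^sub>0) (Arg t\<^sub>0) \<in> \<Delta>"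
    and iii_integrable: "\<And>t\<^sub>0 k n x. t\<^sub>0 \<in> \<Delta> - {0} \<Longrightarrow> 1 \<le> k \<Longrightarrow> 1 \<le> n \<Longrightarrow> x \<in> E\<^sub>0 \<Longrightarrow>
          frechet_integrable (lebesgue_on (A_interval m k n))
            (\<lambda>t. S (of_real t * rcis (cmod t\<^sub>0) (Arg t\<^sub>0)) x)"
    and iii_convergent: "\<And>t\<^sub>0 x. t\<^sub>0 \<in> \<Delta> - {0} \<Longrightarrow> x \<in> E\<^sub>0 \<Longrightarrow>
          uniformly_uncond_convergent {1..}
            (\<lambda>n k. frechet_integral (lebesgue_on (A_interval m k n))
                     (\<lambda>t. S (of_real t * rcis (cmod t\<^sub>0) (Arg t\<^sub>0)) x))"
  shows "f_frequently_hypercyclic f \<Delta> T \<and>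
    (\<forall>t\<^sub>0 \<in> \<Delta> - {0}.
       f_frequently_hypercyclic f nonneg_axis (\<lambda>t. T (t * cis (Arg t\<^sub>0))) \<and>
       l_frequently_hypercyclic m (T t\<^sub>0))"
proof -
  have orbit: "continuous_on \<Delta> (\<lambda>t. T t x)" for x using T by (simp add: C0_semigroup_def)
  have ray: "l_frequently_hypercyclic m (T t\<^sub>0)" if t0: "t\<^sub>0 \<in> \<Delta> - {0}" for t\<^sub>0
  proof -
    have t0': "t\<^sub>0 \<in> \<Delta>" "t\<^sub>0 \<noteq> 0" using t0 by auto
    have rcis: "rcis (cmod z) (Arg z) = z" for z by (rule rcis_cmod_Arg)
    have in_\<Delta>: "of_real s * t\<^sub>0 \<in> \<Delta>" if "0 \<le> s" for s by (rule index_set_scale[OF \<Delta> t0'(1) that])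
    have T_ops: "continuous_linear scale (T t)" if "t \<in> \<Delta>" for t using T that by (simp add: C0_semigroup_def)
    define U where "U s = T (of_real s * t\<^sub>0)" for s :: real
    define S' where "S' s = S (of_real s * t\<^sub>0)" for s :: real
    have "ray_criterion U S' E\<^sub>0 m"
    proof (intro ray_criterion.intro separable_frechet_space_frechet[OF E] ray_criterion_axioms.intro)
      fix s :: real assume s: "0 \<le> s"
      show "linear (U s)" unfolding U_def by (intro continuous_linear_linear[OF E] T_ops in_\<Delta> s)
      show "continuous_on UNIV (U s)"
        using T_ops[OF in_\<Delta>[OF s]] by (simp add: U_def continuous_linear_def)
      show "U (s + t) x = U s (U t x)" if "0 \<le> t" for t x
        using T in_\<Delta>[OF s] in_\<Delta>[OF that] by (simp add: U_def C0_semigroup_def ring_distribs)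
      show "U s x \<in> E\<^sub>0" if "x \<in> E\<^sub>0" for x using T_inv[OF in_\<Delta>[OF s]] that by (auto simp: U_def)
      show "U s (S' s x) = x" if "x \<in> E\<^sub>0" for x
        using i_inverse[OF in_\<Delta>[OF s] that] by (simp add: U_def S'_def)
    next
      show "U 0 = id" using T by (simp add: U_def C0_semigroup_def)
      show "continuous_on {0..} (\<lambda>s. U s x)" for x
        unfolding U_def by (rule continuous_on_compose2[OF orbit]) (auto intro!: continuous_intros in_\<Delta>)
      show "closure E\<^sub>0 = UNIV" by (rule dense)
    next
      fix t r :: real and x assume tr: "0 < t" "t < r" and x: "x \<in> E\<^sub>0"
      have "T (of_real t * t\<^sub>0) (S (of_real r * t\<^sub>0) x) = S (of_real r * t\<^sub>0 - of_real t * t\<^sub>0) x"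
        using tr t0' in_\<Delta>[of r] in_\<Delta>[of t] by (intro i_ray[THEN conjunct2] x) (auto simp: norm_mult Arg_times_of_real)
      then show "U t (S' r x) = S' (r - t) x" by (simp add: U_def S'_def ring_distribs)
    next
      show "1 \<le> m k" for k using f_ge by (simp add: m)
      show "mono m" using f_mono by (auto simp: mono_def m mono_on_def)
    next
      fix q :: nat and x assume q: "1 \<le> q" and x: "x \<in> E\<^sub>0"
      \<comment> \<open>Condition (ii) enters with \<open>s = 0\<close>, but for all the points
        \<open>t\<^sub>0 / q\<close> on the ray.\<close>
      have "of_real (1 / real q) * t\<^sub>0 \<in> \<Delta> - {0}" using in_\<Delta>[of "1 / real q"] t0' q by auto
      note ii = ii[OF this order_refl x]
      have uq: "U (t / real q) x = T (of_real t * (of_real (1 / real q) * t\<^sub>0)) x" for t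
        by (simp add: U_def)
      from ii
      show "uniformly_uncond_convergent {1..} (\<lambda>n k. if n \<le> k
          then frechet_integral (lebesgue_on (B_interval m k n)) (\<lambda>t. U (t / real q) x) else 0)"
        unfolding rcis uq by (simp only: image_add_0)
    next
      fix x assume x: "x \<in> E\<^sub>0"
      show "frechet_integrable (lebesgue_on (A_interval m k n)) (\<lambda>t. S' t x)" if "1 \<le> k" "1 \<le> n" for k n
        using iii_integrable[OF t0 that x] unfolding rcis by (simp add: S'_def)
      show "uniformly_uncond_convergent {1..}
          (\<lambda>n k. frechet_integral (lebesgue_on (A_interval m k n)) (\<lambda>t. S' t x))"
        using iii_convergent[OF t0 x] unfolding rcis by (simp add: S'_def)
    next
      show "\<exists>C::'a set. countable C \<and> closure C = UNIV"
        using E by (auto simp: separable_frechet_space_def separable_space_def)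
      have span: "vector_space scale" "module.span scale {} \<noteq> UNIV"
        using E unfolding separable_frechet_space_def by blast+
      interpret vector_space scale by (rule span(1))
      show "\<exists>x::'a. x \<noteq> 0" using span(2) by auto
    qed
    from ray_criterion.l_frequently_hypercyclic_U[OF this] show ?thesis by (simp add: U_def)
  qed
  \<comment> \<open>Every index set contains the nonnegative reals, so 1/2 is a point of the
    required modulus in each case.\<close>
  have "1 / 2 \<in> \<Delta>" using index_set_of_real[OF \<Delta>, of "1 / 2"] by simp
  then have "f_frequently_hypercyclic f \<Delta> T"
    by (intro f_frequently_hypercyclic_if_operator[OF T \<Delta> f_mono m, of "1 / 2"] ray) auto
  moreover have "f_frequently_hypercyclic f nonneg_axis (\<lambda>t. T (t * cis (Arg t\<^sub>0)))" if t0: "t\<^sub>0 \<in> \<Delta> - {0}" for t\<^sub>0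
  proof -
    have c: "cis (Arg t\<^sub>0) = of_real (1 / cmod t\<^sub>0) * t\<^sub>0"
      using t0 by (simp add: cis_Arg sgn_div_norm scaleR_conv_of_real divide_inverse mult.commute)
    have in_\<Delta>: "t * cis (Arg t\<^sub>0) \<in> \<Delta>" if t: "t \<in> nonneg_axis" for t
    proof -
      obtain r where r: "0 \<le> r" "t = of_real r" using t by (auto simp: nonneg_axis_def)
      have "t * cis (Arg t\<^sub>0) = of_real (r / cmod t\<^sub>0) * t\<^sub>0" by (simp add: c r(2))
      then show ?thesis using index_set_scale[OF \<Delta>, of t\<^sub>0 "r / cmod t\<^sub>0"] t0 r(1) by simp
    qed
    have C0: "C0_semigroup scale nonneg_axis (\<lambda>t. T (t * cis (Arg t\<^sub>0)))"
      unfolding C0_semigroup_def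
    proof (intro conjI ballI allI)
      show "continuous_linear scale (T (t * cis (Arg t\<^sub>0)))" if "t \<in> nonneg_axis" for t
        using T in_\<Delta>[OF that] by (simp add: C0_semigroup_def)
      show "T (0 * cis (Arg t\<^sub>0)) = id" using T by (simp add: C0_semigroup_def)
      show "T ((t + s) * cis (Arg t\<^sub>0)) = T (t * cis (Arg t\<^sub>0)) \<circ> T (s * cis (Arg t\<^sub>0))"
        if "t \<in> nonneg_axis" "s \<in> nonneg_axis" for t s
        using T in_\<Delta>[OF that(1)] in_\<Delta>[OF that(2)] by (simp add: C0_semigroup_def ring_distribs)
      show "continuous_on nonneg_axis (\<lambda>t. T (t * cis (Arg t\<^sub>0)) x)" for x
        by (rule continuous_on_compose2[OF orbit]) (auto intro!: continuous_intros in_\<Delta>)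
    qed
    have half: "1 / 2 \<in> nonneg_axis" using index_set_of_real[OF index_set_nonneg_axis, of "1 / 2"] by simp
    \<comment> \<open>The operator of the rotated semigroup at time 1/2 is \<open>T\<close> at a
      nonzero point of \<open>\<Delta>\<close>, to which \<open>ray\<close> applies.\<close>
    have "1 / 2 * cis (Arg t\<^sub>0) \<in> \<Delta> - {0}" using in_\<Delta>[OF half] by simp
    from ray[OF this] show ?thesis
      by (intro f_frequently_hypercyclic_if_operator[OF C0 index_set_nonneg_axis f_mono m half]) auto
  qed
  ultimately show ?thesis using ray by blast
qed

end
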